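(* Let $d\ge 2$, let $\omega\subset\mathbb R^{d-1}$ be a bounded Lipschitz set, and let $\Omega_\varepsilon=\omega\times(0,\varepsilon)$ for $\varepsilon>0$. Let $s_\varepsilon\in(0,\frac12)$ with $s_\varepsilon\to s_0\in[0,\frac12)$ as $\varepsilon\to0$. Then the functionals $$E_\varepsilon(u)=\frac{1}{\varepsilon^{1-2s_\varepsilon}}\lfloor u\rfloor_{s_\varepsilon}^2(\Omega_\varepsilon),\qquad u\in H^{s_\varepsilon}(\Omega_\varepsilon),$$ $\Gamma$-converge as $\varepsilon\to0$, with respect to the convergence $u_\varepsilon\to v$ defined by $v_\varepsilon\to v$ in $L^2_{\rm loc}(\omega\times(0,1))$, where $v_\varepsilon(x',x_d)=u_\varepsilon(x',\varepsilon x_d)$, to the functional $$E(v)=C_{s_0,d}\int_{\omega}\int_0^1\int_0^1\frac{|v(x',x_d)-v(x',y_d)|^2}{|x_d-y_d|^{1+2s_0}}\,dx_d\,dy_d\,dx'\in[0,+\infty],\qquad v\in L^2_{\rm loc}(\omega\times(0,1)),$$ where $$C_{s,d}=\int_{\mathbb R^{d-1}}\frac{1}{(1+|\xi|^2)^{\frac d2+s}}\,d\xi.$$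
   Context: "Bounded Lipschitz set" means a bounded open set with Lipschitz boundary. Points of $\mathbb R^d$ are written $x=(x',x_d)$ with $x'\in\mathbb R^{d-1}$. For measurable $A\subset\mathbb R^d$ and $s\in(0,1)$, the squared seminorm is $\lfloor u\rfloor_s^2(A)=\int_A\int_A\frac{|u(x)-u(y)|^2}{|x-y|^{d+2s}}\,dx\,dy$. $\Gamma$-convergence with respect to the stated convergence means: for every $v$, (1) $\liminf_{\varepsilon\to0}E_\varepsilon(u_\varepsilon)\ge E(v)$ whenever $u_\varepsilon\to v$; (2) there exist $u_\varepsilon\to v$ with $\limsup_{\varepsilon\to0}E_\varepsilon(u_\varepsilon)\le E(v)$. *)

theory Defs
  imports "HOL-Analysis.Analysis"
begin

text \<open>
  The space of the points \<open>x'\<close>, of dimension \<open>d - 1 \<ge> 1\<close>, is an arbitrary type \<open>'a\<close> of class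
  \<^class>\<open>euclidean_space\<close>. Points \<open>x = (x', x\<^sub>d)\<close> live in \<open>'a \<times> real\<close>, whose library norm is the Euclidean
  one and whose dimension is \<open>DIM('a) + 1 = d\<close>.

  Functions are total. Only their values on the set under consideration matter, because
  measurability and integrals refer to \<open>lebesgue_on A\<close>. All functionals take values in \<open>ennreal\<close>.
\<close>

text \<open>
  The boundary is Lipschitz if, near each of its points, the set is the strict subgraph of a
  Lipschitz function in a rotated frame: \<open>e\<close> is the vertical direction of the frame and \<open>g\<close> is a
  function on the hyperplane orthogonal to \<open>e\<close>. Since \<open>g\<close> is continuous, the boundary then
  coincides locally with the graph.
\<close>

definition lipschitz_boundary :: "'a::euclidean_space set \<Rightarrow> bool" where
  "lipschitz_boundary S \<longleftrightarrow>
     (\<forall>z\<in>frontier S. \<exists>e r g L. norm e = 1 \<and> 0 < r \<and> L-lipschitz_on {y. y \<bullet> e = 0} g \<and>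
        S \<inter> ball z r = {y \<in> ball z r. y \<bullet> e < g (y - (y \<bullet> e) *\<^sub>R e)})"

definition bounded_lipschitz_set :: "'a::euclidean_space set \<Rightarrow> bool" where
  "bounded_lipschitz_set S \<longleftrightarrow> open S \<and> bounded S \<and> lipschitz_boundary S"

definition L2 :: "'a::euclidean_space set \<Rightarrow> ('a \<Rightarrow> real) set" where
  "L2 A = {u \<in> borel_measurable (lebesgue_on A).
             (\<integral>\<^sup>+x. ennreal (\<bar>u x\<bar>\<^sup>2) \<partial>lebesgue_on A) < \<infinity>}"

definition L2_loc :: "'a::euclidean_space set \<Rightarrow> ('a \<Rightarrow> real) set" where
  "L2_loc A = {u \<in> borel_measurable (lebesgue_on A). \<forall>K. compact K \<and> K \<subseteq> A \<longrightarrow> u \<in> L2 K}"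

definition L2_loc_tendsto ::
    "'a::euclidean_space set \<Rightarrow> ('i \<Rightarrow> 'a \<Rightarrow> real) \<Rightarrow> ('a \<Rightarrow> real) \<Rightarrow> 'i filter \<Rightarrow> bool" where
  "L2_loc_tendsto A w v F \<longleftrightarrow>
     (\<forall>K. compact K \<and> K \<subseteq> A \<longrightarrow>
        ((\<lambda>i. \<integral>\<^sup>+x. ennreal (\<bar>w i x - v x\<bar>\<^sup>2) \<partial>lebesgue_on K) \<longlongrightarrow> 0) F)"

definition seminorm_sq :: "real \<Rightarrow> 'a::euclidean_space set \<Rightarrow> ('a \<Rightarrow> real) \<Rightarrow> ennreal" where
  "seminorm_sq s A u =
     (\<integral>\<^sup>+x. (\<integral>\<^sup>+y. ennreal (\<bar>u x - u y\<bar>\<^sup>2 / norm (x - y) powr (real DIM('a) + 2 * s))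
        \<partial>lebesgue_on A) \<partial>lebesgue_on A)"

definition Hs :: "real \<Rightarrow> 'a::euclidean_space set \<Rightarrow> ('a \<Rightarrow> real) set" where
  "Hs s A = {u \<in> L2 A. seminorm_sq s A u < \<infinity>}"

text \<open>
  \<open>D \<epsilon>\<close> is the domain of \<open>E\<^sub>\<epsilon>\<close>, \<open>X\<close> is the domain of the limit functional, and \<open>conv\<close> is the
  notion of convergence of a family indexed by \<open>\<epsilon> > 0\<close> to an element of \<open>X\<close>.
\<close>

definition gamma_converges ::
    "(real \<Rightarrow> 'u set) \<Rightarrow> (real \<Rightarrow> 'u \<Rightarrow> ennreal) \<Rightarrow> ((real \<Rightarrow> 'u) \<Rightarrow> 'v \<Rightarrow> bool) \<Rightarrow>
     'v set \<Rightarrow> ('v \<Rightarrow> ennreal) \<Rightarrow> bool" where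
  "gamma_converges D E\<epsilon> conv X E \<longleftrightarrow>
     (\<forall>v\<in>X.
        (\<forall>u. (\<forall>\<epsilon>>0. u \<epsilon> \<in> D \<epsilon>) \<and> conv u v \<longrightarrow>
           E v \<le> Liminf (at_right 0) (\<lambda>\<epsilon>. E\<epsilon> \<epsilon> (u \<epsilon>))) \<and>
        (\<exists>u. (\<forall>\<epsilon>>0. u \<epsilon> \<in> D \<epsilon>) \<and> conv u v \<and>
           Limsup (at_right 0) (\<lambda>\<epsilon>. E\<epsilon> \<epsilon> (u \<epsilon>)) \<le> E v))"

definition thin_domain :: "'a::euclidean_space set \<Rightarrow> real \<Rightarrow> ('a \<times> real) set" where
  "thin_domain \<omega> \<epsilon> = \<omega> \<times> {0<..<\<epsilon>}"

definition thin_energy ::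
    "'a::euclidean_space set \<Rightarrow> (real \<Rightarrow> real) \<Rightarrow> real \<Rightarrow> ('a \<times> real \<Rightarrow> real) \<Rightarrow> ennreal" where
  "thin_energy \<omega> s \<epsilon> u =
     ennreal (1 / \<epsilon> powr (1 - 2 * s \<epsilon>)) * seminorm_sq (s \<epsilon>) (thin_domain \<omega> \<epsilon>) u"

definition thin_conv ::
    "'a::euclidean_space set \<Rightarrow> (real \<Rightarrow> 'a \<times> real \<Rightarrow> real) \<Rightarrow> ('a \<times> real \<Rightarrow> real) \<Rightarrow> bool" where
  "thin_conv \<omega> u v \<longleftrightarrow>
     L2_loc_tendsto (\<omega> \<times> {0<..<1}) (\<lambda>\<epsilon> (x', t). u \<epsilon> (x', \<epsilon> * t)) v (at_right 0)"

text \<open>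
  The type argument \<open>'a\<close> is the space \<open>\<real>\<^sup>d\<^sup>-\<^sup>1\<close> of integration, so \<open>d = DIM('a) + 1\<close>.
\<close>

definition C_const :: "'a::euclidean_space itself \<Rightarrow> real \<Rightarrow> ennreal" where
  "C_const _ s =
     (\<integral>\<^sup>+\<xi>. ennreal (1 / (1 + (norm (\<xi>::'a))\<^sup>2) powr (real (DIM('a) + 1) / 2 + s)) \<partial>lebesgue)"

definition limit_energy ::
    "'a::euclidean_space set \<Rightarrow> real \<Rightarrow> ('a \<times> real \<Rightarrow> real) \<Rightarrow> ennreal" where
  "limit_energy \<omega> s\<^sub>0 v =
     C_const TYPE('a) s\<^sub>0 *
     (\<integral>\<^sup>+x'. (\<integral>\<^sup>+b. (\<integral>\<^sup>+a.
          ennreal (\<bar>v (x', a) - v (x', b)\<bar>\<^sup>2 / \<bar>a - b\<bar> powr (1 + 2 * s\<^sub>0))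
        \<partial>lebesgue_on {0<..<1}) \<partial>lebesgue_on {0<..<1}) \<partial>lebesgue_on \<omega>)"

end

theory Submission
  imports Defs
begin

text \<open>
  Substituting \<open>x\<^sub>d = \<epsilon> t\<close>, \<open>y\<^sub>d = \<epsilon> \<tau>\<close> and \<open>y' = x' + \<epsilon> \<xi>\<close> turns the scaled seminorm into the integral of
  \<open>\<bar>v(x', t) - v(x' + \<epsilon> \<xi>, \<tau>)\<bar>\<^sup>2 / (\<bar>\<xi>\<bar>\<^sup>2 + (t - \<tau>)\<^sup>2)\<close> raised in the denominator to \<open>d/2 + s\<^sub>\<epsilon>\<close>; the powers of \<open>\<epsilon>\<close>
  cancel exactly. At \<open>\<epsilon> = 0\<close> the variable \<open>\<xi>\<close> integrates out to \<open>C\<^sub>s\<^sub>,\<^sub>d / \<bar>t - \<tau>\<bar>\<close> to the power \<open>1 + 2s\<close>, which is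
  the limit functional.

  Lower bound: since translations are continuous in \<open>L\<^sup>2\<close>, local \<open>L\<^sup>2\<close> convergence makes the integrands
  converge almost everywhere along a suitable sequence, and Fatou's lemma applies.

  Upper bound: for a fixed bounded Lipschitz function the energies converge by dominated convergence.
  A general \<open>v\<close> is cut off in \<open>x'\<close>, dilated in the height and mollified; by convexity this
  increases the limit energy by a factor tending to 1 only, and a diagonal choice gives the recovery
  family. As the limit energy sees no regularity in \<open>x'\<close>, the cut-off is free.
\<close>

section \<open>Lebesgue integrals on products\<close>

text \<open>After the substitution every functional is an integral over one fixed space of points
  \<open>P\<close>, and only the integrand depends on \<open>\<epsilon>\<close>. This makes Fatou's
  lemma and dominated convergence applicable although the domains collapse. Two obstacles shape the
  rest. The convergence is local and gives no pointwise information, while the second point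
  \<open>(x + \<epsilon> \<xi>, \<tau>)\<close> moves with \<open>\<epsilon>\<close>. Hence
  continuity of translations is needed uniformly for \<open>\<xi>\<close> in a ball, and the lower
  bound is first proved on compact sets. Moreover the exponent varies with
  \<open>\<epsilon>\<close>, so dominated convergence needs a single majorant for all exponents;
  bounded Lipschitz functions have one. Cut-off and mollification are applied at
  \<open>\<epsilon> = 0\<close> only. There both points share the base \<open>x\<close>, so a
  horizontal cut-off or translation treats them alike. Energies with \<open>\<epsilon> > 0\<close>
  are bounded from above only for the Lipschitz approximations.\<close>

lemma nn_integral_lborel_pair:
  fixes F :: "'a::euclidean_space \<times> 'b::euclidean_space \<Rightarrow> ennreal"
  assumes F: "F \<in> borel_measurable borel"
  shows "(\<integral>\<^sup>+p. F p \<partial>lborel) = (\<integral>\<^sup>+x. (\<integral>\<^sup>+y. F (x, y) \<partial>lborel) \<partial>lborel)"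
    and "(\<integral>\<^sup>+p. F p \<partial>lborel) = (\<integral>\<^sup>+y. (\<integral>\<^sup>+x. F (x, y) \<partial>lborel) \<partial>lborel)"
proof -
  have m: "F \<in> borel_measurable (lborel \<Otimes>\<^sub>M lborel)"
    using F by (simp add: lborel_prod)
  show "(\<integral>\<^sup>+p. F p \<partial>lborel) = (\<integral>\<^sup>+x. (\<integral>\<^sup>+y. F (x, y) \<partial>lborel) \<partial>lborel)"
    using lborel.nn_integral_fst[OF m] by (simp add: lborel_prod)
  show "(\<integral>\<^sup>+p. F p \<partial>lborel) = (\<integral>\<^sup>+y. (\<integral>\<^sup>+x. F (x, y) \<partial>lborel) \<partial>lborel)"
    using lborel_pair.nn_integral_snd[of F] m by (simp add: lborel_prod)
qed

lemma nn_integral_lborel_swap: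
  fixes F :: "'a::euclidean_space \<Rightarrow> 'b::euclidean_space \<Rightarrow> ennreal"
  assumes F: "(\<lambda>p. F (fst p) (snd p)) \<in> borel_measurable borel"
  shows "(\<integral>\<^sup>+x. (\<integral>\<^sup>+y. F x y \<partial>lborel) \<partial>lborel) = (\<integral>\<^sup>+y. (\<integral>\<^sup>+x. F x y \<partial>lborel) \<partial>lborel)"
  using nn_integral_lborel_pair[OF F] by simp

lemma borel_measurable_nn_integral_lborel:
  fixes F :: "'a::euclidean_space \<times> 'b::euclidean_space \<Rightarrow> ennreal"
  assumes F: "F \<in> borel_measurable borel"
  shows "(\<lambda>x. \<integral>\<^sup>+y. F (x, y) \<partial>lborel) \<in> borel_measurable borel"
    and "(\<lambda>y. \<integral>\<^sup>+x. F (x, y) \<partial>lborel) \<in> borel_measurable borel"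
proof -
  have m: "F \<in> borel_measurable (borel \<Otimes>\<^sub>M lborel)"
    using F by (subst measurable_cong_sets[OF _ refl, of _ borel]) (simp_all add: borel_prod[symmetric] cong: sets_pair_measure_cong)
  show "(\<lambda>x. \<integral>\<^sup>+y. F (x, y) \<partial>lborel) \<in> borel_measurable borel"
    using m by (intro lborel.borel_measurable_nn_integral) (simp add: case_prod_beta')
  have m: "F \<circ> prod.swap \<in> borel_measurable borel"
    by (intro measurable_comp[OF _ F] borel_measurable_continuous_onI)
       (simp add: prod.swap_def continuous_intros)
  then have m: "(\<lambda>p. F (snd p, fst p)) \<in> borel_measurable (borel \<Otimes>\<^sub>M lborel)"
    by (subst measurable_cong_sets[OF _ refl, of _ borel])
       (simp_all add: borel_prod[symmetric] prod.swap_def comp_def cong: sets_pair_measure_cong)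
  show "(\<lambda>y. \<integral>\<^sup>+x. F (x, y) \<partial>lborel) \<in> borel_measurable borel"
    using m by (intro lborel.borel_measurable_nn_integral) (simp add: case_prod_beta')
qed

lemma nn_integral_lborel_affine:
  fixes t :: "'a::euclidean_space" and F :: "'a \<Rightarrow> ennreal"
  assumes F[measurable]: "F \<in> borel_measurable borel" and c: "c \<noteq> 0"
  shows "(\<integral>\<^sup>+x. F x \<partial>lborel) = ennreal (\<bar>c\<bar> ^ DIM('a)) * (\<integral>\<^sup>+x. F (t + c *\<^sub>R x) \<partial>lborel)"
  by (subst lborel_affine[OF c, of t])
     (simp add: nn_integral_density nn_integral_distr nn_integral_cmult)

text \<open>One family covers every change of variables on the cylinder: horizontal translation by
  \<open>\<epsilon> \<xi>\<close> (\<open>a = 1\<close>, \<open>b = 0\<close>), rescaling of the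
  height (\<open>z = 0\<close>, \<open>b = 0\<close>), and the evaluation points of the
  mollification. The Jacobian is \<open>a\<close>, whatever \<open>z\<close> and \<open>b\<close>
  are.\<close>

definition shear :: "'a::euclidean_space \<Rightarrow> real \<Rightarrow> real \<Rightarrow> 'a \<times> real \<Rightarrow> 'a \<times> real" where
  "shear z a b X = (fst X + z, a * snd X + b)"

lemma measurable_shear [measurable]: "shear z a b \<in> borel_measurable borel"
  unfolding shear_def by (intro borel_measurable_continuous_onI continuous_intros)

lemma nn_integral_shear:
  fixes F :: "'a::euclidean_space \<times> real \<Rightarrow> ennreal"
  assumes F[measurable]: "F \<in> borel_measurable borel" and a: "a > 0"
  shows "(\<integral>\<^sup>+X. F X \<partial>lborel) = ennreal a * (\<integral>\<^sup>+X. F (shear z a b X) \<partial>lborel)"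
proof -
  have Fm: "(\<lambda>x. F (g x)) \<in> borel_measurable borel" if "continuous_on UNIV g" for g :: "'c::topological_space \<Rightarrow> _"
    by (rule measurable_compose[OF borel_measurable_continuous_onI[OF that] F])
  have "(\<integral>\<^sup>+X. F X \<partial>lborel) = (\<integral>\<^sup>+x. (\<integral>\<^sup>+t. F (x, t) \<partial>lborel) \<partial>lborel)"
    by (rule nn_integral_lborel_pair[OF F])
  also have "\<dots> = (\<integral>\<^sup>+x. ennreal a * (\<integral>\<^sup>+t. F (x, a * t + b) \<partial>lborel) \<partial>lborel)"
    using a by (subst nn_integral_lborel_affine[where c=a and t=b])
      (auto intro!: Fm continuous_intros simp: add.commute)
  also have "\<dots> = ennreal a * (\<integral>\<^sup>+x. (\<integral>\<^sup>+t. F (x, a * t + b) \<partial>lborel) \<partial>lborel)"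
    using borel_measurable_nn_integral_lborel(1)[OF Fm[of "\<lambda>p. (fst p, a * snd p + b)"]]
    by (intro nn_integral_cmult) (simp add: continuous_intros)
  also have "(\<integral>\<^sup>+x. (\<integral>\<^sup>+t. F (x, a * t + b) \<partial>lborel) \<partial>lborel)
      = (\<integral>\<^sup>+x. (\<integral>\<^sup>+t. F (z + x, a * t + b) \<partial>lborel) \<partial>lborel)"
    using borel_measurable_nn_integral_lborel(1)[OF Fm[of "\<lambda>p. (fst p, a * snd p + b)"]]
    by (subst nn_integral_lborel_affine[where c=1 and t=z]) (auto simp: continuous_intros)
  also have "\<dots> = (\<integral>\<^sup>+X. F (shear z a b X) \<partial>lborel)"
    by (subst nn_integral_lborel_pair(1)) (auto simp: shear_def add.commute intro!: Fm continuous_intros)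
  finally show ?thesis .
qed

lemma nn_integral_shear_arg:
  assumes [measurable]: "F \<in> borel_measurable borel" and a: "a > 0"
  shows "(\<integral>\<^sup>+X. F (shear z a b X) \<partial>lborel) = ennreal (1 / a) * (\<integral>\<^sup>+X. F X \<partial>lborel)"
  using a
  by (subst (2) nn_integral_shear[where z="z" and a="a" and b="b"])
     (auto simp: mult.assoc[symmetric] ennreal_mult[symmetric])

text \<open>The indicator of the preimage of a null set integrates to a multiple of the original
  measure, hence to 0. Almost everywhere representatives thus survive the rescaling of the
  height.\<close>

lemma AE_shear:
  assumes "AE X in lborel. P X" and a: "a > 0"
  shows "AE X in lborel. P (shear z a b X :: 'a::euclidean_space \<times> real)"
proof -
  obtain N where N: "{X. \<not> P X} \<subseteq> N" "N \<in> null_sets lborel"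
    using assms(1) by (auto simp: eventually_ae_filter)
  then have [measurable]: "N \<in> sets borel" by (auto simp: null_sets_def)
  have "(\<integral>\<^sup>+X. indicator N X \<partial>lborel) = 0" using N by (simp add: null_setsD1)
  then have "ennreal a * (\<integral>\<^sup>+X. indicator N (shear z a b X) \<partial>lborel) = 0"
    using a by (subst nn_integral_shear[symmetric]) auto
  then have "(\<integral>\<^sup>+X. indicator N (shear z a b X) \<partial>lborel) = 0" using a by simp
  then have "AE X in lborel. (indicator N (shear z a b X) :: ennreal) = 0"
    by (subst (asm) nn_integral_0_iff_AE) auto
  then show ?thesis
  proof eventually_elim
    case (elim X)
    then show ?case using N(1) by (auto simp: indicator_def split: if_splits)
  qed
qed

lemma tendsto_0_ennrealI:
  fixes f :: "'b \<Rightarrow> ennreal"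
  assumes "\<And>r::real. r > 0 \<Longrightarrow> eventually (\<lambda>k. f k \<le> ennreal r) F"
  shows "(f \<longlongrightarrow> 0) F"
proof (rule order_tendstoI)
  fix e :: ennreal assume "0 < e"
  then obtain c where c: "0 < c" "c < e" using dense by blast
  then obtain r where r: "c = ennreal r" "r > 0"
    by (cases c) (auto simp: top_unique)
  show "eventually (\<lambda>k. f k < e) F"
    using assms[OF r(2)] by eventually_elim (use c r in auto)
qed simp

lemma eventually_le_ennreal_of_tendsto_0:
  fixes f :: "'b \<Rightarrow> ennreal"
  assumes "(f \<longlongrightarrow> 0) F" "r > 0"
  shows "eventually (\<lambda>k. f k \<le> ennreal r) F"
  using order_tendstoD(2)[OF assms(1), of "ennreal r"] assms(2)
  by (auto elim: eventually_mono)

section \<open>Continuity of shears in mean square\<close>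

lemma tendsto_0_ennreal_le:
  fixes f g :: "'b \<Rightarrow> ennreal"
  assumes "(g \<longlongrightarrow> 0) F" "eventually (\<lambda>k. f k \<le> g k) F"
  shows "(f \<longlongrightarrow> 0) F"
  by (rule tendsto_sandwich[OF _ assms(2) tendsto_const assms(1)]) simp

context
  fixes z :: "nat \<Rightarrow> 'a::euclidean_space" and a b :: "nat \<Rightarrow> real"
  assumes z: "z \<longlonglongrightarrow> 0" and a: "a \<longlonglongrightarrow> 1" and a0: "\<And>k. a k > 0" and b: "b \<longlonglongrightarrow> 0"
begin

lemma shear_tendsto: "(\<lambda>k. shear (z k) (a k) (b k) X) \<longlonglongrightarrow> X"
proof -
  have "(\<lambda>k. (fst X + z k, a k * snd X + b k)) \<longlonglongrightarrow> (fst X + 0, 1 * snd X + 0)"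
    by (intro tendsto_intros z a b)
  then show ?thesis by (simp add: shear_def)
qed

lemma shear_open_L1:
  assumes U: "open U" "emeasure lborel U < \<infinity>"
  shows "(\<lambda>k. \<integral>\<^sup>+X. ennreal \<bar>indicator U (shear (z k) (a k) (b k) X) - indicator U X\<bar> \<partial>lborel) \<longlonglongrightarrow> 0"
proof (rule tendsto_0_ennrealI)
  fix r :: real assume r: "r > 0"
  let ?S = "\<lambda>k. shear (z k) (a k) (b k)"
  let ?D = "\<lambda>k. \<integral>\<^sup>+X. ennreal \<bar>indicator U (?S k X) - indicator U X\<bar> \<partial>lborel"
  let ?M = "\<lambda>k. \<integral>\<^sup>+X. indicator {X\<in>U. ?S k X \<notin> U} X \<partial>lborel :: ennreal"
  have [measurable]: "U \<in> sets borel" using U by auto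
  have sets[measurable]: "{X\<in>U. ?S k X \<notin> U} \<in> sets borel" for k
  proof -
    have "{X\<in>U. ?S k X \<notin> U} = U \<inter> (?S k -` (-U) \<inter> space borel)" by auto
    then show ?thesis using measurable_sets[OF measurable_shear, of "-U"] by (metis sets.Int \<open>U \<in> sets borel\<close> borel_comp)
  qed
  have "?M \<longlonglongrightarrow> (\<integral>\<^sup>+X. 0 \<partial>(lborel :: ('a \<times> real) measure))"
  proof (rule nn_integral_dominated_convergence[where w="indicator U"])
    show "AE X in lborel. (\<lambda>k. indicator {X \<in> U. ?S k X \<notin> U} X :: ennreal) \<longlonglongrightarrow> 0"
    proof (intro AE_I2)
      fix X
      show "(\<lambda>k. indicator {X \<in> U. ?S k X \<notin> U} X :: ennreal) \<longlonglongrightarrow> 0"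
      proof (cases "X \<in> U")
        case True
        then have "eventually (\<lambda>k. ?S k X \<in> U) sequentially"
          using topological_tendstoD[OF shear_tendsto U(1)] by auto
        then show ?thesis by (intro tendsto_eventually) (auto elim: eventually_mono simp: indicator_def)
      qed simp
    qed
  qed (use U in \<open>auto intro!: AE_I2 split: split_indicator\<close>)
  then have M: "?M \<longlonglongrightarrow> 0" by simp
  have eq: "?D k + emeasure lborel U = ennreal (1 / a k) * emeasure lborel U + 2 * ?M k" for k
  proof -
    \<comment> \<open>pointwise, \<open>\<bar>1\<^sub>U \<circ> S - 1\<^sub>U\<bar> + 1\<^sub>U = 1\<^sub>U \<circ> S + 2\<close> times the indicator of
      \<open>{X \<in> U. S X \<notin> U}\<close>, a set that shrinks to nothing because \<open>U\<close> is open\<close>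
    have "?D k + emeasure lborel U = (\<integral>\<^sup>+X. ennreal \<bar>indicator U (?S k X) - indicator U X\<bar> + indicator U X \<partial>lborel)"
      by (subst nn_integral_add) auto
    also have "\<dots> = (\<integral>\<^sup>+X. indicator U (?S k X) + 2 * indicator {X\<in>U. ?S k X \<notin> U} X \<partial>lborel)"
      by (intro nn_integral_cong) (auto simp: indicator_def)
    also have "\<dots> = (\<integral>\<^sup>+X. indicator U (?S k X) \<partial>lborel) + 2 * ?M k"
      by (subst nn_integral_add) (auto simp: nn_integral_cmult)
    finally show ?thesis using nn_integral_shear_arg[OF _ a0, of "indicator U"] by simp
  qed
  have "(\<lambda>k. ennreal (1 / a k) * emeasure lborel U + 2 * ?M k) \<longlonglongrightarrow> ennreal (1/1) * emeasure lborel U + 2 * 0"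
    using U(2) by (intro tendsto_intros tendsto_mult_ennreal tendsto_ennrealI a M) auto
  \<comment> \<open>The added term \<open>emeasure lborel U\<close> is finite, which gives the
    strict inequality here and permits cancelling it below.\<close>
  moreover have "emeasure lborel U < ennreal r + emeasure lborel U"
    using U(2) r by (cases "emeasure lborel U") (auto simp: ennreal_plus[symmetric] ennreal_less_iff simp del: ennreal_plus)
  ultimately have "eventually (\<lambda>k. ?D k + emeasure lborel U < ennreal r + emeasure lborel U) sequentially"
    unfolding eq[symmetric] by (intro order_tendstoD(2)) auto
  then show "eventually (\<lambda>k. ?D k \<le> ennreal r) sequentially"
  proof eventually_elim
    case (elim k)
    then show ?case
      by (simp add: add.commute[of _ "emeasure lborel U"] ennreal_add_left_cancel_less less_imp_le)
  qed
qed

text \<open>Composition with a shear multiplies L1 norms by \<open>1 / a k\<close>, eventually at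
  most 2. The functions with the claimed continuity therefore form a closed set in L1.\<close>

lemma shear_L1_closure:
  assumes [measurable]: "f \<in> borel_measurable borel"
  assumes app: "\<And>r::real. r > 0 \<Longrightarrow> \<exists>g\<in>borel_measurable borel.
      (\<integral>\<^sup>+X. ennreal \<bar>f X - g X\<bar> \<partial>lborel) \<le> ennreal r \<and>
      (\<lambda>k. \<integral>\<^sup>+X. ennreal \<bar>g (shear (z k) (a k) (b k) X) - g X\<bar> \<partial>lborel) \<longlonglongrightarrow> 0"
  shows "(\<lambda>k. \<integral>\<^sup>+X. ennreal \<bar>f (shear (z k) (a k) (b k) X) - f X\<bar> \<partial>lborel) \<longlonglongrightarrow> 0"
proof (rule tendsto_0_ennrealI)
  fix r :: real assume r: "r > 0"
  let ?S = "\<lambda>k. shear (z k) (a k) (b k)"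
  obtain g where [measurable]: "g \<in> borel_measurable borel"
    and g: "(\<integral>\<^sup>+X. ennreal \<bar>f X - g X\<bar> \<partial>lborel) \<le> ennreal (r/4)"
    and lim: "(\<lambda>k. \<integral>\<^sup>+X. ennreal \<bar>g (?S k X) - g X\<bar> \<partial>lborel) \<longlonglongrightarrow> 0"
    using app[of "r/4"] r by auto
  have "eventually (\<lambda>k. 1 / 2 < a k) sequentially"
    using order_tendstoD(1)[OF a, of "1/2"] by simp
  moreover have "eventually (\<lambda>k. (\<integral>\<^sup>+X. ennreal \<bar>g (?S k X) - g X\<bar> \<partial>lborel) \<le> ennreal (r/4)) sequentially"
    using eventually_le_ennreal_of_tendsto_0[OF lim, of "r/4"] r by simp
  ultimately show "eventually (\<lambda>k. (\<integral>\<^sup>+X. ennreal \<bar>f (?S k X) - f X\<bar> \<partial>lborel) \<le> ennreal r) sequentially"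
  proof eventually_elim
    case (elim k)
    have "(\<integral>\<^sup>+X. ennreal \<bar>f (?S k X) - f X\<bar> \<partial>lborel) \<le>
      (\<integral>\<^sup>+X. (ennreal \<bar>f (?S k X) - g (?S k X)\<bar> + ennreal \<bar>g (?S k X) - g X\<bar>) + ennreal \<bar>f X - g X\<bar> \<partial>lborel)"
      by (intro nn_integral_mono) (auto simp: ennreal_plus[symmetric] simp del: ennreal_plus intro!: ennreal_leI)
    also have "\<dots> = (\<integral>\<^sup>+X. ennreal \<bar>f (?S k X) - g (?S k X)\<bar> \<partial>lborel) +
        (\<integral>\<^sup>+X. ennreal \<bar>g (?S k X) - g X\<bar> \<partial>lborel) + (\<integral>\<^sup>+X. ennreal \<bar>f X - g X\<bar> \<partial>lborel)"
      by (simp add: nn_integral_add)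
    also have "(\<integral>\<^sup>+X. ennreal \<bar>f (?S k X) - g (?S k X)\<bar> \<partial>lborel) = ennreal (1 / a k) * (\<integral>\<^sup>+X. ennreal \<bar>f X - g X\<bar> \<partial>lborel)"
      by (rule nn_integral_shear_arg[OF _ a0]) simp
    \<comment> \<open>The bound \<open>a k > 1/2\<close> doubles the first quarter of
      \<open>r\<close>; the other two terms use one quarter each.\<close>
    also have "\<dots> \<le> ennreal 2 * ennreal (r / 4)"
      using elim(1) a0[of k] by (intro mult_mono g ennreal_leI) (auto simp: field_simps)
    also have "\<dots> = ennreal (r/2)" using r by (simp add: ennreal_mult[symmetric] del: ennreal_numeral)
    finally have "(\<integral>\<^sup>+X. ennreal \<bar>f (?S k X) - f X\<bar> \<partial>lborel) \<le> ennreal (r/2) + ennreal (r/4) + ennreal (r/4)"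
      using g elim(2) by (meson add_mono order_trans order_refl)
    also have "\<dots> = ennreal r" using r by (simp add: ennreal_plus[symmetric] del: ennreal_plus)
    finally show ?case .
  qed
qed

text \<open>Induction over integrable functions: outer regularity replaces a measurable set by an
  open one, sums follow from the triangle inequality, and \<open>shear_L1_closure\<close> absorbs
  the approximation errors in the first and last case.\<close>

lemma shear_L1:
  assumes "integrable lborel f"
  shows "(\<lambda>k. \<integral>\<^sup>+X. ennreal \<bar>f (shear (z k) (a k) (b k) X) - f X :: real\<bar> \<partial>lborel) \<longlonglongrightarrow> 0"
  using assms
proof induction
  case (base A c)
  then have A[measurable]: "A \<in> sets borel" by simp
  show ?case
  proof (rule shear_L1_closure)
    fix r :: real assume r: "r > 0"
    \<comment> \<open>The summand 1 keeps \<open>?e\<close> positive when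
      \<open>c = 0\<close>.\<close>
    let ?e = "r / (\<bar>c\<bar> + 1)"
    have e: "?e > 0" using r by simp
    obtain U where U: "open U" "A \<subseteq> U" "U - A \<in> lmeasurable" "emeasure lebesgue (U - A) < ennreal ?e"
      using sets_lebesgue_outer_open[of A ?e] e A by (metis sets_completionI_sets sets_lborel)
    have [measurable]: "U \<in> sets borel" using U by auto
    have UA: "emeasure lborel (U - A) < ennreal ?e" using U(4) by simp
    have "emeasure lborel U = emeasure lborel (U - A) + emeasure lborel A"
      using U(2) by (subst plus_emeasure) (auto simp: Un_absorb2)
    then have fin: "emeasure lborel U < \<infinity>" using UA base(2) by (auto simp: less_top[symmetric] top_unique)
    have "(\<integral>\<^sup>+X. ennreal \<bar>indicator A X *\<^sub>R c - indicator U X *\<^sub>R c\<bar> \<partial>lborel) =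
        (\<integral>\<^sup>+X. ennreal \<bar>c\<bar> * indicator (U - A) X \<partial>lborel)"
      using U(2) by (intro nn_integral_cong) (auto simp: indicator_def)
    also have "\<dots> = ennreal \<bar>c\<bar> * emeasure lborel (U - A)"
      by (simp add: nn_integral_cmult)
    also have "\<dots> \<le> ennreal \<bar>c\<bar> * ennreal ?e" using UA by (intro mult_left_mono) auto
    also have "\<dots> \<le> ennreal r"
      using r by (auto simp: ennreal_mult[symmetric] field_simps intro!: ennreal_leI)
    finally have 1: "(\<integral>\<^sup>+X. ennreal \<bar>indicator A X *\<^sub>R c - indicator U X *\<^sub>R c\<bar> \<partial>lborel) \<le> ennreal r" .
    have "(\<lambda>k. ennreal \<bar>c\<bar> * (\<integral>\<^sup>+X. ennreal \<bar>indicator U (shear (z k) (a k) (b k) X) - indicator U X\<bar> \<partial>lborel)) \<longlonglongrightarrow> ennreal \<bar>c\<bar> * 0"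
      by (intro tendsto_mult_ennreal tendsto_const shear_open_L1 U(1) fin) auto
    also have "(\<lambda>k. ennreal \<bar>c\<bar> * (\<integral>\<^sup>+X. ennreal \<bar>indicator U (shear (z k) (a k) (b k) X) - indicator U X\<bar> \<partial>lborel)) =
        (\<lambda>k. \<integral>\<^sup>+X. ennreal \<bar>indicator U (shear (z k) (a k) (b k) X) *\<^sub>R c - indicator U X *\<^sub>R c\<bar> \<partial>lborel)"
      by (subst nn_integral_cmult[symmetric], simp)
         (auto intro!: ext nn_integral_cong simp: ennreal_mult[symmetric] indicator_def)
    finally show "\<exists>g\<in>borel_measurable borel.
      (\<integral>\<^sup>+X. ennreal \<bar>indicator A X *\<^sub>R c - g X\<bar> \<partial>lborel) \<le> ennreal r \<and>
      (\<lambda>k. \<integral>\<^sup>+X. ennreal \<bar>g (shear (z k) (a k) (b k) X) - g X\<bar> \<partial>lborel) \<longlonglongrightarrow> 0"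
      using 1 by (intro bexI[of _ "\<lambda>X. indicator U X *\<^sub>R c"]) auto
  qed simp
next
  case (add f g)
  have [measurable]: "f \<in> borel_measurable borel" "g \<in> borel_measurable borel"
    using add(1,2) by auto
  let ?S = "\<lambda>k. shear (z k) (a k) (b k)"
  have "(\<lambda>k. (\<integral>\<^sup>+X. ennreal \<bar>f (?S k X) - f X\<bar> \<partial>lborel) + (\<integral>\<^sup>+X. ennreal \<bar>g (?S k X) - g X\<bar> \<partial>lborel)) \<longlonglongrightarrow> 0 + 0"
    by (intro tendsto_add add)
  then show ?case unfolding add_0
  proof (rule tendsto_0_ennreal_le)
    show "eventually (\<lambda>k. (\<integral>\<^sup>+X. ennreal \<bar>f (?S k X) + g (?S k X) - (f X + g X)\<bar> \<partial>lborel) \<le>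
       (\<integral>\<^sup>+X. ennreal \<bar>f (?S k X) - f X\<bar> \<partial>lborel) + (\<integral>\<^sup>+X. ennreal \<bar>g (?S k X) - g X\<bar> \<partial>lborel)) sequentially"
      by (intro always_eventually allI, subst nn_integral_add[symmetric])
         (auto intro!: nn_integral_mono ennreal_leI simp: ennreal_plus[symmetric] simp del: ennreal_plus)
  qed
next
  case (lim f s)
  have [measurable]: "f \<in> borel_measurable borel" "\<And>i. s i \<in> borel_measurable borel"
    using lim by auto
  show ?case
  proof (rule shear_L1_closure)
    fix r :: real assume r: "r > 0"
    have "(\<lambda>i. \<integral>\<^sup>+X. norm (f X - s i X) \<partial>lborel) \<longlonglongrightarrow> 0"
    \<comment> \<open>The induction rule bounds \<open>norm (s i x)\<close> by
      \<open>2 * norm (f x)\<close>, which supplies this majorant.\<close>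
    proof (rule nn_integral_dominated_convergence_norm[where w="\<lambda>x. 2 * norm (f x)"])
      show "(\<integral>\<^sup>+x. ennreal (2 * norm (f x)) \<partial>lborel) < \<infinity>"
        using integrable_iff_bounded[THEN iffD1, OF integrable_mult_right[OF lim(4), of 2]]
        by (simp add: abs_mult)
    qed (use lim in auto)
    from eventually_le_ennreal_of_tendsto_0[OF this r]
    obtain i where "(\<integral>\<^sup>+X. norm (f X - s i X) \<partial>lborel) \<le> ennreal r"
      by (auto simp: eventually_sequentially)
    then show "\<exists>g\<in>borel_measurable borel.
      (\<integral>\<^sup>+X. ennreal \<bar>f X - g X\<bar> \<partial>lborel) \<le> ennreal r \<and>
      (\<lambda>k. \<integral>\<^sup>+X. ennreal \<bar>g (shear (z k) (a k) (b k) X) - g X\<bar> \<partial>lborel) \<longlonglongrightarrow> 0"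
      using lim(5)[of i] by (intro bexI[of _ "s i"]) auto
  qed simp
qed

text \<open>For nonnegative numbers \<open>(x - y)\<^sup>2\<close> is at most
  \<open>\<bar>x\<^sup>2 - y\<^sup>2\<bar>\<close>. Continuity of the positive and negative parts in
  L2 thus follows from continuity of their squares \<open>p\<close> and \<open>m\<close> in
  L1.\<close>

lemma shear_L2:
  assumes [measurable]: "f \<in> borel_measurable borel"
    and fin: "(\<integral>\<^sup>+X. ennreal ((f X)\<^sup>2) \<partial>lborel) < \<infinity>"
  shows "(\<lambda>k. \<integral>\<^sup>+X. ennreal ((f (shear (z k) (a k) (b k) X) - f X)\<^sup>2) \<partial>lborel) \<longlonglongrightarrow> 0"
proof -
  let ?S = "\<lambda>k. shear (z k) (a k) (b k)"
  define p where "p = (\<lambda>X. (max 0 (f X))\<^sup>2)"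
  define m where "m = (\<lambda>X. (max 0 (- f X))\<^sup>2)"
  have [measurable]: "p \<in> borel_measurable borel" "m \<in> borel_measurable borel"
    by (auto simp: p_def m_def)
  have int: "integrable lborel p" "integrable lborel m"
    by (rule integrableI_bounded, simp,
        rule le_less_trans[OF _ fin], intro nn_integral_mono ennreal_leI, simp add: p_def m_def max_def)+
  have pm: "(x - y)\<^sup>2 \<le> 2 * \<bar>x\<^sup>2 - y\<^sup>2\<bar>" if "x \<ge> 0" "y \<ge> 0" for x y :: real
  proof -
    have "(x - y)\<^sup>2 = \<bar>x - y\<bar> * \<bar>x - y\<bar>" by (simp add: power2_eq_square)
    also have "\<dots> \<le> \<bar>x - y\<bar> * \<bar>x + y\<bar>" using that by (intro mult_left_mono) auto
    also have "\<dots> = \<bar>x\<^sup>2 - y\<^sup>2\<bar>" by (simp add: abs_mult[symmetric] power2_eq_square algebra_simps)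
    also have "\<dots> \<le> 2 * \<bar>x\<^sup>2 - y\<^sup>2\<bar>" by simp
    finally show ?thesis .
  qed
  have bnd: "(f Y - f X)\<^sup>2 \<le> 4 * \<bar>p Y - p X\<bar> + 4 * \<bar>m Y - m X\<bar>" for X Y
  proof -
    have "f Y - f X = (max 0 (f Y) - max 0 (f X)) - (max 0 (- f Y) - max 0 (- f X))" by auto
    also have "\<dots>\<^sup>2 \<le> 2 * (max 0 (f Y) - max 0 (f X))\<^sup>2 + 2 * (max 0 (- f Y) - max 0 (- f X))\<^sup>2"
      using sum_squares_bound[of "max 0 (f Y) - max 0 (f X)" "-(max 0 (- f Y) - max 0 (- f X))"]
      by (simp add: power2_eq_square algebra_simps)
    also have "\<dots> \<le> 4 * \<bar>p Y - p X\<bar> + 4 * \<bar>m Y - m X\<bar>"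
      using pm[of "max 0 (f Y)" "max 0 (f X)"] pm[of "max 0 (- f Y)" "max 0 (- f X)"]
      by (simp add: p_def m_def)
    finally show ?thesis .
  qed
  have "(\<lambda>k. 4 * (\<integral>\<^sup>+X. ennreal \<bar>p (?S k X) - p X\<bar> \<partial>lborel) + 4 * (\<integral>\<^sup>+X. ennreal \<bar>m (?S k X) - m X\<bar> \<partial>lborel)) \<longlonglongrightarrow> 4 * 0 + 4 * 0"
    by (intro tendsto_add tendsto_mult_ennreal tendsto_const shear_L1 int) auto
  then show ?thesis unfolding add_0 mult_zero_right
  proof (rule tendsto_0_ennreal_le)
    show "eventually (\<lambda>k. (\<integral>\<^sup>+X. ennreal ((f (?S k X) - f X)\<^sup>2) \<partial>lborel) \<le>
       4 * (\<integral>\<^sup>+X. ennreal \<bar>p (?S k X) - p X\<bar> \<partial>lborel) + 4 * (\<integral>\<^sup>+X. ennreal \<bar>m (?S k X) - m X\<bar> \<partial>lborel)) sequentially"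
    proof (intro always_eventually allI)
      fix k
      have "(\<integral>\<^sup>+X. ennreal ((f (?S k X) - f X)\<^sup>2) \<partial>lborel) \<le>
         (\<integral>\<^sup>+X. 4 * ennreal \<bar>p (?S k X) - p X\<bar> + 4 * ennreal \<bar>m (?S k X) - m X\<bar> \<partial>lborel)"
      proof (rule nn_integral_mono)
        fix X
        have "ennreal ((f (?S k X) - f X)\<^sup>2) \<le> ennreal (4 * \<bar>p (?S k X) - p X\<bar> + 4 * \<bar>m (?S k X) - m X\<bar>)"
          by (intro ennreal_leI bnd)
        then show "ennreal ((f (?S k X) - f X)\<^sup>2) \<le> 4 * ennreal \<bar>p (?S k X) - p X\<bar> + 4 * ennreal \<bar>m (?S k X) - m X\<bar>"
          by (simp add: ennreal_mult)
      qed
      also have "\<dots> = 4 * (\<integral>\<^sup>+X. ennreal \<bar>p (?S k X) - p X\<bar> \<partial>lborel) + 4 * (\<integral>\<^sup>+X. ennreal \<bar>m (?S k X) - m X\<bar> \<partial>lborel)"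
        by (simp add: nn_integral_add nn_integral_cmult)
      finally show "(\<integral>\<^sup>+X. ennreal ((f (?S k X) - f X)\<^sup>2) \<partial>lborel) \<le> \<dots>" .
    qed
  qed
qed

end

text \<open>Sequential continuity becomes a modulus by contradiction. Uniformity in the parameters
  is what the applications require: the translation ranges over all \<open>\<epsilon> \<xi>\<close>
  with \<open>\<xi>\<close> in a ball, or over the support of a mollifier.\<close>

lemma shear_L2_eps:
  fixes f :: "'a::euclidean_space \<times> real \<Rightarrow> real"
  assumes "f \<in> borel_measurable borel" "(\<integral>\<^sup>+X. ennreal ((f X)\<^sup>2) \<partial>lborel) < \<infinity>" "r > 0"
  shows "\<exists>\<delta>>0. \<forall>z a b. norm z < \<delta> \<and> \<bar>a - 1\<bar> < \<delta> \<and> \<bar>b\<bar> < \<delta> \<longrightarrow>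
     (\<integral>\<^sup>+X. ennreal ((f (shear z a b X) - f X)\<^sup>2) \<partial>lborel) \<le> ennreal r"
proof (rule ccontr)
  assume neg: "\<not> ?thesis"
  let ?d = "\<lambda>k::nat. inverse (real (Suc k))"
  define I where "I z a b = (\<integral>\<^sup>+X. ennreal ((f (shear z a b X) - f X)\<^sup>2) \<partial>lborel)" for z a b
  have "\<exists>z a b. norm z < ?d k \<and> \<bar>a - 1\<bar> < ?d k \<and> \<bar>b\<bar> < ?d k \<and> \<not> I z a b \<le> ennreal r" for k
    using neg[unfolded not_ex, rule_format, of "?d k"] by (simp add: I_def)
  then obtain z a b where zab: "\<And>k. norm (z k) < ?d k" "\<And>k. \<bar>a k - 1\<bar> < ?d k" "\<And>k. \<bar>b k\<bar> < ?d k"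
     and not: "\<And>k. \<not> I (z k) (a k) (b k) \<le> ennreal r"
    by metis
  \<comment> \<open>Since \<open>?d k\<close> is at most 1, the strict bound on
    \<open>\<bar>a k - 1\<bar>\<close> makes \<open>a k\<close> positive, as \<open>shear_L2\<close>
    requires.\<close>
  have le1: "?d k \<le> 1" for k by (simp add: field_simps)
  have z: "z \<longlonglongrightarrow> 0"
    by (rule LIMSEQ_norm_0) (use zab in \<open>simp add: inverse_eq_divide\<close>)
  have "(\<lambda>k. a k - 1) \<longlonglongrightarrow> 0"
    by (rule LIMSEQ_norm_0) (use zab in \<open>simp add: inverse_eq_divide\<close>)
  then have a: "a \<longlonglongrightarrow> 1" by (simp add: LIM_zero_iff)
  have b: "b \<longlonglongrightarrow> 0"
    by (rule LIMSEQ_norm_0) (use zab in \<open>simp add: inverse_eq_divide\<close>)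
  have a0: "a k > 0" for k using zab(2)[of k] le1[of k] by linarith
  from eventually_le_ennreal_of_tendsto_0[OF shear_L2[OF z a a0 b assms(1,2)] assms(3)]
  show False using not by (auto simp: I_def eventually_sequentially)
qed

section \<open>The energy in rescaled coordinates\<close>

text \<open>
  A point \<open>P = ((x, t), (\<xi>, \<tau>))\<close> stands for the pair \<open>(x, t)\<close>, \<open>(x + \<epsilon> \<xi>, \<tau>)\<close> of points of
  \<open>\<omega> \<times> (0, 1)\<close>. In these coordinates the rescaled seminorm of \<open>u\<close> is exactly
  \<open>energy \<omega> \<epsilon> (s \<epsilon>) v\<close> with \<open>v (x, t) = u (x, \<epsilon> t)\<close>, and the limit functional is the case
  \<open>\<epsilon> = 0\<close>. The singular points \<open>\<xi> = 0\<close>, \<open>t = \<tau>\<close> carry the junk value \<open>kern \<sigma> P = 0\<close>.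
\<close>

definition shift :: "real \<Rightarrow> ('a::euclidean_space \<times> real) \<times> ('a \<times> real) \<Rightarrow> 'a \<times> real" where
  "shift \<epsilon> P = (fst (fst P) + \<epsilon> *\<^sub>R fst (snd P), snd (snd P))"

definition kern :: "real \<Rightarrow> ('a::euclidean_space \<times> real) \<times> ('a \<times> real) \<Rightarrow> real" where
  "kern \<sigma> P = 1 / ((norm (fst (snd P)))\<^sup>2 + (snd (fst P) - snd (snd P))\<^sup>2) powr (real (DIM('a) + 1) / 2 + \<sigma>)"

definition dens ::
  "'a::euclidean_space set \<Rightarrow> real \<Rightarrow> real \<Rightarrow> ('a \<times> real \<Rightarrow> real) \<Rightarrow> ('a \<times> real) \<times> ('a \<times> real) \<Rightarrow> ennreal" where
  "dens \<omega> \<epsilon> \<sigma> V P = indicator (\<omega> \<times> {0<..<1}) (fst P) * indicator (\<omega> \<times> {0<..<1}) (shift \<epsilon> P) *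
     ennreal ((V (fst P) - V (shift \<epsilon> P))\<^sup>2 * kern \<sigma> P)"

definition energy :: "'a::euclidean_space set \<Rightarrow> real \<Rightarrow> real \<Rightarrow> ('a \<times> real \<Rightarrow> real) \<Rightarrow> ennreal" where
  "energy \<omega> \<epsilon> \<sigma> V = (\<integral>\<^sup>+P. dens \<omega> \<epsilon> \<sigma> V P \<partial>lborel)"

lemma measurable_shift [measurable]: "shift \<epsilon> \<in> borel_measurable borel"
  unfolding shift_def by (intro borel_measurable_continuous_onI continuous_intros)

lemma measurable_fst_borel [measurable]:
  "(fst :: 'a::euclidean_space \<times> 'b::euclidean_space \<Rightarrow> 'a) \<in> borel_measurable borel"
  by (intro borel_measurable_continuous_onI continuous_intros)

lemma measurable_snd_borel [measurable]:
  "(snd :: 'a::euclidean_space \<times> 'b::euclidean_space \<Rightarrow> 'b) \<in> borel_measurable borel"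
  by (intro borel_measurable_continuous_onI continuous_intros)

lemma measurable_kern [measurable]: "kern \<sigma> \<in> borel_measurable borel"
  unfolding kern_def by measurable

lemma kern_nonneg [simp]: "0 \<le> kern \<sigma> P"
  by (simp add: kern_def)

lemma sets_cyl [measurable]:
  fixes \<omega> :: "'a::euclidean_space set"
  shows "open \<omega> \<Longrightarrow> \<omega> \<times> {0<..<1::real} \<in> sets borel"
  by (intro borel_open open_Times) auto

lemma measurable_dens [measurable]:
  assumes "open \<omega>" and [measurable]: "V \<in> borel_measurable borel"
  shows "dens \<omega> \<epsilon> \<sigma> V \<in> borel_measurable borel"
proof -
  note [measurable] = sets_cyl[OF assms(1)]
  show ?thesis unfolding dens_def by measurable
qed

lemma nn_integral_lebesgue_on:
  assumes "A \<in> sets lebesgue"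
  shows "(\<integral>\<^sup>+x. f x \<partial>lebesgue_on A) = (\<integral>\<^sup>+x. f x * indicator A x \<partial>lborel)"
  using assms by (simp add: nn_integral_restrict_space nn_integral_completion)

section \<open>Integrals of the kernel\<close>

text \<open>Put \<open>d = DIM('a) + 1\<close>. Replacing \<open>\<xi>\<close> by
  \<open>\<bar>r\<bar> \<xi>\<close> yields \<open>\<bar>r\<bar> ^ (d - 1)\<close> from the volume
  against \<open>\<bar>r\<bar> powr (d + 2 \<sigma>)\<close> from the denominator. The quotient is
  the one-dimensional kernel of the limit functional.\<close>

lemma C_const_scale:
  fixes \<sigma> r :: real
  assumes r: "r \<noteq> 0"
  shows "(\<integral>\<^sup>+\<xi>. ennreal (1 / ((norm (\<xi>::'a::euclidean_space))\<^sup>2 + r\<^sup>2) powr (real (DIM('a) + 1) / 2 + \<sigma>)) \<partial>lborel)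
      = C_const TYPE('a) \<sigma> * ennreal (1 / \<bar>r\<bar> powr (1 + 2 * \<sigma>))"
proof -
  let ?p = "real (DIM('a) + 1) / 2 + \<sigma>"
  have "(\<integral>\<^sup>+\<xi>. ennreal (1 / ((norm (\<xi>::'a))\<^sup>2 + r\<^sup>2) powr ?p) \<partial>lborel)
    = ennreal (\<bar>\<bar>r\<bar>\<bar> ^ DIM('a)) * (\<integral>\<^sup>+\<xi>. ennreal (1 / ((norm (0 + \<bar>r\<bar> *\<^sub>R \<xi>::'a))\<^sup>2 + r\<^sup>2) powr ?p) \<partial>lborel)"
    using r by (intro nn_integral_lborel_affine) auto
  also have "\<dots> = (\<integral>\<^sup>+\<xi>. ennreal (1 / \<bar>r\<bar> powr (1 + 2 * \<sigma>)) * ennreal (1 / (1 + (norm (\<xi>::'a))\<^sup>2) powr ?p) \<partial>lborel)"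
  proof (subst nn_integral_cmult[symmetric], simp, intro nn_integral_cong)
    fix \<xi> :: 'a
    have e: "(norm (0 + \<bar>r\<bar> *\<^sub>R \<xi>))\<^sup>2 + r\<^sup>2 = \<bar>r\<bar> powr 2 * (1 + (norm \<xi>)\<^sup>2)"
      using r by (simp add: power_mult_distrib powr_numeral algebra_simps)
    have p2: "2 * ?p = real DIM('a) + 1 + 2 * \<sigma>" by (simp add: field_simps)
    have "((norm (0 + \<bar>r\<bar> *\<^sub>R \<xi>))\<^sup>2 + r\<^sup>2) powr ?p = \<bar>r\<bar> powr (real DIM('a) + 1 + 2 * \<sigma>) * (1 + (norm \<xi>)\<^sup>2) powr ?p"
      unfolding e powr_mult powr_powr p2 ..
    also have "\<bar>r\<bar> powr (real DIM('a) + 1 + 2 * \<sigma>) = \<bar>r\<bar> ^ DIM('a) * \<bar>r\<bar> powr (1 + 2 * \<sigma>)"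
      using r by (simp add: powr_add powr_realpow[symmetric] algebra_simps)
    finally have "((norm (0 + \<bar>r\<bar> *\<^sub>R \<xi>))\<^sup>2 + r\<^sup>2) powr ?p = \<bar>r\<bar> ^ DIM('a) * \<bar>r\<bar> powr (1 + 2 * \<sigma>) * (1 + (norm \<xi>)\<^sup>2) powr ?p" .
    then show "ennreal (\<bar>\<bar>r\<bar>\<bar> ^ DIM('a)) * ennreal (1 / ((norm (0 + \<bar>r\<bar> *\<^sub>R \<xi>))\<^sup>2 + r\<^sup>2) powr ?p)
       = ennreal (1 / \<bar>r\<bar> powr (1 + 2 * \<sigma>)) * ennreal (1 / (1 + (norm \<xi>)\<^sup>2) powr ?p)"
      using r by (simp add: ennreal_mult[symmetric] del: of_nat_add)
  qed
  also have "\<dots> = ennreal (1 / \<bar>r\<bar> powr (1 + 2 * \<sigma>)) * C_const TYPE('a) \<sigma>"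
    by (simp add: nn_integral_cmult C_const_def nn_integral_completion)
  finally show ?thesis by (simp add: mult.commute)
qed

text \<open>With \<open>d = DIM('a) + 1\<close>, the integrand decays like the power
  \<open>-(d + 2 \<sigma>)\<close> of \<open>norm \<xi>\<close> in dimension \<open>d - 1\<close>,
  so \<open>-1/2\<close> is the threshold. Comparison with dyadic balls gives a geometric series.
  Negative \<open>\<sigma>\<close> is included for the sake of the majorant with
  \<open>\<sigma> = -1/4\<close>.\<close>

lemma C_const_finite:
  assumes \<sigma>: "\<sigma> > -1/2"
  shows "C_const TYPE('a::euclidean_space) \<sigma> < \<infinity>"
proof -
  define p where "p = real (DIM('a) + 1) / 2 + \<sigma>"
  \<comment> \<open>If \<open>k > 0\<close> is least with \<open>norm \<xi> \<le> 2 ^ k\<close>,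
    then \<open>norm \<xi>\<close> exceeds \<open>2 ^ (k - 1)\<close>. The factor
    \<open>2 powr (2 * p)\<close> pays for the loss of one dyadic step.\<close>
  define c where "c k = 2 powr (2 * p) * (2 powr (- 2 * p)) ^ k" for k :: nat
  have p: "2 * p > real DIM('a)" "p > 0" using \<sigma> by (auto simp: field_simps p_def)
  have bound: "ennreal (1 / (1 + (norm (\<xi>::'a))\<^sup>2) powr p) \<le> (\<Sum>k. ennreal (c k) * indicator (cball 0 (2 ^ k)) \<xi>)" for \<xi>
  proof -
    obtain m where m: "norm \<xi> < 2 ^ m" using real_arch_pow[of 2 "norm \<xi>"] by auto
    define k where "k = (LEAST k. norm \<xi> \<le> 2 ^ k)"
    have k: "norm \<xi> \<le> 2 ^ k" unfolding k_def by (rule LeastI[of _ m]) (use m in simp)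
    have "1 / (1 + (norm \<xi>)\<^sup>2) powr p \<le> c k"
    proof (cases k)
      case 0
      have "1 \<le> (1 + (norm \<xi>)\<^sup>2) powr p" using p by (intro ge_one_powr_ge_zero) auto
      moreover have "1 \<le> 2 powr (2 * p)" using p by (intro ge_one_powr_ge_zero) auto
      ultimately have "1 / (1 + (norm \<xi>)\<^sup>2) powr p \<le> 1 / 1" "1 \<le> c k"
        using 0 by (intro frac_le, simp_all add: c_def del: of_nat_add)
      then show ?thesis by linarith
    next
      case (Suc j)
      have "\<not> norm \<xi> \<le> 2 ^ j" using not_less_Least[of j "\<lambda>k. norm \<xi> \<le> 2 ^ k"] Suc by (simp add: k_def)
      then have "(2 ^ j)\<^sup>2 \<le> (norm \<xi>)\<^sup>2" by (intro power_mono) auto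
      then have "(2 ^ j)\<^sup>2 \<le> 1 + (norm \<xi>)\<^sup>2" by linarith
      moreover have "(2 ^ j)\<^sup>2 = (2::real) powr (2 * real j)"
        by (simp add: powr_realpow[symmetric] powr_powr mult.commute flip: powr_numeral)
      ultimately have "(2 powr (2 * real j)) powr p \<le> (1 + (norm \<xi>)\<^sup>2) powr p"
        using p by (intro powr_mono2) auto
      then have "1 / (1 + (norm \<xi>)\<^sup>2) powr p \<le> 1 / (2 powr (2 * real j)) powr p"
        by (intro divide_left_mono) (auto intro!: mult_pos_pos powr_gt_zero[THEN iffD2] add_pos_nonneg simp: add_nonneg_eq_0_iff)
      also have "\<dots> = 2 powr (- (2 * real j * p))"
        by (simp only: powr_powr powr_minus_divide)
      also have "\<dots> = 2 powr (2 * p) * 2 powr (- 2 * p * real (Suc j))"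
        unfolding powr_add[symmetric] by (rule arg_cong[where f="\<lambda>x. 2 powr x"]) (simp add: field_simps)
      also have "\<dots> = c k" using powr_realpow[of "2 powr (- 2 * p)" "Suc j"]
        unfolding Suc c_def powr_powr by (simp del: of_nat_Suc of_nat_add power_Suc)
      finally show ?thesis .
    qed
    then have "ennreal (1 / (1 + (norm \<xi>)\<^sup>2) powr p) \<le> ennreal (c k) * indicator (cball 0 (2 ^ k)) \<xi>"
      using k by (auto intro: ennreal_leI simp: indicator_def simp del: of_nat_add)
    also have "\<dots> \<le> (\<Sum>k. ennreal (c k) * indicator (cball 0 (2 ^ k)) \<xi>)"
    proof -
      define F where "F k = ennreal (c k) * indicator (cball 0 (2 ^ k)) \<xi>" for k
      have "F k \<le> suminf F" using sum_le_suminf[of F "{k}"] by simp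
      then show ?thesis unfolding F_def .
    qed
    finally show ?thesis .
  qed
  let ?v = "unit_ball_vol (real DIM('a))"
  have "C_const TYPE('a) \<sigma> \<le> (\<integral>\<^sup>+\<xi>. (\<Sum>k. ennreal (c k) * indicator (cball (0::'a) (2 ^ k)) \<xi>) \<partial>lborel)"
    unfolding C_const_def nn_integral_completion p_def[symmetric] by (rule nn_integral_mono) (rule bound)
  also have "\<dots> = (\<Sum>k. ennreal (c k) * emeasure lborel (cball (0::'a) (2 ^ k)))"
  proof -
    have b[measurable]: "cball (0::'a) r \<in> sets borel" for r by simp
    have m: "(\<lambda>\<xi>. ennreal (c k) * indicator (cball (0::'a) (2 ^ k)) \<xi>) \<in> borel_measurable lborel" for k
      by measurable
    show ?thesis unfolding nn_integral_suminf[OF m]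
      by (intro suminf_cong nn_integral_cmult_indicator) (simp add: b)
  qed
  also have "\<dots> = (\<Sum>k. ennreal (2 powr (2 * p) * ?v * (2 powr (real DIM('a) - 2 * p)) ^ k))"
  proof (intro suminf_cong)
    fix k
    have "c k * (?v * (2 ^ k) ^ DIM('a)) = 2 powr (2 * p) * ?v * ((2 powr (- 2 * p)) * 2 ^ DIM('a)) ^ k"
      unfolding c_def
      by (simp add: power_mult_distrib power_mult[symmetric] mult.commute[of k] del: of_nat_add)
    also have "(2 powr (- 2 * p)) * 2 ^ DIM('a) = 2 powr (real DIM('a) - 2 * p)"
      by (subst powr_realpow[symmetric]) (auto simp: powr_add[symmetric] algebra_simps)
    finally have eq: "c k * (?v * (2 ^ k) ^ DIM('a)) = 2 powr (2 * p) * ?v * (2 powr (real DIM('a) - 2 * p)) ^ k" .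
    have "ennreal (c k) * emeasure lborel (cball (0::'a) (2 ^ k)) = ennreal (c k * (?v * (2 ^ k) ^ DIM('a)))"
      by (subst emeasure_cball) (auto simp: ennreal_mult c_def simp del: of_nat_add)
    then show "ennreal (c k) * emeasure lborel (cball (0::'a) (2 ^ k)) = ennreal (2 powr (2 * p) * ?v * (2 powr (real DIM('a) - 2 * p)) ^ k)"
      unfolding eq .
  qed
  also have "\<dots> < \<infinity>"
  proof -
    have "2 powr (real DIM('a) - 2 * p) < 2 powr 0" using p(1) by (intro powr_less_mono) auto
    then have "summable (\<lambda>k. 2 powr (2 * p) * ?v * (2 powr (real DIM('a) - 2 * p)) ^ k)"
      by (intro summable_mult summable_geometric) simp
    then have "(\<Sum>k. ennreal (2 powr (2 * p) * ?v * (2 powr (real DIM('a) - 2 * p)) ^ k)) \<noteq> top"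
      by (rule ennreal_suminf_neq_top) auto
    then show ?thesis by (simp add: less_top)
  qed
  finally show ?thesis .
qed

text \<open>The kernel with \<open>\<sigma> = -1/4\<close> leaves the exponent
  \<open>1 + 2 \<sigma> = 1/2\<close> for the heights. Each side of \<open>x\<close> contributes at
  most the integral of \<open>r powr (-1/2)\<close> over the unit interval, which is 2.\<close>

lemma nn_integral_inverse_sqrt_bound:
  "(\<integral>\<^sup>+y. indicator {0<..<1} y * ennreal (1 / \<bar>y - x\<bar> powr (1/2)) \<partial>lborel) \<le> 4" if "x \<in> {0<..<1::real}"
proof -
  let ?f = "\<lambda>r::real. indicator {0..1} r * ennreal (r powr (-1/2))"
  have "((\<lambda>r. r powr (-1/2)) has_integral (1 powr (-1/2+1) / (-1/2+1))) {0..1::real}"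
    by (rule has_integral_powr_from_0) auto
  from nn_integral_has_integral_lebesgue[OF _ this]
  have f: "(\<integral>\<^sup>+r. ?f r \<partial>lborel) = 2"
    by (simp add: ennreal_mult' ennreal_indicator)
  have f': "(\<integral>\<^sup>+r. ?f (-r) \<partial>lborel) = 2"
    using nn_integral_lborel_affine[of ?f "-1" 0] f by simp
  have "(\<integral>\<^sup>+y. indicator {0<..<1} y * ennreal (1 / \<bar>y - x\<bar> powr (1/2)) \<partial>lborel)
    = (\<integral>\<^sup>+r. indicator {0<..<1} (x + 1 *\<^sub>R r) * ennreal (1 / \<bar>(x + 1 *\<^sub>R r) - x\<bar> powr (1/2)) \<partial>lborel)"
    by (subst nn_integral_lborel_affine[of _ 1 x]) auto
  also have "\<dots> \<le> (\<integral>\<^sup>+r. ?f r + ?f (-r) \<partial>lborel)"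
  proof (intro nn_integral_mono)
    fix r :: real
    have "1 / \<bar>r\<bar> powr (1/2) = \<bar>r\<bar> powr (-1/2)" by (simp add: powr_minus_divide)
    then show "indicator {0<..<1} (x + 1 *\<^sub>R r) * ennreal (1 / \<bar>(x + 1 *\<^sub>R r) - x\<bar> powr (1/2)) \<le> ?f r + ?f (-r)"
      using that by (auto simp: indicator_def)
  qed
  also have "\<dots> = 4" using f f' by (simp add: nn_integral_add)
  finally show ?thesis .
qed

section \<open>The functionals as instances of \<open>energy\<close>\<close>

text \<open>At \<open>\<epsilon> = 0\<close> the variable \<open>\<xi>\<close> occurs in the kernel
  only. Tonelli integrates it out, and \<open>C_const_scale\<close> supplies the constant and the
  remaining kernel.\<close>

lemma energy_0:
  fixes \<omega> :: "'a::euclidean_space set"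
  assumes \<omega>: "open \<omega>" and V: "V \<in> borel_measurable borel"
  shows "energy \<omega> 0 \<sigma> V = C_const TYPE('a) \<sigma> *
     (\<integral>\<^sup>+x. (\<integral>\<^sup>+b. (\<integral>\<^sup>+a. indicator (\<omega> \<times> {0<..<1}) (x, b) * indicator (\<omega> \<times> {0<..<1}) (x, a) *
        ennreal ((V (x, a) - V (x, b))\<^sup>2 / \<bar>a - b\<bar> powr (1 + 2 * \<sigma>)) \<partial>lborel) \<partial>lborel) \<partial>lborel)"
proof -
  note [measurable] = sets_cyl[OF \<omega>] V
  let ?g = "\<lambda>x b a. indicator (\<omega> \<times> {0<..<1}) (x, b) * indicator (\<omega> \<times> {0<..<1}) (x, a) *
        ennreal ((V (x, a) - V (x, b))\<^sup>2 / \<bar>a - b\<bar> powr (1 + 2 * \<sigma>))"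
  have D: "dens \<omega> 0 \<sigma> V \<in> borel_measurable borel" using \<omega> by measurable
  have Dm: "(\<lambda>x. dens \<omega> 0 \<sigma> V (g x)) \<in> borel_measurable borel" if "continuous_on UNIV g" for g :: "'c::topological_space \<Rightarrow> _"
    by (rule measurable_compose[OF borel_measurable_continuous_onI[OF that] D])
  have Vm: "(\<lambda>x. V (g x)) \<in> borel_measurable borel" if "continuous_on UNIV g" for g :: "'c::topological_space \<Rightarrow> _"
    by (rule measurable_compose[OF borel_measurable_continuous_onI[OF that] V])
  have Im: "(\<lambda>x. indicator (\<omega> \<times> {0<..<1::real}) (g x) :: ennreal) \<in> borel_measurable borel" if "continuous_on UNIV g" for g :: "'c::topological_space \<Rightarrow> _"
    by (rule measurable_compose[OF borel_measurable_continuous_onI[OF that]])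
       (intro borel_measurable_indicator sets_cyl \<omega>)
  have gm: "(\<lambda>q. ?g (fst (fst q)) (snd (fst q)) (snd q)) \<in> borel_measurable borel"
  proof -
    have [measurable]: "(\<lambda>q. snd q - snd (fst q)) \<in> borel_measurable (borel :: (('a \<times> real) \<times> real) measure)"
      by (intro borel_measurable_continuous_onI continuous_intros)
    have [measurable]: "(\<lambda>q::(('a \<times> real) \<times> real). V (fst (fst q), snd q)) \<in> borel_measurable borel"
       "(\<lambda>q::(('a \<times> real) \<times> real). V (fst (fst q), snd (fst q))) \<in> borel_measurable borel"
      by (intro Vm continuous_intros)+
    have [measurable]: "(\<lambda>q::(('a \<times> real) \<times> real). indicator (\<omega> \<times> {0<..<1}) (fst (fst q), snd q) :: ennreal) \<in> borel_measurable borel"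
       "(\<lambda>q::(('a \<times> real) \<times> real). indicator (\<omega> \<times> {0<..<1}) (fst (fst q), snd (fst q)) :: ennreal) \<in> borel_measurable borel"
      by (intro Im continuous_intros)+
    show ?thesis by measurable
  qed
  have m1: "(\<lambda>X. \<integral>\<^sup>+a. ?g (fst X) (snd X) a \<partial>lborel) \<in> borel_measurable borel"
    using borel_measurable_nn_integral_lborel(1)[OF gm] by simp
  have inner: "(\<integral>\<^sup>+\<xi>. dens \<omega> 0 \<sigma> V ((x, b), (\<xi>, a)) \<partial>lborel) = C_const TYPE('a) \<sigma> * ?g x b a" for x a b
  proof (cases "a = b")
    \<comment> \<open>\<open>C_const_scale\<close> excludes equal heights, but there the squared
      difference vanishes on both sides.\<close>
    case True
    then show ?thesis by (simp add: dens_def shift_def)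
  next
    case False
    let ?c = "indicator (\<omega> \<times> {0<..<1}) (x, b) * indicator (\<omega> \<times> {0<..<1}) (x, a) * ennreal ((V (x, a) - V (x, b))\<^sup>2)"
    let ?k = "\<lambda>\<xi>::'a. ennreal (1 / ((norm \<xi>)\<^sup>2 + (b - a)\<^sup>2) powr (real (DIM('a) + 1) / 2 + \<sigma>))"
    have "(\<integral>\<^sup>+\<xi>. dens \<omega> 0 \<sigma> V ((x, b), (\<xi>, a)) \<partial>lborel) = (\<integral>\<^sup>+\<xi>. ?c * ?k \<xi> \<partial>lborel)"
      by (intro nn_integral_cong) (simp add: dens_def shift_def kern_def ennreal_mult[symmetric] power2_commute[of "V (x, b)"] mult.assoc)
    also have "\<dots> = ?c * (\<integral>\<^sup>+\<xi>. ?k \<xi> \<partial>lborel)" by (rule nn_integral_cmult) simp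
    also have "(\<integral>\<^sup>+\<xi>. ?k \<xi> \<partial>lborel) = C_const TYPE('a) \<sigma> * ennreal (1 / \<bar>b - a\<bar> powr (1 + 2 * \<sigma>))"
      by (rule C_const_scale) (use False in simp)
    also have "?c * (C_const TYPE('a) \<sigma> * ennreal (1 / \<bar>b - a\<bar> powr (1 + 2 * \<sigma>))) = C_const TYPE('a) \<sigma> * ?g x b a"
      by (simp add: abs_minus_commute[of b] divide_inverse ennreal_mult' mult_ac)
    finally show ?thesis .
  qed
  have "energy \<omega> 0 \<sigma> V = (\<integral>\<^sup>+X. (\<integral>\<^sup>+Y. dens \<omega> 0 \<sigma> V (X, Y) \<partial>lborel) \<partial>lborel)"
    unfolding energy_def by (rule nn_integral_lborel_pair[OF D])
  also have "\<dots> = (\<integral>\<^sup>+X. (\<integral>\<^sup>+a. (\<integral>\<^sup>+\<xi>. dens \<omega> 0 \<sigma> V (X, (\<xi>, a)) \<partial>lborel) \<partial>lborel) \<partial>lborel)"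
    by (intro nn_integral_cong nn_integral_lborel_pair(2) Dm continuous_intros)
  also have "\<dots> = (\<integral>\<^sup>+X. (\<integral>\<^sup>+a. C_const TYPE('a) \<sigma> * ?g (fst X) (snd X) a \<partial>lborel) \<partial>lborel)"
    using inner by (intro nn_integral_cong) (metis prod.collapse)
  also have "\<dots> = (\<integral>\<^sup>+X. C_const TYPE('a) \<sigma> * (\<integral>\<^sup>+a. ?g (fst X) (snd X) a \<partial>lborel) \<partial>lborel)"
  proof -
    have "(\<lambda>a. ?g (fst X) (snd X) a) \<in> borel_measurable borel" for X
    proof -
      have "(\<lambda>a::real. (X, a)) \<in> borel_measurable borel"
        by (intro borel_measurable_continuous_onI continuous_intros)
      from measurable_compose[OF this gm] show ?thesis by simp
    qed
    then show ?thesis by (intro nn_integral_cong nn_integral_cmult) simp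
  qed
  also have "\<dots> = C_const TYPE('a) \<sigma> * (\<integral>\<^sup>+X. (\<integral>\<^sup>+a. ?g (fst X) (snd X) a \<partial>lborel) \<partial>lborel)"
    by (intro nn_integral_cmult) (use m1 in simp)
  also have "(\<integral>\<^sup>+X. (\<integral>\<^sup>+a. ?g (fst X) (snd X) a \<partial>lborel) \<partial>lborel) = (\<integral>\<^sup>+x. (\<integral>\<^sup>+b. (\<integral>\<^sup>+a. ?g x b a \<partial>lborel) \<partial>lborel) \<partial>lborel)"
    using nn_integral_lborel_pair(1)[OF m1] by simp
  finally show ?thesis .
qed

lemma AE_lborel_pair:
  fixes P :: "'a::euclidean_space \<times> 'b::euclidean_space \<Rightarrow> bool"
  assumes "AE p in lborel. P p"
  shows "AE x in lborel. AE y in lborel. P (x, y)"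
proof -
  have "AE p in lborel \<Otimes>\<^sub>M lborel. P p" unfolding lborel_prod by (rule assms)
  from lborel_pair.AE_pair[OF this] show ?thesis .
qed

text \<open>The limit functional takes Lebesgue measurable \<open>v\<close>, whereas the
  substitutions work with Borel functions. Almost every vertical line meets the exceptional set in a
  null set, so passing to \<open>V\<close> does not change the iterated integral.\<close>

lemma limit_energy_eq_energy:
  fixes \<omega> :: "'a::euclidean_space set"
  assumes \<omega>: "open \<omega>" and V: "V \<in> borel_measurable borel"
    and ae: "AE X in lborel. X \<in> \<omega> \<times> {0<..<1} \<longrightarrow> v X = V X"
  shows "limit_energy \<omega> \<sigma> v = energy \<omega> 0 \<sigma> V"
proof -
  have "AE x in lborel. AE t in lborel. (x, t) \<in> \<omega> \<times> {0<..<1} \<longrightarrow> v (x, t) = V (x, t)"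
    by (rule AE_lborel_pair[OF ae])
  then have "AE x in lborel.
     (\<integral>\<^sup>+b. (\<integral>\<^sup>+a. ennreal (\<bar>v (x, a) - v (x, b)\<bar>\<^sup>2 / \<bar>a - b\<bar> powr (1 + 2 * \<sigma>)) * indicator {0<..<1} a \<partial>lborel) * indicator {0<..<1} b \<partial>lborel) * indicator \<omega> x
    = (\<integral>\<^sup>+b. (\<integral>\<^sup>+a. indicator (\<omega> \<times> {0<..<1}) (x, b) * indicator (\<omega> \<times> {0<..<1}) (x, a) *
        ennreal ((V (x, a) - V (x, b))\<^sup>2 / \<bar>a - b\<bar> powr (1 + 2 * \<sigma>)) \<partial>lborel) \<partial>lborel)"
  proof eventually_elim
    case (elim x)
    show ?case
    proof (cases "x \<in> \<omega>")
      case True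
      have "(\<integral>\<^sup>+b. (\<integral>\<^sup>+a. ennreal (\<bar>v (x, a) - v (x, b)\<bar>\<^sup>2 / \<bar>a - b\<bar> powr (1 + 2 * \<sigma>)) * indicator {0<..<1} a \<partial>lborel) * indicator {0<..<1} b \<partial>lborel)
       = (\<integral>\<^sup>+b. (\<integral>\<^sup>+a. indicator (\<omega> \<times> {0<..<1}) (x, b) * indicator (\<omega> \<times> {0<..<1}) (x, a) *
          ennreal ((V (x, a) - V (x, b))\<^sup>2 / \<bar>a - b\<bar> powr (1 + 2 * \<sigma>)) \<partial>lborel) \<partial>lborel)"
      proof (rule nn_integral_cong_AE, use elim in eventually_elim)
        case (elim b)
        note b = elim
        show ?case
        proof (cases "b \<in> {0<..<1}")
          case b01: True
          have "(\<integral>\<^sup>+a. ennreal (\<bar>v (x, a) - v (x, b)\<bar>\<^sup>2 / \<bar>a - b\<bar> powr (1 + 2 * \<sigma>)) * indicator {0<..<1} a \<partial>lborel)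
           = (\<integral>\<^sup>+a. indicator (\<omega> \<times> {0<..<1}) (x, b) * indicator (\<omega> \<times> {0<..<1}) (x, a) *
              ennreal ((V (x, a) - V (x, b))\<^sup>2 / \<bar>a - b\<bar> powr (1 + 2 * \<sigma>)) \<partial>lborel)"
          proof (rule nn_integral_cong_AE, use \<open>AE t in lborel. (x, t) \<in> \<omega> \<times> {0<..<1} \<longrightarrow> v (x, t) = V (x, t)\<close> in eventually_elim)
            case (elim a)
            then show ?case using b b01 True by (auto simp: indicator_def)
          qed
          then show ?thesis using b01 by simp
        qed simp
      qed
      then show ?thesis using True by simp
    qed (simp add: indicator_def)
  qed
  then have "(\<integral>\<^sup>+x. (\<integral>\<^sup>+b. (\<integral>\<^sup>+a. ennreal (\<bar>v (x, a) - v (x, b)\<bar>\<^sup>2 / \<bar>a - b\<bar> powr (1 + 2 * \<sigma>)) * indicator {0<..<1} a \<partial>lborel) * indicator {0<..<1} b \<partial>lborel) * indicator \<omega> x \<partial>lborel)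
    = (\<integral>\<^sup>+x. (\<integral>\<^sup>+b. (\<integral>\<^sup>+a. indicator (\<omega> \<times> {0<..<1}) (x, b) * indicator (\<omega> \<times> {0<..<1}) (x, a) *
        ennreal ((V (x, a) - V (x, b))\<^sup>2 / \<bar>a - b\<bar> powr (1 + 2 * \<sigma>)) \<partial>lborel) \<partial>lborel) \<partial>lborel)"
    by (rule nn_integral_cong_AE)
  then show ?thesis using \<omega>
    unfolding limit_energy_def energy_0[OF \<omega> V] by (simp add: nn_integral_lebesgue_on)
qed

text \<open>The prefactor contributes \<open>\<epsilon> powr (2 \<sigma> - 1)\<close>, the first
  height \<open>\<epsilon>\<close>, and the second point \<open>\<epsilon> ^ d\<close> with
  \<open>d = DIM('a \<times> real)\<close>. The product
  \<open>\<epsilon> powr (d + 2 \<sigma>)\<close> is exactly the scaling of the denominator.\<close>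

lemma scaled_seminorm_eq_energy:
  fixes \<omega> :: "'a::euclidean_space set"
  assumes \<omega>: "open \<omega>" and U: "U \<in> borel_measurable borel" and \<epsilon>: "\<epsilon> > 0"
  shows "ennreal (1 / \<epsilon> powr (1 - 2 * \<sigma>)) *
     (\<integral>\<^sup>+X. (\<integral>\<^sup>+Y. ennreal (\<bar>U X - U Y\<bar>\<^sup>2 / norm (X - Y) powr (real DIM('a \<times> real) + 2 * \<sigma>)) * indicator (\<omega> \<times> {0<..<\<epsilon>}) Y \<partial>lborel)
         * indicator (\<omega> \<times> {0<..<\<epsilon>}) X \<partial>lborel)
     = energy \<omega> \<epsilon> \<sigma> (\<lambda>X. U (fst X, \<epsilon> * snd X))"
proof -
  let ?\<Omega> = "\<omega> \<times> {0<..<\<epsilon>}"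
  let ?q = "real DIM('a \<times> real) + 2 * \<sigma>"
  define G where "G p = ennreal (\<bar>U (fst p) - U (snd p)\<bar>\<^sup>2 / norm (fst p - snd p) powr ?q) * indicator ?\<Omega> (snd p) * indicator ?\<Omega> (fst p)" for p
  have [measurable]: "?\<Omega> \<in> sets borel" using \<omega> by (intro borel_open open_Times) auto
  note [measurable] = U
  have G[measurable]: "G \<in> borel_measurable borel"
  proof -
    have [measurable]: "(\<lambda>p. norm (fst p - snd p)) \<in> borel_measurable (borel :: (('a \<times> real) \<times> ('a \<times> real)) measure)"
      by (intro borel_measurable_continuous_onI continuous_intros)
    show ?thesis unfolding G_def by measurable
  qed
  have Gm: "(\<lambda>x. G (g x)) \<in> borel_measurable borel" if "continuous_on UNIV g" for g :: "'c::topological_space \<Rightarrow> _"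
    by (rule measurable_compose[OF borel_measurable_continuous_onI[OF that] G])
  let ?S = "\<lambda>X::'a \<times> real. (fst X, \<epsilon> * snd X)"
  \<comment> \<open>The second point is measured from \<open>(x', 0)\<close>, so that one dilation
    by \<open>\<epsilon>\<close> scales \<open>\<xi>\<close> and \<open>\<tau>\<close> together. The
    result is the image of \<open>shift \<epsilon> P\<close> under \<open>?S\<close>.\<close>
  let ?T = "\<lambda>P::('a \<times> real) \<times> ('a \<times> real). (fst (fst P), 0) + \<epsilon> *\<^sub>R snd P"
  let ?c1 = "1 / \<epsilon> powr (1 - 2 * \<sigma>)"
  let ?c2 = "\<epsilon> ^ DIM('a \<times> real)"
  have "(\<integral>\<^sup>+X. (\<integral>\<^sup>+Y. ennreal (\<bar>U X - U Y\<bar>\<^sup>2 / norm (X - Y) powr ?q) * indicator ?\<Omega> Y \<partial>lborel) * indicator ?\<Omega> X \<partial>lborel)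
    = (\<integral>\<^sup>+X. (\<integral>\<^sup>+Y. G (X, Y) \<partial>lborel) \<partial>lborel)"
    by (intro nn_integral_cong) (auto simp: G_def indicator_def)
  also have "\<dots> = ennreal \<epsilon> * (\<integral>\<^sup>+X. (\<integral>\<^sup>+Y. G (?S X, Y) \<partial>lborel) \<partial>lborel)"
    using nn_integral_shear[OF borel_measurable_nn_integral_lborel(1)[OF G] \<epsilon>, of 0 0] by (simp add: shear_def)
  also have "\<dots> = ennreal \<epsilon> * (\<integral>\<^sup>+X. ennreal ?c2 * (\<integral>\<^sup>+Y. G (?S X, ?T (X, Y)) \<partial>lborel) \<partial>lborel)"
  proof (intro arg_cong[where f="\<lambda>x. ennreal \<epsilon> * x"] nn_integral_cong)
    fix X :: "'a \<times> real"
    show "(\<integral>\<^sup>+Y. G (?S X, Y) \<partial>lborel) = ennreal ?c2 * (\<integral>\<^sup>+Y. G (?S X, ?T (X, Y)) \<partial>lborel)"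
      using \<epsilon> by (subst nn_integral_lborel_affine[where c=\<epsilon> and t="(fst X, 0)"])
        (auto intro!: Gm continuous_intros)
  qed
  also have "\<dots> = ennreal \<epsilon> * (ennreal ?c2 * (\<integral>\<^sup>+X. (\<integral>\<^sup>+Y. G (?S X, ?T (X, Y)) \<partial>lborel) \<partial>lborel))"
  proof -
    have "(\<lambda>P. G (?S (fst P), ?T P)) \<in> borel_measurable borel" by (intro Gm continuous_intros)
    from borel_measurable_nn_integral_lborel(1)[OF this]
    show ?thesis by (subst nn_integral_cmult) simp_all
  qed
  also have "(\<integral>\<^sup>+X. (\<integral>\<^sup>+Y. G (?S X, ?T (X, Y)) \<partial>lborel) \<partial>lborel) = (\<integral>\<^sup>+P. G (?S (fst P), ?T P) \<partial>lborel)"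
    by (subst nn_integral_lborel_pair(1)) (auto intro!: Gm continuous_intros)
  finally have "ennreal ?c1 * (\<integral>\<^sup>+X. (\<integral>\<^sup>+Y. ennreal (\<bar>U X - U Y\<bar>\<^sup>2 / norm (X - Y) powr ?q) * indicator ?\<Omega> Y \<partial>lborel) * indicator ?\<Omega> X \<partial>lborel)
     = ennreal ?c1 * (ennreal \<epsilon> * (ennreal ?c2 * (\<integral>\<^sup>+P. G (?S (fst P), ?T P) \<partial>lborel)))" by simp
  also have "\<dots> = ennreal (?c1 * \<epsilon> * ?c2) * (\<integral>\<^sup>+P. G (?S (fst P), ?T P) \<partial>lborel)"
    using \<epsilon> by (simp add: ennreal_mult[symmetric] mult.assoc[symmetric] del: DIM_prod)
  also have "\<dots> = (\<integral>\<^sup>+P. ennreal (?c1 * \<epsilon> * ?c2) * G (?S (fst P), ?T P) \<partial>lborel)"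
    by (intro nn_integral_cmult[symmetric]) (auto intro!: Gm continuous_intros)
  also have "\<dots> = energy \<omega> \<epsilon> \<sigma> (\<lambda>X. U (?S X))" unfolding energy_def
  proof (rule nn_integral_cong)
    fix P :: "('a \<times> real) \<times> ('a \<times> real)"
    let ?V = "\<lambda>X. U (?S X)"
    let ?r = "(norm (fst (snd P)))\<^sup>2 + (snd (fst P) - snd (snd P))\<^sup>2"
    have T: "?T P = ?S (shift \<epsilon> P)" by (cases P; cases "snd P") (simp add: shift_def prod_eq_iff)
    have i1: "indicator ?\<Omega> (?T P) = (indicator (\<omega> \<times> {0<..<1}) (shift \<epsilon> P) :: ennreal)"
      using \<epsilon> unfolding T by (auto simp: indicator_def shift_def zero_less_mult_iff)
    have i2: "indicator ?\<Omega> (?S (fst P)) = (indicator (\<omega> \<times> {0<..<1}) (fst P) :: ennreal)"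
      using \<epsilon> by (cases "fst P") (auto simp: indicator_def zero_less_mult_iff)
    have "norm (?S (fst P) - ?T P) = sqrt (\<epsilon>\<^sup>2 * ?r)"
      by (simp add: norm_Pair power_mult_distrib algebra_simps power2_eq_square norm_prod_def)
    also have "\<dots> = \<epsilon> * ?r powr (1/2)" using \<epsilon> by (simp add: real_sqrt_mult powr_half_sqrt)
    finally have nrm: "norm (?S (fst P) - ?T P) = \<epsilon> * ?r powr (1/2)" .
    have "norm (?S (fst P) - ?T P) powr ?q = \<epsilon> powr ?q * ?r powr (1/2 * ?q)"
      unfolding nrm powr_mult powr_powr ..
    also have "1/2 * ?q = real (DIM('a) + 1) / 2 + \<sigma>" by (simp add: field_simps)
    finally have n: "norm (?S (fst P) - ?T P) powr ?q = \<epsilon> powr ?q * ?r powr (real (DIM('a) + 1) / 2 + \<sigma>)" .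
    have "?c1 * \<epsilon> * ?c2 = \<epsilon> powr ?q"
      using \<epsilon> by (simp add: powr_realpow[symmetric] powr_add powr_diff field_simps)
    then have c: "?c1 * \<epsilon> * ?c2 * (\<bar>U (?S (fst P)) - U (?T P)\<bar>\<^sup>2 / norm (?S (fst P) - ?T P) powr ?q)
       = (U (?S (fst P)) - U (?S (shift \<epsilon> P)))\<^sup>2 * kern \<sigma> P"
      using \<epsilon> unfolding n unfolding kern_def T by (simp add: field_simps del: of_nat_add)
    show "ennreal (?c1 * \<epsilon> * ?c2) * G (?S (fst P), ?T P) = dens \<omega> \<epsilon> \<sigma> ?V P"
      unfolding dens_def G_def fst_conv snd_conv i1 i2 c[symmetric] using \<epsilon>
      by (subst ennreal_mult) (auto simp: mult_ac)
  qed
  finally show ?thesis .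
qed

lemma seminorm_sq_AE:
  fixes u U :: "'a::euclidean_space \<Rightarrow> real"
  assumes A: "A \<in> sets lebesgue" and ae: "AE X in lborel. X \<in> A \<longrightarrow> u X = U X"
  shows "seminorm_sq \<sigma> A u = (\<integral>\<^sup>+X. (\<integral>\<^sup>+Y. ennreal (\<bar>U X - U Y\<bar>\<^sup>2 / norm (X - Y) powr (real DIM('a) + 2 * \<sigma>)) * indicator A Y \<partial>lborel)
         * indicator A X \<partial>lborel)"
  unfolding seminorm_sq_def nn_integral_lebesgue_on[OF A]
proof (rule nn_integral_cong_AE, use ae in eventually_elim)
  case (elim X)
  show ?case
  proof (cases "X \<in> A")
    case True
    have "(\<integral>\<^sup>+Y. ennreal (\<bar>u X - u Y\<bar>\<^sup>2 / norm (X - Y) powr (real DIM('a) + 2 * \<sigma>)) * indicator A Y \<partial>lborel) =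
      (\<integral>\<^sup>+Y. ennreal (\<bar>U X - U Y\<bar>\<^sup>2 / norm (X - Y) powr (real DIM('a) + 2 * \<sigma>)) * indicator A Y \<partial>lborel)"
      by (rule nn_integral_cong_AE, use ae in eventually_elim) (use elim True in \<open>auto simp: indicator_def\<close>)
    then show ?thesis by simp
  qed simp
qed

lemma thin_energy_eq_energy:
  fixes \<omega> :: "'a::euclidean_space set"
  assumes \<omega>: "open \<omega>" and U: "U \<in> borel_measurable borel" and \<epsilon>: "\<epsilon> > 0"
    and ae: "AE X in lborel. X \<in> thin_domain \<omega> \<epsilon> \<longrightarrow> u X = U X"
  shows "thin_energy \<omega> s \<epsilon> u = energy \<omega> \<epsilon> (s \<epsilon>) (\<lambda>X. U (fst X, \<epsilon> * snd X))"
proof -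
  have "open (thin_domain \<omega> \<epsilon>)" unfolding thin_domain_def using \<omega> by (intro open_Times) auto
  then have "thin_domain \<omega> \<epsilon> \<in> sets lebesgue" by auto
  from seminorm_sq_AE[OF this ae, of "s \<epsilon>"] show ?thesis
    unfolding thin_energy_def scaled_seminorm_eq_energy[OF \<omega> U \<epsilon>, symmetric] by (simp add: thin_domain_def)
qed

lemma borel_representative:
  fixes u :: "'a::euclidean_space \<Rightarrow> real"
  assumes "A \<in> sets lebesgue" "u \<in> borel_measurable (lebesgue_on A)"
  obtains U where "U \<in> borel_measurable borel" "AE X in lborel. X \<in> A \<longrightarrow> u X = U X"
proof -
  have "(\<lambda>X. if X \<in> A then u X else 0) \<in> borel_measurable lebesgue"
    using assms by (subst borel_measurable_if)
  from completion_ex_borel_measurable_real[OF this]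
  obtain U where "U \<in> borel_measurable borel" "AE X in lborel. (if X \<in> A then u X else 0) = U X"
    by (auto simp: measurable_lborel1)
  moreover from this(2) have "AE X in lborel. X \<in> A \<longrightarrow> u X = U X" by eventually_elim auto
  ultimately show ?thesis using that by blast
qed

section \<open>The lower bound\<close>

text \<open>The sum of the integrals is finite, so the sum of the functions is finite almost
  everywhere and its terms tend to 0. The geometric rate makes a further passage to a subsequence
  unnecessary.\<close>

lemma AE_tendsto_0_of_summable:
  fixes h :: "nat \<Rightarrow> 'b \<Rightarrow> ennreal"
  assumes [measurable]: "\<And>k. h k \<in> borel_measurable M"
    and le: "\<And>k. (\<integral>\<^sup>+x. h k x \<partial>M) \<le> ennreal ((1/2) ^ k)"
  shows "AE x in M. (\<lambda>k. h k x) \<longlonglongrightarrow> 0"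
proof -
  have "(\<integral>\<^sup>+x. (\<Sum>k. h k x) \<partial>M) = (\<Sum>k. \<integral>\<^sup>+x. h k x \<partial>M)"
    by (rule nn_integral_suminf) simp
  also have "\<dots> \<le> (\<Sum>k. ennreal ((1/2) ^ k))"
    by (intro suminf_le le) auto
  also have "\<dots> < top" unfolding less_top[symmetric] by (intro ennreal_suminf_neq_top summable_geometric) auto
  finally have "(\<integral>\<^sup>+x. (\<Sum>k. h k x) \<partial>M) \<noteq> \<infinity>" by (auto simp: top_unique)
  from nn_integral_noteq_infinite[OF _ this]
  have "AE x in M. (\<Sum>k. h k x) \<noteq> \<infinity>" by simp
  then show ?thesis
  proof eventually_elim
    case (elim x)
    have "h k x \<le> (\<Sum>k. h k x)" for k
      using sum_le_suminf[of "\<lambda>k. h k x" "{k}"] by simp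
    then have h: "h k x = ennreal (enn2real (h k x))" for k
      using elim by (metis ennreal_enn2real infinity_ennreal_def less_top top_unique)
    have "summable (\<lambda>k. enn2real (h k x))"
      by (rule summable_suminf_not_top) (use elim h in auto)
    then have "(\<lambda>k. ennreal (enn2real (h k x))) \<longlonglongrightarrow> ennreal 0"
      by (intro tendsto_ennrealI summable_LIMSEQ_zero)
    then show ?case using h by simp
  qed
qed

lemma tendsto_0_of_ennreal_square:
  fixes a :: "nat \<Rightarrow> real"
  assumes "(\<lambda>k. ennreal ((a k)\<^sup>2)) \<longlonglongrightarrow> 0"
  shows "a \<longlonglongrightarrow> 0"
proof -
  have "(\<lambda>k. enn2real (ennreal ((a k)\<^sup>2))) \<longlonglongrightarrow> 0"
    by (rule tendsto_enn2real) (use assms in auto)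
  then have "(\<lambda>k. sqrt (enn2real (ennreal ((a k)\<^sup>2)))) \<longlonglongrightarrow> sqrt 0"
    by (intro tendsto_real_sqrt)
  then show ?thesis by (simp add: tendsto_rabs_zero_iff)
qed

section \<open>Local L2 convergence along small translations\<close>

text \<open>Room for shifts: points near \<open>K\<close> stay in a compact set on which local
  convergence is still available.\<close>

lemma compact_enlarge:
  fixes K :: "'a::euclidean_space set"
  assumes "compact K" "open S" "K \<subseteq> S"
  obtains \<rho> K' where "\<rho> > 0" "compact K'" "K' \<subseteq> S" "\<And>x y. x \<in> K \<Longrightarrow> dist x y \<le> \<rho> \<Longrightarrow> y \<in> K'"
proof (cases "K = {}")
  case True
  then show ?thesis using that[of 1 "{}"] by auto
next
  case False
  obtain e where e: "e > 0" "(\<Union>x\<in>K. ball x e) \<subseteq> S"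
    using compact_subset_open_imp_ball_epsilon_subset[OF assms] .
  show ?thesis
  proof (rule that[of "e/2" "{x. infdist x K \<le> e/2}"])
    show "compact {x. infdist x K \<le> e/2}" using False e assms by (intro compact_infdist_le) auto
    show "{x. infdist x K \<le> e/2} \<subseteq> S"
    proof safe
      fix x assume x: "infdist x K \<le> e/2"
      obtain y where "y \<in> K" "infdist x K = dist x y"
        using infdist_attains_inf[OF compact_imp_closed[OF assms(1)] False] by metis
      then have "y \<in> K" "x \<in> ball y e" using e x by (auto simp: dist_commute)
      then show "x \<in> S" using e(2) by blast
    qed
    show "y \<in> {x. infdist x K \<le> e/2}" if "x \<in> K" "dist x y \<le> e/2" for x y
      using infdist_le2[OF that(1), of y "e/2"] that(2) by (simp add: dist_commute)
  qed (use e in auto)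
qed

text \<open>The difference splits into \<open>V \<epsilon> - V0\<close> at the shifted point and the
  increment of \<open>V0\<close>. Translation invariance bounds the first by the convergence on a
  larger compact set; L2 continuity of the cut-off function \<open>F\<close> bounds the second. Both
  bounds are uniform over the ball, because \<open>\<xi>\<close> is integrated afterwards.\<close>

lemma shear_L2_loc_eventually:
  fixes V :: "real \<Rightarrow> 'a::euclidean_space \<times> real \<Rightarrow> real"
  assumes S: "open S" and V[measurable]: "\<And>\<epsilon>. V \<epsilon> \<in> borel_measurable borel" and V0[measurable]: "V0 \<in> borel_measurable borel"
    and loc: "\<And>K. compact K \<Longrightarrow> K \<subseteq> S \<Longrightarrow> (\<integral>\<^sup>+X. ennreal ((V0 X)\<^sup>2) * indicator K X \<partial>lborel) < \<infinity>"
    and conv: "\<And>K. compact K \<Longrightarrow> K \<subseteq> S \<Longrightarrow>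
        ((\<lambda>\<epsilon>. \<integral>\<^sup>+X. ennreal ((V \<epsilon> X - V0 X)\<^sup>2) * indicator K X \<partial>lborel) \<longlongrightarrow> 0) (at_right 0)"
    and K: "compact K" "K \<subseteq> S" and R: "R > 0" and r: "r > 0"
  shows "eventually (\<lambda>\<epsilon>. \<forall>\<xi>. norm \<xi> \<le> R \<longrightarrow>
      (\<integral>\<^sup>+X. ennreal ((V \<epsilon> (shear (\<epsilon> *\<^sub>R \<xi>) 1 0 X) - V0 X)\<^sup>2) * indicator K X \<partial>lborel) \<le> ennreal r) (at_right 0)"
proof -
  obtain \<rho> K' where \<rho>: "\<rho> > 0" "compact K'" "K' \<subseteq> S" "\<And>x y. x \<in> K \<Longrightarrow> dist x y \<le> \<rho> \<Longrightarrow> y \<in> K'"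
    using compact_enlarge[OF K(1) S K(2)] by metis
  have [measurable]: "K' \<in> sets borel" "K \<in> sets borel" using \<rho> K by (auto intro: borel_compact)
  define F where "F = (\<lambda>X. V0 X * indicator K' X)"
  have F[measurable]: "F \<in> borel_measurable borel" unfolding F_def by measurable
  have "(\<integral>\<^sup>+X. ennreal ((F X)\<^sup>2) \<partial>lborel) = (\<integral>\<^sup>+X. ennreal ((V0 X)\<^sup>2) * indicator K' X \<partial>lborel)"
    by (intro nn_integral_cong) (auto simp: F_def indicator_def)
  then have "(\<integral>\<^sup>+X. ennreal ((F X)\<^sup>2) \<partial>lborel) < \<infinity>" using loc[OF \<rho>(2,3)] by simp
  from shear_L2_eps[OF F this, of "r/4"] r obtain \<delta> where \<delta>: "\<delta> > 0"
    and F\<delta>: "\<And>z a b. norm z < \<delta> \<Longrightarrow> \<bar>a - 1\<bar> < \<delta> \<Longrightarrow> \<bar>b\<bar> < \<delta> \<Longrightarrow>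
     (\<integral>\<^sup>+X. ennreal ((F (shear z a b X) - F X)\<^sup>2) \<partial>lborel) \<le> ennreal (r/4)"
    by auto
  \<comment> \<open>Below this threshold every translation \<open>\<epsilon> \<xi>\<close> is
    shorter than \<open>\<delta>\<close>, for the continuity of \<open>F\<close>, and than
    \<open>\<rho>\<close>, so that points of \<open>K\<close> stay in \<open>K'\<close>.\<close>
  have "eventually (\<lambda>\<epsilon>::real. 0 < \<epsilon> \<and> \<epsilon> < min \<delta> \<rho> / R) (at_right 0)"
    using \<delta> \<rho> R by (auto simp: eventually_at_right_less intro!: eventually_conj eventually_at_rightI[of 0 "min \<delta> \<rho> / R"])
  moreover have "eventually (\<lambda>\<epsilon>. (\<integral>\<^sup>+X. ennreal ((V \<epsilon> X - V0 X)\<^sup>2) * indicator K' X \<partial>lborel) \<le> ennreal (r/4)) (at_right 0)"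
    by (rule eventually_le_ennreal_of_tendsto_0[OF conv[OF \<rho>(2,3)]]) (use r in simp)
  ultimately show ?thesis
  proof (eventually_elim, intro allI impI)
    case (elim \<epsilon>)
    fix \<xi> :: 'a assume \<xi>: "norm \<xi> \<le> R"
    let ?S = "shear (\<epsilon> *\<^sub>R \<xi>) 1 0"
    have "norm (\<epsilon> *\<^sub>R \<xi>) \<le> \<epsilon> * R" using elim \<xi> by (auto intro: mult_left_mono)
    also have "\<dots> < min \<delta> \<rho>" using elim R by (simp add: field_simps)
    finally have n: "norm (\<epsilon> *\<^sub>R \<xi>) < min \<delta> \<rho>" .
    have "(\<integral>\<^sup>+X. ennreal ((V \<epsilon> (?S X) - V0 X)\<^sup>2) * indicator K X \<partial>lborel)
      \<le> (\<integral>\<^sup>+X. 2 * (ennreal ((V \<epsilon> (?S X) - V0 (?S X))\<^sup>2) * indicator K' (?S X)) + 2 * ennreal ((F (?S X) - F X)\<^sup>2) \<partial>lborel)"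
    proof (intro nn_integral_mono)
      fix X :: "'a \<times> real"
      show "ennreal ((V \<epsilon> (?S X) - V0 X)\<^sup>2) * indicator K X \<le>
        2 * (ennreal ((V \<epsilon> (?S X) - V0 (?S X))\<^sup>2) * indicator K' (?S X)) + 2 * ennreal ((F (?S X) - F X)\<^sup>2)"
      proof (cases "X \<in> K")
        case True
        have "dist X (?S X) = norm (\<epsilon> *\<^sub>R \<xi>)"
          by (cases X) (simp add: shear_def dist_Pair_Pair dist_norm)
        then have in': "?S X \<in> K'" "X \<in> K'" using \<rho>(4)[OF True, of "?S X"] \<rho>(4)[OF True, of X] n \<rho>(1) by auto
        have "(V \<epsilon> (?S X) - V0 X)\<^sup>2 \<le> 2 * (V \<epsilon> (?S X) - V0 (?S X))\<^sup>2 + 2 * (V0 (?S X) - V0 X)\<^sup>2"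
          using sum_squares_bound[of "V \<epsilon> (?S X) - V0 (?S X)" "V0 (?S X) - V0 X"]
          by (simp add: power2_eq_square algebra_simps)
        then have "ennreal ((V \<epsilon> (?S X) - V0 X)\<^sup>2) \<le> ennreal (2 * (V \<epsilon> (?S X) - V0 (?S X))\<^sup>2 + 2 * (V0 (?S X) - V0 X)\<^sup>2)"
          by (rule ennreal_leI)
        also have "\<dots> = 2 * ennreal ((V \<epsilon> (?S X) - V0 (?S X))\<^sup>2) + 2 * ennreal ((V0 (?S X) - V0 X)\<^sup>2)"
          by (simp add: ennreal_mult)
        finally show ?thesis using True in' by (simp add: F_def)
      qed simp
    qed
    also have "\<dots> = 2 * (\<integral>\<^sup>+X. ennreal ((V \<epsilon> (?S X) - V0 (?S X))\<^sup>2) * indicator K' (?S X) \<partial>lborel)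
       + 2 * (\<integral>\<^sup>+X. ennreal ((F (?S X) - F X)\<^sup>2) \<partial>lborel)"
      by (simp add: nn_integral_add nn_integral_cmult)
    also have "(\<integral>\<^sup>+X. ennreal ((V \<epsilon> (?S X) - V0 (?S X))\<^sup>2) * indicator K' (?S X) \<partial>lborel)
       = (\<integral>\<^sup>+X. ennreal ((V \<epsilon> X - V0 X)\<^sup>2) * indicator K' X \<partial>lborel)"
      using nn_integral_shear[of "\<lambda>X. ennreal ((V \<epsilon> X - V0 X)\<^sup>2) * indicator K' X" 1 "\<epsilon> *\<^sub>R \<xi>" 0] by simp
    also have "2 * (\<integral>\<^sup>+X. ennreal ((V \<epsilon> X - V0 X)\<^sup>2) * indicator K' X \<partial>lborel) + 2 * (\<integral>\<^sup>+X. ennreal ((F (?S X) - F X)\<^sup>2) \<partial>lborel)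
       \<le> 2 * ennreal (r/4) + 2 * ennreal (r/4)"
      using elim F\<delta>[of "\<epsilon> *\<^sub>R \<xi>" 1 0] n \<delta> by (intro add_mono mult_left_mono) auto
    also have "\<dots> = ennreal r"
      using r by (simp add: ennreal_mult[symmetric] ennreal_plus[symmetric] flip: ennreal_numeral del: ennreal_plus)
    finally show "(\<integral>\<^sup>+X. ennreal ((V \<epsilon> (?S X) - V0 X)\<^sup>2) * indicator K X \<partial>lborel) \<le> ennreal r" .
  qed
qed

text \<open>The second point of \<open>P\<close> is a horizontal translate of
  \<open>(x, \<tau>)\<close>, not of \<open>(x, t)\<close>. Exchanging \<open>t\<close> and
  \<open>\<tau>\<close> turns it into a shear of \<open>fst P\<close>, so that the translation
  estimate applies to it as well.\<close>

definition swap_heights :: "('a::euclidean_space \<times> real) \<times> ('a \<times> real) \<Rightarrow> ('a \<times> real) \<times> ('a \<times> real)" where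
  "swap_heights P = ((fst (fst P), snd (snd P)), (fst (snd P), snd (fst P)))"

lemma measurable_swap_heights [measurable]: "swap_heights \<in> borel_measurable borel"
  unfolding swap_heights_def by (intro borel_measurable_continuous_onI continuous_intros)

text \<open>Tonelli brings the two heights next to each other, where they can be exchanged.\<close>

lemma nn_integral_swap_heights:
  fixes F :: "('a::euclidean_space \<times> real) \<times> ('a \<times> real) \<Rightarrow> ennreal"
  assumes F: "F \<in> borel_measurable borel"
  shows "(\<integral>\<^sup>+P. F (swap_heights P) \<partial>lborel) = (\<integral>\<^sup>+P. F P \<partial>lborel)"
proof -
  have *: "(\<integral>\<^sup>+P. F P \<partial>lborel) = (\<integral>\<^sup>+x. \<integral>\<^sup>+\<xi>. \<integral>\<^sup>+t. \<integral>\<^sup>+\<tau>. F ((x, t), (\<xi>, \<tau>)) \<partial>lborel \<partial>lborel \<partial>lborel \<partial>lborel)"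
    if F: "F \<in> borel_measurable borel" for F :: "('a \<times> real) \<times> ('a \<times> real) \<Rightarrow> ennreal"
  proof -
    have Fm: "(\<lambda>x. F (g x)) \<in> borel_measurable borel" if "continuous_on UNIV g" for g :: "'c::topological_space \<Rightarrow> _"
      by (rule measurable_compose[OF borel_measurable_continuous_onI[OF that] F])
    have m: "(\<lambda>q. \<integral>\<^sup>+\<tau>. F ((x, fst q), (snd q, \<tau>)) \<partial>lborel) \<in> borel_measurable borel" for x
      using borel_measurable_nn_integral_lborel(1)[OF Fm[of "\<lambda>z::(real \<times> 'a) \<times> real. ((x, fst (fst z)), (snd (fst z), snd z))"]]
      by (simp add: continuous_intros)
    have "(\<integral>\<^sup>+P. F P \<partial>lborel) = (\<integral>\<^sup>+X. \<integral>\<^sup>+Y. F (X, Y) \<partial>lborel \<partial>lborel)"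
      by (rule nn_integral_lborel_pair[OF F])
    also have "\<dots> = (\<integral>\<^sup>+x. \<integral>\<^sup>+t. \<integral>\<^sup>+Y. F ((x, t), Y) \<partial>lborel \<partial>lborel \<partial>lborel)"
      by (rule nn_integral_lborel_pair(1)[OF borel_measurable_nn_integral_lborel(1)[OF F]])
    also have "\<dots> = (\<integral>\<^sup>+x. \<integral>\<^sup>+t. \<integral>\<^sup>+\<xi>. \<integral>\<^sup>+\<tau>. F ((x, t), (\<xi>, \<tau>)) \<partial>lborel \<partial>lborel \<partial>lborel \<partial>lborel)"
      by (intro nn_integral_cong nn_integral_lborel_pair(1) Fm continuous_intros)
    also have "\<dots> = (\<integral>\<^sup>+x. \<integral>\<^sup>+\<xi>. \<integral>\<^sup>+t. \<integral>\<^sup>+\<tau>. F ((x, t), (\<xi>, \<tau>)) \<partial>lborel \<partial>lborel \<partial>lborel \<partial>lborel)"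
      by (intro nn_integral_cong nn_integral_lborel_swap m)
    finally show ?thesis .
  qed
  have Fm: "(\<lambda>x. F (g x)) \<in> borel_measurable borel" if "continuous_on UNIV g" for g :: "'c::topological_space \<Rightarrow> _"
    by (rule measurable_compose[OF borel_measurable_continuous_onI[OF that] F])
  have "(\<integral>\<^sup>+P. F (swap_heights P) \<partial>lborel) = (\<integral>\<^sup>+x. \<integral>\<^sup>+\<xi>. \<integral>\<^sup>+t. \<integral>\<^sup>+\<tau>. F ((x, \<tau>), (\<xi>, t)) \<partial>lborel \<partial>lborel \<partial>lborel \<partial>lborel)"
    by (subst *) (auto simp: swap_heights_def intro!: Fm continuous_intros)
  also have "\<dots> = (\<integral>\<^sup>+x. \<integral>\<^sup>+\<xi>. \<integral>\<^sup>+\<tau>. \<integral>\<^sup>+t. F ((x, \<tau>), (\<xi>, t)) \<partial>lborel \<partial>lborel \<partial>lborel \<partial>lborel)"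
    by (intro nn_integral_cong nn_integral_lborel_swap Fm continuous_intros)
  also have "\<dots> = (\<integral>\<^sup>+P. F P \<partial>lborel)" by (rule *[OF F, symmetric])
  finally show ?thesis .
qed

lemma kern_tendsto:
  assumes "(\<sigma> \<longlongrightarrow> \<sigma>0) F"
  shows "((\<lambda>k. kern (\<sigma> k) P) \<longlongrightarrow> kern \<sigma>0 P) F"
proof (cases "(norm (fst (snd P)))\<^sup>2 + (snd (fst P) - snd (snd P))\<^sup>2 = 0")
  \<comment> \<open>The base 0 gives \<open>0 powr p = 0\<close> for every exponent, so the kernel
    vanishes along the whole family.\<close>
  case True
  then show ?thesis unfolding kern_def True by simp
next
  case False
  show ?thesis unfolding kern_def
    by (intro tendsto_intros assms) (use False in auto)
qed

text \<open>Heights do not depend on \<open>k\<close>, and \<open>\<omega>\<close> is open: a base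
  in \<open>\<omega>\<close> remains there after a small translation. Hence the indicators are
  eventually constant, and only the values of \<open>V\<close> and the kernel have to
  converge.\<close>

lemma dens_tendsto:
  fixes \<omega> :: "'a::euclidean_space set"
  assumes \<omega>: "open \<omega>" and \<sigma>: "\<sigma> \<longlonglongrightarrow> \<sigma>0" and e: "e \<longlonglongrightarrow> 0"
    and P: "fst (fst P) \<in> \<omega>"
    and V1: "(\<lambda>k. V k (fst P)) \<longlonglongrightarrow> V0 (fst P)" and V2: "(\<lambda>k. V k (shift (e k) P)) \<longlonglongrightarrow> V0 (shift 0 P)"
  shows "(\<lambda>k. dens \<omega> (e k) (\<sigma> k) (V k) P) \<longlonglongrightarrow> dens \<omega> 0 \<sigma>0 V0 P"
proof -
  have "(\<lambda>k. fst (fst P) + e k *\<^sub>R fst (snd P)) \<longlonglongrightarrow> fst (fst P) + 0 *\<^sub>R fst (snd P)"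
    by (intro tendsto_intros e)
  then have "eventually (\<lambda>k. fst (fst P) + e k *\<^sub>R fst (snd P) \<in> \<omega>) sequentially"
    using topological_tendstoD[OF _ \<omega>] P by fastforce
  then have "eventually (\<lambda>k. indicator (\<omega> \<times> {0<..<1}) (shift (e k) P) = (indicator (\<omega> \<times> {0<..<1}) (shift 0 P) :: ennreal)) sequentially"
    by eventually_elim (use P in \<open>simp add: shift_def indicator_def\<close>)
  then have i: "(\<lambda>k. indicator (\<omega> \<times> {0<..<1}) (shift (e k) P) :: ennreal) \<longlonglongrightarrow> indicator (\<omega> \<times> {0<..<1}) (shift 0 P)"
    by (rule tendsto_eventually)
  show ?thesis unfolding dens_def
    by (intro tendsto_mult_ennreal tendsto_const i tendsto_ennrealI tendsto_intros V1 V2 kern_tendsto \<sigma>)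
       (auto simp: indicator_def)
qed

lemma compact_exhaustion:
  fixes S :: "'a::euclidean_space set"
  assumes "open S"
  shows "\<exists>C. (\<forall>n::nat. compact (C n)) \<and> (\<forall>n. C n \<subseteq> S) \<and> (\<forall>K. compact K \<longrightarrow> K \<subseteq> S \<longrightarrow> (\<exists>N. \<forall>n\<ge>N. K \<subseteq> C n))"
proof (rule open_Union_compact_subsets[OF assms])
  fix C :: "nat \<Rightarrow> 'a set"
  assume 1: "\<And>n. compact (C n)" and 2: "\<And>n. C n \<subseteq> S"
    and 3: "\<And>K. \<lbrakk>compact K; K \<subseteq> S\<rbrakk> \<Longrightarrow> \<exists>N. \<forall>n\<ge>N. K \<subseteq> C n"
  show ?thesis by (rule exI[of _ C]) (simp add: 1 2 3)
qed

text \<open>The weight \<open>\<kappa>\<close> confines both points, at their positions for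
  \<open>\<epsilon> = 0\<close>, to a compact set and \<open>\<xi>\<close> to a ball. There L2
  convergence carries over to the variable \<open>P\<close>, and the negated claim selects a
  sequence to which Fatou's lemma applies.\<close>

lemma liminf_energy_cutoff:
  fixes \<omega> :: "'a::euclidean_space set" and V :: "real \<Rightarrow> 'a \<times> real \<Rightarrow> real"
  defines "\<kappa> C R P \<equiv> (indicator C (fst P) * indicator C (shift 0 P) * indicator (cball 0 R) (fst (snd P)) :: ennreal)"
  assumes \<omega>: "open \<omega>" and V[measurable]: "\<And>\<epsilon>. V \<epsilon> \<in> borel_measurable borel" and V0[measurable]: "V0 \<in> borel_measurable borel"
    and loc: "\<And>K. compact K \<Longrightarrow> K \<subseteq> \<omega> \<times> {0<..<1} \<Longrightarrow> (\<integral>\<^sup>+X. ennreal ((V0 X)\<^sup>2) * indicator K X \<partial>lborel) < \<infinity>"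
    and conv: "\<And>K. compact K \<Longrightarrow> K \<subseteq> \<omega> \<times> {0<..<1} \<Longrightarrow>
        ((\<lambda>\<epsilon>. \<integral>\<^sup>+X. ennreal ((V \<epsilon> X - V0 X)\<^sup>2) * indicator K X \<partial>lborel) \<longlongrightarrow> 0) (at_right 0)"
    and s: "(s \<longlongrightarrow> s0) (at_right 0)"
    and C: "compact C" "C \<subseteq> \<omega> \<times> {0<..<1}" and R: "R > 0"
  shows "(\<integral>\<^sup>+P. \<kappa> C R P * dens \<omega> 0 s0 V0 P \<partial>lborel) \<le> Liminf (at_right 0) (\<lambda>\<epsilon>. energy \<omega> \<epsilon> (s \<epsilon>) (V \<epsilon>))"
    (is "?I \<le> ?L")
proof (rule ccontr)
  assume "\<not> ?I \<le> ?L"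
  then have "?L < ?I" by (simp only: not_le)
  from dense[OF this] obtain c where c: "?L < c" "c < ?I" by (elim exE conjE)
  have S: "open (\<omega> \<times> {0<..<1::real})" using \<omega> by (intro open_Times) auto
  have [measurable]: "C \<in> sets borel" "cball (0::'a) R \<in> sets borel" using C by (auto intro: borel_compact)
  have \<kappa>m[measurable]: "\<kappa> C R \<in> borel_measurable borel" unfolding \<kappa>_def by measurable
  note Dm[measurable] = measurable_dens[OF \<omega> V] measurable_dens[OF \<omega> V0]
  \<comment> \<open>Contains \<open>(\<xi>, \<tau>)\<close> for every \<open>P\<close> in the
    support of \<open>\<kappa>\<close>, also after the heights are exchanged. Its measure is the
    price of integrating over these variables; the 1 in \<open>M\<close> makes \<open>r / M\<close>
    a genuine quotient.\<close>
  let ?B = "cball (0::'a) R \<times> {0..1::real}"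
  define M where "M = measure lborel ?B + 1"
  have B: "compact ?B" by (intro compact_Times) auto
  then have [measurable]: "?B \<in> sets borel" by (rule borel_compact)
  have Bfin: "emeasure lborel ?B < \<infinity>" using emeasure_compact_finite[OF B] by simp
  have M: "M > 0" "emeasure lborel ?B \<le> ennreal M"
    unfolding M_def using emeasure_eq_ennreal_measure[of lborel ?B] Bfin by (auto simp: add_nonneg_pos intro: ennreal_leI)
  \<comment> \<open>\<open>h\<close> and \<open>h'\<close> measure the deviation from
    \<open>V0\<close> at the first and at the second point; the latter is compared with
    \<open>V0\<close> at its unshifted position.\<close>
  define h where "h \<epsilon> P = \<kappa> C R P * ennreal ((V \<epsilon> (fst P) - V0 (fst P))\<^sup>2)" for \<epsilon> P
  define h' where "h' \<epsilon> P = \<kappa> C R P * ennreal ((V \<epsilon> (shift \<epsilon> P) - V0 (shift 0 P))\<^sup>2)" for \<epsilon> P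
  have hm[measurable]: "h \<epsilon> \<in> borel_measurable borel" "h' \<epsilon> \<in> borel_measurable borel" for \<epsilon>
    unfolding h_def h'_def by measurable
  define q where "q \<epsilon> \<xi> X = ennreal ((V \<epsilon> (shear (\<epsilon> *\<^sub>R \<xi>) 1 0 X) - V0 X)\<^sup>2) * indicator C X" for \<epsilon> \<xi> X
  have shear0: "shear 0 1 0 X = X" for X :: "'a \<times> real" by (simp add: shear_def)
  have Csnd: "snd X \<in> {0..1}" if "X \<in> C" for X using C(2) that by fastforce
  have ev: "eventually (\<lambda>\<epsilon>. (\<integral>\<^sup>+P. h \<epsilon> P \<partial>lborel) \<le> ennreal r \<and> (\<integral>\<^sup>+P. h' \<epsilon> P \<partial>lborel) \<le> ennreal r) (at_right 0)"
    if r: "r > 0" for r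
  proof -
    have rM: "r / M > 0" using r M by simp
    have rM': "ennreal (r / M) * ennreal M = ennreal r" using r M by (simp add: ennreal_mult[symmetric])
    have "eventually (\<lambda>\<epsilon>. \<forall>\<xi>. norm \<xi> \<le> R \<longrightarrow> (\<integral>\<^sup>+X. q \<epsilon> \<xi> X \<partial>lborel) \<le> ennreal (r / M)) (at_right 0)"
      unfolding q_def by (rule shear_L2_loc_eventually[OF S V V0 _ _ C R rM]) (rule loc conv; assumption)+
    then show ?thesis
    proof eventually_elim
      case (elim \<epsilon>)
      then have q: "(\<integral>\<^sup>+X. q \<epsilon> \<xi> X \<partial>lborel) \<le> ennreal (r / M)" if "norm \<xi> \<le> R" for \<xi>
        using that by simp
      have qm: "(\<lambda>X. q \<epsilon> \<xi> X) \<in> borel_measurable borel" for \<xi> unfolding q_def by measurable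
      have "(\<lambda>P. shear (\<epsilon> *\<^sub>R fst (snd P)) 1 0 (fst P)) \<in> borel_measurable (borel :: (('a \<times> real) \<times> ('a \<times> real)) measure)"
        unfolding shear_def by (intro borel_measurable_continuous_onI continuous_intros)
      then have [measurable]: "(\<lambda>P. V \<epsilon> (shear (\<epsilon> *\<^sub>R fst (snd P)) 1 0 (fst P))) \<in> borel_measurable (borel :: (('a \<times> real) \<times> ('a \<times> real)) measure)"
        by (rule measurable_compose) (rule V)
      have "(\<integral>\<^sup>+P. h \<epsilon> P \<partial>lborel) \<le> (\<integral>\<^sup>+P. q \<epsilon> 0 (fst P) * indicator ?B (snd P) \<partial>lborel)"
      proof (rule nn_integral_mono)
        fix P
        show "h \<epsilon> P \<le> q \<epsilon> 0 (fst P) * indicator ?B (snd P)"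
          using Csnd[of "shift 0 P"]
          by (cases "snd P") (auto simp: h_def q_def \<kappa>_def indicator_def shift_def shear0 split: if_splits)
      qed
      also have "\<dots> = (\<integral>\<^sup>+Y. \<integral>\<^sup>+X. q \<epsilon> 0 X * indicator ?B Y \<partial>lborel \<partial>lborel)"
        using qm[of 0] by (subst nn_integral_lborel_pair(2)) simp_all
      also have "\<dots> = (\<integral>\<^sup>+Y. (\<integral>\<^sup>+X. q \<epsilon> 0 X \<partial>lborel) * indicator ?B Y \<partial>lborel)"
        using qm[of 0] by (simp add: nn_integral_multc)
      also have "\<dots> = (\<integral>\<^sup>+X. q \<epsilon> 0 X \<partial>lborel) * emeasure lborel ?B"
        by (simp add: nn_integral_cmult)
      also have "\<dots> \<le> ennreal (r / M) * ennreal M" using q[of 0] R M(2) by (intro mult_mono) auto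
      finally have 1: "(\<integral>\<^sup>+P. h \<epsilon> P \<partial>lborel) \<le> ennreal r" unfolding rM' .
      have "(\<integral>\<^sup>+P. h' \<epsilon> P \<partial>lborel) = (\<integral>\<^sup>+P. h' \<epsilon> (swap_heights P) \<partial>lborel)"
        by (rule nn_integral_swap_heights[symmetric]) simp
      also have "\<dots> \<le> (\<integral>\<^sup>+P. q \<epsilon> (fst (snd P)) (fst P) * indicator ?B (snd P) \<partial>lborel)"
      proof (rule nn_integral_mono)
        fix P
        show "h' \<epsilon> (swap_heights P) \<le> q \<epsilon> (fst (snd P)) (fst P) * indicator ?B (snd P)"
          using Csnd[of "fst (swap_heights P)"]
          by (cases "snd P") (auto simp: swap_heights_def h'_def q_def \<kappa>_def indicator_def shift_def shear_def split: if_splits)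
      qed
      also have "\<dots> = (\<integral>\<^sup>+Y. \<integral>\<^sup>+X. q \<epsilon> (fst Y) X * indicator ?B Y \<partial>lborel \<partial>lborel)"
        unfolding q_def by (subst nn_integral_lborel_pair(2)) simp_all
      also have "\<dots> \<le> (\<integral>\<^sup>+Y. ennreal (r / M) * indicator ?B Y \<partial>lborel)"
      proof (rule nn_integral_mono)
        fix Y
        show "(\<integral>\<^sup>+X. q \<epsilon> (fst Y) X * indicator ?B Y \<partial>lborel) \<le> ennreal (r / M) * indicator ?B Y"
          using q[of "fst Y"] by (auto simp: indicator_def)
      qed
      also have "\<dots> = ennreal (r / M) * emeasure lborel ?B" by (simp add: nn_integral_cmult)
      also have "\<dots> \<le> ennreal (r / M) * ennreal M" using M(2) by (intro mult_left_mono) auto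
      finally have 2: "(\<integral>\<^sup>+P. h' \<epsilon> P \<partial>lborel) \<le> ennreal r" unfolding rM' .
      from 1 2 show ?case ..
    qed
  qed
  \<comment> \<open>By \<open>?L < c\<close> there are arbitrarily small \<open>\<epsilon>\<close>
    with energy below \<open>c\<close>. The other requirements hold eventually, so all can be met at
    once; the geometric bounds are those of \<open>AE_tendsto_0_of_summable\<close>.\<close>
  have "\<exists>\<epsilon>. 0 < \<epsilon> \<and> \<epsilon> < 1 / real (Suc k) \<and> \<bar>s \<epsilon> - s0\<bar> < 1 / real (Suc k) \<and> energy \<omega> \<epsilon> (s \<epsilon>) (V \<epsilon>) < c
     \<and> (\<integral>\<^sup>+P. h \<epsilon> P \<partial>lborel) \<le> ennreal ((1/2)^k) \<and> (\<integral>\<^sup>+P. h' \<epsilon> P \<partial>lborel) \<le> ennreal ((1/2)^k)" for k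
  proof (rule ccontr)
    assume neg: "\<not> ?thesis"
    have "eventually (\<lambda>\<epsilon>::real. 0 < \<epsilon> \<and> \<epsilon> < 1 / real (Suc k)) (at_right 0)"
      by (intro eventually_at_rightI[of 0 "1 / real (Suc k)"]) auto
    moreover have "eventually (\<lambda>\<epsilon>. \<bar>s \<epsilon> - s0\<bar> < 1 / real (Suc k)) (at_right 0)"
      using tendstoD[OF s, of "1 / real (Suc k)"] by (simp add: dist_real_def)
    moreover have "(0::real) < (1/2)^k" by simp
    note ev[OF this]
    ultimately have "eventually (\<lambda>\<epsilon>. c \<le> energy \<omega> \<epsilon> (s \<epsilon>) (V \<epsilon>)) (at_right 0)"
    proof eventually_elim
      case (elim \<epsilon>)
      then show ?case using neg by (meson not_le)
    qed
    then have "c \<le> ?L" by (rule Liminf_bounded)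
    then show False using c by simp
  qed
  then obtain e where e: "\<And>k. 0 < e k" "\<And>k. e k < 1 / real (Suc k)" "\<And>k. \<bar>s (e k) - s0\<bar> < 1 / real (Suc k)"
    "\<And>k. energy \<omega> (e k) (s (e k)) (V (e k)) < c"
    "\<And>k. (\<integral>\<^sup>+P. h (e k) P \<partial>lborel) \<le> ennreal ((1/2)^k)" "\<And>k. (\<integral>\<^sup>+P. h' (e k) P \<partial>lborel) \<le> ennreal ((1/2)^k)"
    by metis
  have e0: "e \<longlonglongrightarrow> 0" by (rule LIMSEQ_norm_0) (use e in \<open>auto simp: less_imp_le\<close>)
  have "(\<lambda>k. s (e k) - s0) \<longlonglongrightarrow> 0" by (rule LIMSEQ_norm_0) (use e in auto)
  then have se: "(\<lambda>k. s (e k)) \<longlonglongrightarrow> s0" by (simp add: LIM_zero_iff)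
  have "AE P in lborel. (\<lambda>k. h (e k) P) \<longlonglongrightarrow> 0" "AE P in lborel. (\<lambda>k. h' (e k) P) \<longlonglongrightarrow> 0"
    by (intro AE_tendsto_0_of_summable e; simp)+
  then have "AE P in lborel. \<kappa> C R P * dens \<omega> 0 s0 V0 P \<le> liminf (\<lambda>k. dens \<omega> (e k) (s (e k)) (V (e k)) P)"
  proof eventually_elim
    case (elim P)
    show ?case
    proof (cases "fst P \<in> C \<and> shift 0 P \<in> C \<and> fst (snd P) \<in> cball 0 R")
      case True
      then have \<kappa>1: "\<kappa> C R P = 1" by (simp add: \<kappa>_def)
      have "(\<lambda>k. V (e k) (fst P) - V0 (fst P)) \<longlonglongrightarrow> 0"
        by (rule tendsto_0_of_ennreal_square) (use elim \<kappa>1 in \<open>simp add: h_def\<close>)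
      then have 1: "(\<lambda>k. V (e k) (fst P)) \<longlonglongrightarrow> V0 (fst P)" by (simp add: LIM_zero_iff)
      have "(\<lambda>k. V (e k) (shift (e k) P) - V0 (shift 0 P)) \<longlonglongrightarrow> 0"
        by (rule tendsto_0_of_ennreal_square) (use elim \<kappa>1 in \<open>simp add: h'_def\<close>)
      then have 2: "(\<lambda>k. V (e k) (shift (e k) P)) \<longlonglongrightarrow> V0 (shift 0 P)" by (simp add: LIM_zero_iff)
      have "fst (fst P) \<in> \<omega>" using True C(2) by (cases "fst P") auto
      from dens_tendsto[OF \<omega> se e0 this 1 2]
      show ?thesis by (simp add: \<kappa>1 lim_imp_Liminf)
    qed (auto simp: \<kappa>_def)
  qed
  then have "?I \<le> (\<integral>\<^sup>+P. liminf (\<lambda>k. dens \<omega> (e k) (s (e k)) (V (e k)) P) \<partial>lborel)"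
    by (rule nn_integral_mono_AE)
  also have "\<dots> \<le> liminf (\<lambda>k. \<integral>\<^sup>+P. dens \<omega> (e k) (s (e k)) (V (e k)) P \<partial>lborel)"
    by (rule nn_integral_liminf) simp
  also have "\<dots> \<le> liminf (\<lambda>k. c)"
    by (rule Liminf_mono) (use e(4) in \<open>auto simp: energy_def less_imp_le\<close>)
  also have "\<dots> = c" by (simp add: Liminf_const)
  finally show False using c(2) by simp
qed

text \<open>Each \<open>P\<close> with both points in the cylinder is eventually kept by the
  cut-offs, which need not be monotone in \<open>n\<close>. Fatou's lemma, used a second time,
  removes them.\<close>

lemma liminf_energy:
  fixes \<omega> :: "'a::euclidean_space set" and V :: "real \<Rightarrow> 'a \<times> real \<Rightarrow> real"
  assumes \<omega>: "open \<omega>" and V: "\<And>\<epsilon>. V \<epsilon> \<in> borel_measurable borel" and V0: "V0 \<in> borel_measurable borel"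
    and loc: "\<And>K. compact K \<Longrightarrow> K \<subseteq> \<omega> \<times> {0<..<1} \<Longrightarrow> (\<integral>\<^sup>+X. ennreal ((V0 X)\<^sup>2) * indicator K X \<partial>lborel) < \<infinity>"
    and conv: "\<And>K. compact K \<Longrightarrow> K \<subseteq> \<omega> \<times> {0<..<1} \<Longrightarrow>
        ((\<lambda>\<epsilon>. \<integral>\<^sup>+X. ennreal ((V \<epsilon> X - V0 X)\<^sup>2) * indicator K X \<partial>lborel) \<longlongrightarrow> 0) (at_right 0)"
    and s: "(s \<longlongrightarrow> s0) (at_right 0)"
  shows "energy \<omega> 0 s0 V0 \<le> Liminf (at_right 0) (\<lambda>\<epsilon>. energy \<omega> \<epsilon> (s \<epsilon>) (V \<epsilon>))"
    (is "_ \<le> ?L")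
proof -
  have S: "open (\<omega> \<times> {0<..<1::real})" using \<omega> by (intro open_Times) auto
  obtain C where C: "\<forall>n::nat. compact (C n)" "\<forall>n. C n \<subseteq> \<omega> \<times> {0<..<1::real}"
    "\<forall>K. compact K \<longrightarrow> K \<subseteq> \<omega> \<times> {0<..<1::real} \<longrightarrow> (\<exists>N. \<forall>n\<ge>N. K \<subseteq> C n)"
    using compact_exhaustion[OF S] by (elim exE conjE)
  \<comment> \<open>The radius \<open>Suc n\<close> is positive already at
    \<open>n = 0\<close>.\<close>
  define \<kappa> where "\<kappa> n P = (indicator (C n) (fst P) * indicator (C n) (shift 0 P) * indicator (cball 0 (real (Suc n))) (fst (snd P)) :: ennreal)" for n P
  have cut: "(\<integral>\<^sup>+P. \<kappa> n P * dens \<omega> 0 s0 V0 P \<partial>lborel) \<le> ?L" for n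
    unfolding \<kappa>_def by (rule liminf_energy_cutoff[OF \<omega> V V0 _ _ s C(1)[rule_format] C(2)[rule_format]])
      (rule loc conv of_nat_0_less_iff[THEN iffD2] zero_less_Suc; assumption?)+
  have [measurable]: "C n \<in> sets borel" "cball (0::'a) r \<in> sets borel" for n r using C by (auto intro: borel_compact)
  note [measurable] = measurable_dens[OF \<omega> V0]
  have lim: "dens \<omega> 0 s0 V0 P = liminf (\<lambda>n. \<kappa> n P * dens \<omega> 0 s0 V0 P)" for P
  proof (cases "fst P \<in> \<omega> \<times> {0<..<1} \<and> shift 0 P \<in> \<omega> \<times> {0<..<1}")
    case True
    then obtain N where N: "\<And>n. n \<ge> N \<Longrightarrow> {fst P, shift 0 P} \<subseteq> C n"
      using C(3)[rule_format, of "{fst P, shift 0 P}"] by auto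
    obtain m where m: "norm (fst (snd P)) \<le> real m" using real_arch_simple by blast
    have "eventually (\<lambda>n. \<kappa> n P * dens \<omega> 0 s0 V0 P = dens \<omega> 0 s0 V0 P) sequentially"
      using eventually_ge_at_top[of "max N m"]
    proof eventually_elim
      case (elim n)
      then show ?case using N[of n] m by (simp add: \<kappa>_def)
    qed
    then have "(\<lambda>n. \<kappa> n P * dens \<omega> 0 s0 V0 P) \<longlonglongrightarrow> dens \<omega> 0 s0 V0 P" by (rule tendsto_eventually)
    then show ?thesis by (simp add: lim_imp_Liminf)
  next
    case False
    then have "dens \<omega> 0 s0 V0 P = 0" by (auto simp: dens_def)
    then show ?thesis by (simp add: Liminf_const)
  qed
  have "energy \<omega> 0 s0 V0 = (\<integral>\<^sup>+P. liminf (\<lambda>n. \<kappa> n P * dens \<omega> 0 s0 V0 P) \<partial>lborel)"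
    unfolding energy_def by (rule nn_integral_cong) (rule lim)
  also have "\<dots> \<le> liminf (\<lambda>n. \<integral>\<^sup>+P. \<kappa> n P * dens \<omega> 0 s0 V0 P \<partial>lborel)"
    unfolding \<kappa>_def by (rule nn_integral_liminf) measurable
  also have "\<dots> \<le> liminf (\<lambda>n::nat. ?L)"
    by (rule Liminf_mono) (use cut in auto)
  also have "\<dots> = ?L" by (simp add: Liminf_const)
  finally show ?thesis .
qed

section \<open>Bounded Lipschitz functions\<close>

text \<open>
  The exponent \<open>\<sigma> = -1/4\<close> lies between the behaviour of the densities of bounded Lipschitz
  functions near the diagonal and at infinity, for all \<open>\<sigma> \<in> [0, 1/2]\<close> at once, and
  \<open>kern (-1/4)\<close> is integrable over all \<open>\<xi>\<close> and over \<open>t\<close>, \<open>\<tau>\<close> in \<open>(0, 1)\<close>.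
\<close>

definition majorant :: "'a::euclidean_space set \<Rightarrow> real \<Rightarrow> ('a \<times> real) \<times> ('a \<times> real) \<Rightarrow> ennreal" where
  "majorant \<omega> K P = indicator (\<omega> \<times> {0<..<1}) (fst P) * indicator {0<..<1} (snd (snd P)) * ennreal (K * kern (-1/4) P)"

lemma measurable_majorant [measurable]:
  assumes "open \<omega>"
  shows "majorant \<omega> K \<in> borel_measurable borel"
proof -
  note [measurable] = sets_cyl[OF assms]
  show ?thesis unfolding majorant_def by measurable
qed

text \<open>Integrating in \<open>\<xi>\<close> first gives the constant at \<open>-1/4\<close> and
  leaves \<open>\<bar>t - \<tau>\<bar> powr (-1/2)\<close>, whose integral in \<open>\<tau>\<close>
  is bounded uniformly in \<open>t\<close>. What remains is the finite measure of the bounded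
  cylinder.\<close>

lemma majorant_finite:
  fixes \<omega> :: "'a::euclidean_space set"
  assumes \<omega>: "open \<omega>" "bounded \<omega>" and K: "K \<ge> 0"
  shows "(\<integral>\<^sup>+P. majorant \<omega> K P \<partial>lborel) < \<infinity>"
proof -
  let ?\<Omega> = "\<omega> \<times> {0<..<1::real}"
  let ?C = "C_const TYPE('a) (-1/4)"
  note D = measurable_majorant[OF \<omega>(1), of K]
  have Dm: "(\<lambda>x. majorant \<omega> K (g x)) \<in> borel_measurable borel" if "continuous_on UNIV g" for g :: "'c::topological_space \<Rightarrow> _"
    by (rule measurable_compose[OF borel_measurable_continuous_onI[OF that] D])
  have inner: "(\<integral>\<^sup>+\<xi>. majorant \<omega> K (X, (\<xi>, \<tau>)) \<partial>lborel) =
      (indicator ?\<Omega> X * ennreal K * ?C) * (indicator {0<..<1} \<tau> * ennreal (1 / \<bar>\<tau> - snd X\<bar> powr (1/2)))" if "\<tau> \<noteq> snd X" for X \<tau>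
  proof -
    let ?k = "\<lambda>\<xi>::'a. ennreal (1 / ((norm \<xi>)\<^sup>2 + (snd X - \<tau>)\<^sup>2) powr (real (DIM('a) + 1) / 2 + (-1/4)))"
    have "(\<integral>\<^sup>+\<xi>. majorant \<omega> K (X, (\<xi>, \<tau>)) \<partial>lborel) = (\<integral>\<^sup>+\<xi>. (indicator ?\<Omega> X * indicator {0<..<1} \<tau> * ennreal K) * ?k \<xi> \<partial>lborel)"
      using K by (intro nn_integral_cong) (simp add: majorant_def kern_def ennreal_mult[symmetric] mult.assoc)
    also have "\<dots> = (indicator ?\<Omega> X * indicator {0<..<1} \<tau> * ennreal K) * (\<integral>\<^sup>+\<xi>. ?k \<xi> \<partial>lborel)"
      by (rule nn_integral_cmult) simp
    also have "(\<integral>\<^sup>+\<xi>. ?k \<xi> \<partial>lborel) = ?C * ennreal (1 / \<bar>snd X - \<tau>\<bar> powr (1 + 2 * (-1/4)))"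
      by (rule C_const_scale) (use that in simp)
    finally show ?thesis by (simp add: abs_minus_commute mult_ac)
  qed
  have "(\<integral>\<^sup>+P. majorant \<omega> K P \<partial>lborel) = (\<integral>\<^sup>+X. \<integral>\<^sup>+Y. majorant \<omega> K (X, Y) \<partial>lborel \<partial>lborel)"
    by (rule nn_integral_lborel_pair[OF D])
  also have "\<dots> = (\<integral>\<^sup>+X. \<integral>\<^sup>+\<tau>. \<integral>\<^sup>+\<xi>. majorant \<omega> K (X, (\<xi>, \<tau>)) \<partial>lborel \<partial>lborel \<partial>lborel)"
    by (intro nn_integral_cong nn_integral_lborel_pair(2) Dm continuous_intros)
  also have "\<dots> \<le> (\<integral>\<^sup>+X. (ennreal K * ?C * 4) * indicator ?\<Omega> X \<partial>lborel)"
  proof (rule nn_integral_mono)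
    fix X :: "'a \<times> real"
    \<comment> \<open>\<open>C_const_scale\<close> excludes the single height
      \<open>\<tau> = snd X\<close>, a null set.\<close>
    have "AE \<tau> in lborel. \<tau> \<noteq> snd X" by (rule AE_lborel_singleton)
    then have "(\<integral>\<^sup>+\<tau>. \<integral>\<^sup>+\<xi>. majorant \<omega> K (X, (\<xi>, \<tau>)) \<partial>lborel \<partial>lborel) =
      (\<integral>\<^sup>+\<tau>. (indicator ?\<Omega> X * ennreal K * ?C) * (indicator {0<..<1} \<tau> * ennreal (1 / \<bar>\<tau> - snd X\<bar> powr (1/2))) \<partial>lborel)"
      by (intro nn_integral_cong_AE) (auto elim!: eventually_mono simp: inner)
    also have "\<dots> = (indicator ?\<Omega> X * ennreal K * ?C) * (\<integral>\<^sup>+\<tau>. indicator {0<..<1} \<tau> * ennreal (1 / \<bar>\<tau> - snd X\<bar> powr (1/2)) \<partial>lborel)"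
      by (intro nn_integral_cmult) simp
    also have "\<dots> \<le> (ennreal K * ?C * 4) * indicator ?\<Omega> X"
    proof (cases "X \<in> ?\<Omega>")
      case True
      then have "snd X \<in> {0<..<1}" by (cases X) auto
      from mult_left_mono[OF nn_integral_inverse_sqrt_bound[OF this], of "ennreal K * ?C"] True
      show ?thesis by (simp add: mult.commute)
    qed simp
    finally show "(\<integral>\<^sup>+\<tau>. \<integral>\<^sup>+\<xi>. majorant \<omega> K (X, (\<xi>, \<tau>)) \<partial>lborel \<partial>lborel) \<le> (ennreal K * ?C * 4) * indicator ?\<Omega> X" .
  qed
  also have "\<dots> = (ennreal K * ?C * 4) * emeasure lborel ?\<Omega>"
    using sets_cyl[OF \<omega>(1)] by (intro nn_integral_cmult_indicator) simp
  also have "\<dots> < \<infinity>"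
  proof -
    have "bounded ?\<Omega>" using \<omega>(2) by (intro bounded_Times) auto
    then have "emeasure lborel ?\<Omega> < \<infinity>" by (rule emeasure_bounded_finite)
    moreover have "?C < \<infinity>" by (rule C_const_finite) simp
    ultimately show ?thesis by (simp add: ennreal_mult_less_top)
  qed
  finally show ?thesis .
qed

text \<open>Write \<open>b\<close> for the base of the kernel. The squared difference is at most
  \<open>4 M\<^sup>2\<close> and at most \<open>(L N)\<^sup>2 b\<close>, while the two kernels
  differ by the factor \<open>b powr (-\<sigma> - 1/4)\<close>. The Lipschitz bound serves for
  \<open>b \<le> 1\<close>, where \<open>3/4 - \<sigma>\<close> is positive, and the sup bound for
  \<open>b > 1\<close>. \<open>N\<close> dominates both 1 and \<open>\<epsilon>\<close> because only
  the horizontal displacement carries the factor \<open>\<epsilon>\<close>.\<close>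

lemma dens_le_majorant:
  fixes \<omega> :: "'a::euclidean_space set"
  assumes lip: "L-lipschitz_on UNIV g" and bnd: "\<And>X. \<bar>g X\<bar> \<le> M"
    and \<epsilon>: "0 \<le> \<epsilon>" "\<epsilon> \<le> N" "1 \<le> N" and \<sigma>: "0 \<le> \<sigma>" "\<sigma> \<le> 1/2"
  shows "dens \<omega> \<epsilon> \<sigma> g P \<le> majorant \<omega> (4 * M\<^sup>2 + (L * N)\<^sup>2) P"
proof (cases "fst P \<in> \<omega> \<times> {0<..<1} \<and> shift \<epsilon> P \<in> \<omega> \<times> {0<..<1}")
  case True
  let ?b = "(norm (fst (snd P)))\<^sup>2 + (snd (fst P) - snd (snd P))\<^sup>2"
  let ?p = "real (DIM('a) + 1) / 2 + \<sigma>" and ?q = "real (DIM('a) + 1) / 2 + (-1/4)"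
  let ?d = "(g (fst P) - g (shift \<epsilon> P))\<^sup>2"
  have "?d * kern \<sigma> P \<le> (4 * M\<^sup>2 + (L * N)\<^sup>2) * kern (-1/4) P"
  proof (cases "?b = 0")
    case True
    then show ?thesis by (simp add: kern_def)
  next
    case False
    then have b: "?b > 0" by (metis add_nonneg_nonneg zero_le_power2 less_le)
    have L: "L \<ge> 0" using lip by (rule lipschitz_on_nonneg)
    have "\<bar>g (fst P) - g (shift \<epsilon> P)\<bar> \<le> 2 * M" using bnd[of "fst P"] bnd[of "shift \<epsilon> P"] by linarith
    then have "?d \<le> (2 * M)\<^sup>2" by (metis abs_ge_zero power2_abs power_mono)
    then have d1: "?d \<le> 4 * M\<^sup>2" by (simp add: power_mult_distrib)
    have "\<bar>g (fst P) - g (shift \<epsilon> P)\<bar> \<le> L * dist (fst P) (shift \<epsilon> P)"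
      using lipschitz_onD[OF lip, of "fst P" "shift \<epsilon> P"] by (simp add: dist_real_def)
    then have "?d \<le> (L * dist (fst P) (shift \<epsilon> P))\<^sup>2" by (metis abs_ge_zero power2_abs power_mono)
    also have "\<dots> = L\<^sup>2 * (\<epsilon>\<^sup>2 * (norm (fst (snd P)))\<^sup>2 + 1 * (snd (fst P) - snd (snd P))\<^sup>2)"
      by (cases "fst P") (simp add: shift_def dist_norm norm_Pair power_mult_distrib)
    also have "\<dots> \<le> L\<^sup>2 * (N\<^sup>2 * (norm (fst (snd P)))\<^sup>2 + N\<^sup>2 * (snd (fst P) - snd (snd P))\<^sup>2)"
      using \<epsilon> one_le_power[of N 2] by (intro mult_left_mono add_mono mult_right_mono power_mono) auto
    also have "\<dots> = (L * N)\<^sup>2 * ?b" by (simp add: power_mult_distrib algebra_simps)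
    finally have d2: "?d \<le> (L * N)\<^sup>2 * ?b" .
    have "1 / ?b powr ?p = ?b powr (?q - ?p) * (1 / ?b powr ?q)"
      using b by (simp only: powr_diff) simp
    then have k: "kern \<sigma> P = ?b powr (?q - ?p) * kern (-1/4) P" by (simp add: kern_def)
    have qp: "?q - ?p = - \<sigma> - 1/4" by simp
    have "?d * ?b powr (?q - ?p) \<le> 4 * M\<^sup>2 + (L * N)\<^sup>2"
    proof (cases "?b \<le> 1")
      case True
      have "?d * ?b powr (?q - ?p) \<le> (L * N)\<^sup>2 * ?b * ?b powr (?q - ?p)"
        using d2 by (intro mult_right_mono) auto
      also have "\<dots> = (L * N)\<^sup>2 * ?b powr (1 + (?q - ?p))" using b by (subst powr_add) simp
      also have "\<dots> \<le> (L * N)\<^sup>2 * 1"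
        unfolding qp using b True \<sigma> by (intro mult_left_mono powr_le1) auto
      finally have "?d * ?b powr (?q - ?p) \<le> (L * N)\<^sup>2 * 1" .
      moreover have "0 \<le> 4 * M\<^sup>2" by simp
      ultimately show ?thesis by linarith
    next
      case False
      have "?b powr (?q - ?p) \<le> ?b powr 0" unfolding qp using False \<sigma> by (intro powr_mono) auto
      then have "?b powr (?q - ?p) \<le> 1" using b by (auto split: if_splits)
      then have "?d * ?b powr (?q - ?p) \<le> 4 * M\<^sup>2 * 1" using d1 by (intro mult_mono) auto
      moreover have "0 \<le> (L * N)\<^sup>2" by simp
      ultimately show ?thesis by linarith
    qed
    from mult_right_mono[OF this kern_nonneg[of "-1/4" P]]
    show ?thesis unfolding k by (simp add: mult.assoc)
  qed
  then show ?thesis using True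
    by (cases "snd P") (auto simp: dens_def majorant_def shift_def intro!: ennreal_leI)
qed (auto simp: dens_def)

text \<open>Membership in \<open>Hs\<close> is required for every \<open>\<epsilon> > 0\<close>, not
  only for small ones; hence the factor \<open>max 1 \<epsilon>\<close> in the majorant.\<close>

lemma energy_lipschitz_finite:
  fixes \<omega> :: "'a::euclidean_space set"
  assumes \<omega>: "open \<omega>" "bounded \<omega>" and lip: "L-lipschitz_on UNIV g" and bnd: "\<And>X. \<bar>g X\<bar> \<le> M"
    and "0 \<le> \<epsilon>" "0 \<le> \<sigma>" "\<sigma> \<le> 1/2"
  shows "energy \<omega> \<epsilon> \<sigma> g < \<infinity>"
proof -
  have "energy \<omega> \<epsilon> \<sigma> g \<le> (\<integral>\<^sup>+P. majorant \<omega> (4 * M\<^sup>2 + (L * max 1 \<epsilon>)\<^sup>2) P \<partial>lborel)"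
    unfolding energy_def by (intro nn_integral_mono dens_le_majorant[OF lip bnd]) (use assms in auto)
  also have "\<dots> < \<infinity>" by (rule majorant_finite[OF \<omega>]) simp
  finally show ?thesis .
qed

text \<open>One majorant serves all \<open>\<epsilon> < 1\<close> and all exponents in
  \<open>(0, 1/2)\<close>, so the exponent may vary together with \<open>\<epsilon>\<close>.\<close>

lemma energy_lipschitz_tendsto:
  fixes \<omega> :: "'a::euclidean_space set"
  assumes \<omega>: "open \<omega>" "bounded \<omega>" and lip: "L-lipschitz_on UNIV g" and bnd: "\<And>X. \<bar>g X\<bar> \<le> M"
    and s: "(s \<longlongrightarrow> s0) (at_right 0)" "\<And>\<epsilon>. \<epsilon> > 0 \<Longrightarrow> s \<epsilon> \<in> {0<..<1/2}"
  shows "((\<lambda>\<epsilon>. energy \<omega> \<epsilon> (s \<epsilon>) g) \<longlongrightarrow> energy \<omega> 0 s0 g) (at_right 0)"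
proof (rule tendsto_at_right_sequentially[of 0 1])
  fix e :: "nat \<Rightarrow> real"
  assume e: "\<And>n. 0 < e n" "\<And>n. e n < 1" "e \<longlonglongrightarrow> 0"
  have cont: "continuous_on UNIV g" using lip by (rule lipschitz_on_continuous_on)
  then have g: "g \<in> borel_measurable borel" by (rule borel_measurable_continuous_onI)
  have "filterlim e (at_right 0) sequentially"
    unfolding filterlim_at using e(1,3) by (simp add: less_imp_neq[symmetric])
  then have se: "(\<lambda>n. s (e n)) \<longlonglongrightarrow> s0" by (rule filterlim_compose[OF s(1)])
  show "(\<lambda>n. energy \<omega> (e n) (s (e n)) g) \<longlonglongrightarrow> energy \<omega> 0 s0 g"
    unfolding energy_def
  proof (rule nn_integral_dominated_convergence[where w="majorant \<omega> (4 * M\<^sup>2 + (L * 1)\<^sup>2)"])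
    show "AE P in lborel. dens \<omega> (e n) (s (e n)) g P \<le> majorant \<omega> (4 * M\<^sup>2 + (L * 1)\<^sup>2) P" for n
      by (intro AE_I2 dens_le_majorant[OF lip bnd])
         (use e(1,2)[of n] s(2)[of "e n"] in auto)
    show "(\<integral>\<^sup>+P. majorant \<omega> (4 * M\<^sup>2 + (L * 1)\<^sup>2) P \<partial>lborel) < \<infinity>"
      by (rule majorant_finite[OF \<omega>]) simp
    show "AE P in lborel. (\<lambda>n. dens \<omega> (e n) (s (e n)) g P) \<longlonglongrightarrow> dens \<omega> 0 s0 g P"
    proof (rule AE_I2)
      fix P :: "('a \<times> real) \<times> ('a \<times> real)"
      show "(\<lambda>n. dens \<omega> (e n) (s (e n)) g P) \<longlonglongrightarrow> dens \<omega> 0 s0 g P"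
      proof (cases "fst (fst P) \<in> \<omega>")
        case True
        have "(\<lambda>n. shift (e n) P) \<longlonglongrightarrow> shift 0 P"
          unfolding shift_def by (intro tendsto_intros e)
        then have "(\<lambda>n. g (shift (e n) P)) \<longlonglongrightarrow> g (shift 0 P)"
          by (rule continuous_on_tendsto_compose[OF cont]) auto
        then show ?thesis by (intro dens_tendsto \<omega> se e True tendsto_const)
      next
        case False
        then show ?thesis by (cases "fst P") (simp add: dens_def)
      qed
    qed
  qed (use measurable_dens[OF \<omega>(1) g] measurable_majorant[OF \<omega>(1)] in auto)
qed simp

section \<open>Mollification\<close>

text \<open>Lipschitz continuity in place of smoothness is enough, since mollification only has to
  produce bounded Lipschitz functions. A normalised cone then qualifies.\<close>

definition mollifier :: "real \<Rightarrow> ('b::euclidean_space \<Rightarrow> real) \<Rightarrow> bool" where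
  "mollifier \<delta> \<phi> \<longleftrightarrow> (\<forall>Z. 0 \<le> \<phi> Z) \<and> (\<integral>\<^sup>+Z. ennreal (\<phi> Z) \<partial>lborel) = 1 \<and>
     (\<forall>Z. \<delta> \<le> norm Z \<longrightarrow> \<phi> Z = 0) \<and> (\<exists>c. c-lipschitz_on UNIV \<phi>) \<and> (\<exists>B. \<forall>Z. \<phi> Z \<le> B)"

lemma mollifier_exists:
  assumes \<delta>: "\<delta> > 0"
  shows "\<exists>\<phi> :: 'b::euclidean_space \<Rightarrow> real. mollifier \<delta> \<phi>"
proof -
  define \<psi> where "\<psi> = (\<lambda>Z::'b. max 0 (\<delta> - norm Z))"
  have [measurable]: "\<psi> \<in> borel_measurable borel" unfolding \<psi>_def by measurable
  define I where "I = (\<integral>\<^sup>+Z. ennreal (\<psi> Z) \<partial>lborel)"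
  have "I \<le> (\<integral>\<^sup>+Z. ennreal \<delta> * indicator (cball (0::'b) \<delta>) Z \<partial>lborel)"
    unfolding I_def by (intro nn_integral_mono) (use \<delta> in \<open>auto simp: \<psi>_def indicator_def intro!: ennreal_leI\<close>)
  also have "\<dots> = ennreal \<delta> * emeasure lborel (cball (0::'b) \<delta>)"
    by (intro nn_integral_cmult_indicator) simp
  also have "\<dots> < \<infinity>" using emeasure_bounded_finite[of "cball (0::'b) \<delta>"] by (simp add: ennreal_mult_less_top)
  finally have fin: "I < \<infinity>" .
  \<comment> \<open>On the ball of half the radius the cone is at least \<open>\<delta> / 2\<close>,
    so its integral is positive and it can be normalised.\<close>
  have "ennreal (\<delta> / 2) * emeasure lborel (ball (0::'b) (\<delta>/2)) = (\<integral>\<^sup>+Z. ennreal (\<delta> / 2) * indicator (ball (0::'b) (\<delta>/2)) Z \<partial>lborel)"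
    by (intro nn_integral_cmult_indicator[symmetric]) simp
  also have "\<dots> \<le> I"
    unfolding I_def by (intro nn_integral_mono) (use \<delta> in \<open>auto simp: \<psi>_def indicator_def intro!: ennreal_leI\<close>)
  finally have "ennreal (\<delta> / 2) * emeasure lborel (ball (0::'b) (\<delta>/2)) \<le> I" .
  moreover have "ennreal (\<delta> / 2) * emeasure lborel (ball (0::'b) (\<delta>/2)) > 0"
    using \<delta> open_not_negligible[of "ball (0::'b) (\<delta>/2)"]
    by (auto simp: ennreal_zero_less_mult_iff negligible_iff_null_sets null_sets_def zero_less_iff_neq_zero)
  ultimately have pos: "I > 0" by simp
  obtain J where J: "I = ennreal J" "J > 0" using fin pos by (cases I) auto
  have "(\<integral>\<^sup>+Z. ennreal (\<psi> Z / J) \<partial>lborel) = (\<integral>\<^sup>+Z. ennreal (1 / J) * ennreal (\<psi> Z) \<partial>lborel)"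
    using J by (intro nn_integral_cong) (simp add: ennreal_mult[symmetric] \<psi>_def)
  also have "\<dots> = ennreal (1 / J) * ennreal J"
    unfolding J(1)[symmetric] I_def by (intro nn_integral_cmult) simp
  also have "\<dots> = 1" using J by (simp add: ennreal_mult[symmetric])
  finally have 1: "(\<integral>\<^sup>+Z. ennreal (\<psi> Z / J) \<partial>lborel) = 1" .
  have "(1 / J)-lipschitz_on UNIV (\<lambda>Z. \<psi> Z / J)"
  proof (rule lipschitz_onI)
    fix Z W :: 'b
    have "\<bar>\<psi> Z - \<psi> W\<bar> \<le> \<bar>norm Z - norm W\<bar>" by (auto simp: \<psi>_def max_def)
    also have "\<dots> \<le> dist Z W" unfolding dist_norm by (rule norm_triangle_ineq3)
    finally have "\<bar>\<psi> Z - \<psi> W\<bar> / J \<le> dist Z W / J" using J by (intro divide_right_mono) auto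
    then show "dist (\<psi> Z / J) (\<psi> W / J) \<le> 1 / J * dist Z W"
      using J by (simp add: dist_real_def diff_divide_distrib[symmetric] abs_divide)
  qed (use J in simp)
  moreover have "\<psi> Z / J \<le> \<delta> / J" for Z using J \<delta> by (intro divide_right_mono) (auto simp: \<psi>_def)
  moreover have "0 \<le> \<psi> Z / J" for Z using J by (simp add: \<psi>_def)
  moreover have "\<psi> Z / J = 0" if "\<delta> \<le> norm Z" for Z using that by (simp add: \<psi>_def)
  ultimately have "mollifier \<delta> (\<lambda>Z. \<psi> Z / J)" unfolding mollifier_def using 1 by blast
  then show ?thesis by blast
qed

lemma
  assumes "mollifier \<delta> \<phi>"
  shows mollifier_nonneg: "0 \<le> \<phi> Z"
    and mollifier_nn_integral: "(\<integral>\<^sup>+Z. ennreal (\<phi> Z) \<partial>lborel) = 1"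
    and mollifier_support: "\<phi> Z \<noteq> 0 \<Longrightarrow> norm Z < \<delta>"
  using assms unfolding mollifier_def by (blast, blast, meson not_le)

lemma mollifier_measurable:
  assumes "mollifier \<delta> \<phi>"
  shows "\<phi> \<in> borel_measurable borel"
  using assms unfolding mollifier_def
  by (auto intro: borel_measurable_continuous_onI lipschitz_on_continuous_on)

text \<open>The variance of \<open>h\<close> under the probability density \<open>\<phi>\<close> is
  nonnegative; expanding the square around the mean \<open>m\<close> gives the claim. An infinite
  right-hand side leaves nothing to show.\<close>

lemma jensen_square:
  fixes h :: "'b \<Rightarrow> real"
  assumes [measurable]: "\<phi> \<in> borel_measurable M" "h \<in> borel_measurable M"
    and \<phi>: "\<And>Z. 0 \<le> \<phi> Z" "(\<integral>\<^sup>+Z. ennreal (\<phi> Z) \<partial>M) = 1"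
    and int: "integrable M (\<lambda>Z. \<phi> Z * h Z)"
  shows "ennreal ((\<integral>Z. \<phi> Z * h Z \<partial>M)\<^sup>2) \<le> (\<integral>\<^sup>+Z. ennreal (\<phi> Z) * ennreal ((h Z)\<^sup>2) \<partial>M)"
proof (cases "(\<integral>\<^sup>+Z. ennreal (\<phi> Z) * ennreal ((h Z)\<^sup>2) \<partial>M) < \<infinity>")
  case True
  have eq: "(\<integral>\<^sup>+Z. ennreal (\<phi> Z) * ennreal ((h Z)\<^sup>2) \<partial>M) = (\<integral>\<^sup>+Z. ennreal (\<phi> Z * (h Z)\<^sup>2) \<partial>M)"
    by (intro nn_integral_cong) (simp add: ennreal_mult \<phi>)
  have int2: "integrable M (\<lambda>Z. \<phi> Z * (h Z)\<^sup>2)"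
    by (rule integrableI_bounded) (use True eq \<phi> in \<open>auto simp: abs_mult\<close>)
  have int1: "integrable M \<phi>"
    by (rule integrableI_bounded) (use \<phi> in auto)
  have I1: "(\<integral>Z. \<phi> Z \<partial>M) = 1"
    using nn_integral_eq_integral[OF int1] \<phi> by (simp add: ennreal_eq_1)
  define m where "m = (\<integral>Z. \<phi> Z * h Z \<partial>M)"
  have "0 \<le> (\<integral>Z. \<phi> Z * (h Z - m)\<^sup>2 \<partial>M)" using \<phi> by (intro integral_nonneg_AE) auto
  also have "(\<lambda>Z. \<phi> Z * (h Z - m)\<^sup>2) = (\<lambda>Z. (\<phi> Z * (h Z)\<^sup>2 - (2 * m) * (\<phi> Z * h Z)) + m\<^sup>2 * \<phi> Z)"
    by (auto simp: power2_eq_square algebra_simps)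
  also have "(\<integral>Z. (\<phi> Z * (h Z)\<^sup>2 - (2 * m) * (\<phi> Z * h Z)) + m\<^sup>2 * \<phi> Z \<partial>M)
     = (\<integral>Z. \<phi> Z * (h Z)\<^sup>2 \<partial>M) - (2 * m) * m + m\<^sup>2 * 1"
    using int int1 int2 by (simp add: m_def[symmetric] I1)
  finally have "m\<^sup>2 \<le> (\<integral>Z. \<phi> Z * (h Z)\<^sup>2 \<partial>M)" by (simp add: power2_eq_square)
  then have "ennreal (m\<^sup>2) \<le> ennreal (\<integral>Z. \<phi> Z * (h Z)\<^sup>2 \<partial>M)" by (rule ennreal_leI)
  also have "\<dots> = (\<integral>\<^sup>+Z. ennreal (\<phi> Z * (h Z)\<^sup>2) \<partial>M)"
    by (rule nn_integral_eq_integral[symmetric, OF int2]) (use \<phi> in auto)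
  finally show ?thesis unfolding m_def eq .
qed (simp add: less_top[symmetric])

text \<open>
  The dilation \<open>t \<mapsto> (1 - 2\<eta>) t + \<eta>\<close> of the height keeps the averages away from the two
  ends of \<open>(0, 1)\<close>.
\<close>

definition probe :: "real \<Rightarrow> 'a::euclidean_space \<times> real \<Rightarrow> 'a \<times> real \<Rightarrow> 'a \<times> real" where
  "probe \<eta> Z = shear (- fst Z) (1 - 2 * \<eta>) (\<eta> - snd Z)"

definition mollify :: "('a::euclidean_space \<times> real \<Rightarrow> real) \<Rightarrow> real \<Rightarrow> ('a \<times> real \<Rightarrow> real) \<Rightarrow> 'a \<times> real \<Rightarrow> real" where
  "mollify \<phi> \<eta> f X = (\<integral>Z. \<phi> Z * f (probe \<eta> Z X) \<partial>lborel)"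

lemma probe_eq: "probe \<eta> Z X = shear 0 (1 - 2 * \<eta>) \<eta> X - Z"
  by (cases Z) (simp add: probe_def shear_def)

lemma probe_measurable [measurable]: "probe \<eta> Z \<in> borel_measurable borel"
  unfolding probe_def by measurable

lemma probe_measurable_fst [measurable]: "(\<lambda>Z. probe \<eta> Z X) \<in> borel_measurable borel"
  unfolding probe_def shear_def by (intro borel_measurable_continuous_onI continuous_intros)

lemma lborel_distr_reflect: "distr lborel borel (\<lambda>W. t - W) = (lborel :: 'b::euclidean_space measure)"
  by (subst lborel_affine[of "-1" t]) (auto simp: density_1)

lemma
  fixes h :: "'b::euclidean_space \<Rightarrow> real"
  assumes [measurable]: "h \<in> borel_measurable borel"
  shows integral_lborel_reflect: "(\<integral>W. h (t - W) \<partial>lborel) = (\<integral>W. h W \<partial>lborel)"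
    and integrable_lborel_reflect: "integrable lborel (\<lambda>W. h (t - W)) \<longleftrightarrow> integrable lborel h"
proof -
  have "(\<integral>W. h W \<partial>lborel) = (\<integral>W. h W \<partial>distr lborel borel (\<lambda>W. t - W))" by (simp add: lborel_distr_reflect)
  also have "\<dots> = (\<integral>W. h (t - W) \<partial>lborel)" by (rule integral_distr) auto
  finally show "(\<integral>W. h (t - W) \<partial>lborel) = (\<integral>W. h W \<partial>lborel)" ..
  have "integrable lborel h \<longleftrightarrow> integrable (distr lborel borel (\<lambda>W. t - W)) h" by (simp add: lborel_distr_reflect)
  also have "\<dots> \<longleftrightarrow> integrable lborel (\<lambda>W. h (t - W))" by (rule integrable_distr_eq) auto
  finally show "integrable lborel (\<lambda>W. h (t - W)) \<longleftrightarrow> integrable lborel h" ..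
qed

context
  fixes \<phi> :: "'a::euclidean_space \<times> real \<Rightarrow> real" and \<delta> \<eta> :: real and f :: "'a \<times> real \<Rightarrow> real"
  assumes \<phi>: "mollifier \<delta> \<phi>" and f: "integrable lborel f" and \<eta>: "0 < \<eta>" "\<eta> < 1/2"
begin

lemmas [measurable] = mollifier_measurable[OF \<phi>] borel_measurable_integrable[OF f, unfolded measurable_lborel2]

text \<open>The reflection \<open>W = ?t - Z\<close> at the dilated point moves the dependence on
  \<open>X\<close> from \<open>f\<close> to \<open>\<phi>\<close>. Boundedness and Lipschitz
  continuity of \<open>\<phi>\<close> are then inherited although \<open>f\<close> is only
  integrable.\<close>

lemma mollify_integrable: "integrable lborel (\<lambda>Z. \<phi> Z * f (probe \<eta> Z X))"
  and mollify_convolution: "mollify \<phi> \<eta> f X = (\<integral>W. \<phi> (shear 0 (1 - 2 * \<eta>) \<eta> X - W) * f W \<partial>lborel)"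
  and convolution_integrable: "integrable lborel (\<lambda>W. \<phi> (shear 0 (1 - 2 * \<eta>) \<eta> X - W) * f W)"
proof -
  let ?t = "shear 0 (1 - 2 * \<eta>) \<eta> X"
  obtain B where B: "\<And>Z. \<phi> Z \<le> B" using \<phi> unfolding mollifier_def by blast
  have [measurable]: "(\<lambda>W. ?t - W) \<in> borel_measurable borel" by measurable
  show i: "integrable lborel (\<lambda>W. \<phi> (?t - W) * f W)"
  proof (rule Bochner_Integration.integrable_bound)
    show "integrable lborel (\<lambda>W. B * f W)" using f by simp
    show "AE W in lborel. norm (\<phi> (?t - W) * f W) \<le> norm (B * f W)"
    proof (rule AE_I2)
      fix W
      show "norm (\<phi> (?t - W) * f W) \<le> norm (B * f W)"
        using B[of "?t - W"] mollifier_nonneg[OF \<phi>, of "?t - W"] by (simp add: abs_mult mult_right_mono)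
    qed
  qed measurable
  let ?h = "\<lambda>Z. \<phi> Z * f (?t - Z)"
  have hm: "?h \<in> borel_measurable borel" by measurable
  show "integrable lborel (\<lambda>Z. \<phi> Z * f (probe \<eta> Z X))"
    using integrable_lborel_reflect[OF hm, of ?t] i by (simp add: probe_eq)
  show "mollify \<phi> \<eta> f X = (\<integral>W. \<phi> (?t - W) * f W \<partial>lborel)"
    using integral_lborel_reflect[OF hm, of ?t] by (simp add: probe_eq mollify_def)
qed

lemma mollify_bounded: "\<exists>M. \<forall>X. \<bar>mollify \<phi> \<eta> f X\<bar> \<le> M"
proof -
  obtain B where B: "\<And>Z. \<phi> Z \<le> B" using \<phi> unfolding mollifier_def by blast
  have "\<bar>mollify \<phi> \<eta> f X\<bar> \<le> (\<integral>W. B * \<bar>f W\<bar> \<partial>lborel)" for X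
    unfolding mollify_convolution
  proof (rule order_trans[OF integral_abs_bound integral_mono])
    show "\<bar>\<phi> (shear 0 (1 - 2 * \<eta>) \<eta> X - W) * f W\<bar> \<le> B * \<bar>f W\<bar>" for W
      using B[of "shear 0 (1 - 2 * \<eta>) \<eta> X - W"] mollifier_nonneg[OF \<phi>, of "shear 0 (1 - 2 * \<eta>) \<eta> X - W"]
      by (simp add: abs_mult mult_right_mono)
  qed (use f convolution_integrable in auto)
  then show ?thesis by blast
qed

lemma mollify_lipschitz: "\<exists>L. L-lipschitz_on UNIV (mollify \<phi> \<eta> f)"
proof -
  obtain c where c: "c-lipschitz_on UNIV \<phi>" using \<phi> unfolding mollifier_def by blast
  then have c0: "c \<ge> 0" by (rule lipschitz_on_nonneg)
  let ?t = "shear 0 (1 - 2 * \<eta>) \<eta>"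
  have "(c * (\<integral>W. \<bar>f W\<bar> \<partial>lborel))-lipschitz_on UNIV (mollify \<phi> \<eta> f)"
  proof (rule lipschitz_onI)
    fix X Y :: "'a \<times> real"
    have dt: "dist (?t X) (?t Y) \<le> dist X Y"
    proof -
      have "dist (?t X) (?t Y) = sqrt ((dist (fst X) (fst Y))\<^sup>2 + (\<bar>1 - 2 * \<eta>\<bar> * dist (snd X) (snd Y))\<^sup>2)"
        by (simp add: shear_def dist_Pair_Pair dist_real_def abs_mult[symmetric] algebra_simps)
      also have "\<dots> \<le> sqrt ((dist (fst X) (fst Y))\<^sup>2 + (1 * dist (snd X) (snd Y))\<^sup>2)"
        using \<eta> by (intro real_sqrt_le_mono add_left_mono power_mono mult_right_mono) auto
      also have "\<dots> = dist X Y" by (simp add: dist_prod_def)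
      finally show ?thesis .
    qed
    have "mollify \<phi> \<eta> f X - mollify \<phi> \<eta> f Y = (\<integral>W. \<phi> (?t X - W) * f W - \<phi> (?t Y - W) * f W \<partial>lborel)"
      unfolding mollify_convolution by (rule Bochner_Integration.integral_diff[symmetric]; rule convolution_integrable)
    also have "\<bar>\<dots>\<bar> \<le> (\<integral>W. (c * dist X Y) * \<bar>f W\<bar> \<partial>lborel)"
    proof (rule order_trans[OF integral_abs_bound integral_mono])
      fix W
      have "\<bar>\<phi> (?t X - W) - \<phi> (?t Y - W)\<bar> \<le> c * dist (?t X) (?t Y)"
        using lipschitz_onD[OF c, of "?t X - W" "?t Y - W"] by (simp add: dist_real_def dist_norm)
      also have "\<dots> \<le> c * dist X Y" using c0 dt by (intro mult_left_mono)
      finally show "\<bar>\<phi> (?t X - W) * f W - \<phi> (?t Y - W) * f W\<bar> \<le> (c * dist X Y) * \<bar>f W\<bar>"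
        unfolding left_diff_distrib[symmetric] abs_mult by (intro mult_right_mono) auto
    qed (use f convolution_integrable in auto)
    finally show "dist (mollify \<phi> \<eta> f X) (mollify \<phi> \<eta> f Y) \<le> c * (\<integral>W. \<bar>f W\<bar> \<partial>lborel) * dist X Y"
      by (simp add: dist_real_def mult_ac)
  qed (use c0 in simp)
  then show ?thesis by blast
qed

lemma mollify_jensen:
  "ennreal ((mollify \<phi> \<eta> f X - y)\<^sup>2) \<le> (\<integral>\<^sup>+Z. ennreal (\<phi> Z) * ennreal ((f (probe \<eta> Z X) - y)\<^sup>2) \<partial>lborel)"
proof -
  have int1: "integrable lborel \<phi>"
    by (rule integrableI_bounded) (use mollifier_nonneg[OF \<phi>] mollifier_nn_integral[OF \<phi>] in auto)
  have I1: "(\<integral>Z. \<phi> Z \<partial>lborel) = 1"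
    using nn_integral_eq_integral[OF int1] mollifier_nonneg[OF \<phi>] mollifier_nn_integral[OF \<phi>] by (simp add: ennreal_eq_1)
  have eq: "(\<lambda>Z. \<phi> Z * (f (probe \<eta> Z X) - y)) = (\<lambda>Z. \<phi> Z * f (probe \<eta> Z X) - y * \<phi> Z)"
    by (simp add: algebra_simps)
  have i: "integrable lborel (\<lambda>Z. \<phi> Z * (f (probe \<eta> Z X) - y))"
    unfolding eq using int1 mollify_integrable by auto
  have "(\<integral>Z. \<phi> Z * (f (probe \<eta> Z X) - y) \<partial>lborel) = mollify \<phi> \<eta> f X - y"
    unfolding eq using int1 mollify_integrable[of X] by (simp add: I1 mollify_def)
  then show ?thesis using jensen_square[OF _ _ mollifier_nonneg[OF \<phi>] mollifier_nn_integral[OF \<phi>] i] by simp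
qed

lemma mollify_jensen_diff:
  "ennreal ((mollify \<phi> \<eta> f X - mollify \<phi> \<eta> f Y)\<^sup>2) \<le>
     (\<integral>\<^sup>+Z. ennreal (\<phi> Z) * ennreal ((f (probe \<eta> Z X) - f (probe \<eta> Z Y))\<^sup>2) \<partial>lborel)"
proof -
  have eq: "(\<lambda>Z. \<phi> Z * (f (probe \<eta> Z X) - f (probe \<eta> Z Y))) = (\<lambda>Z. \<phi> Z * f (probe \<eta> Z X) - \<phi> Z * f (probe \<eta> Z Y))"
    by (simp add: algebra_simps)
  have i: "integrable lborel (\<lambda>Z. \<phi> Z * (f (probe \<eta> Z X) - f (probe \<eta> Z Y)))"
    unfolding eq using mollify_integrable by auto
  have "(\<integral>Z. \<phi> Z * (f (probe \<eta> Z X) - f (probe \<eta> Z Y)) \<partial>lborel) = mollify \<phi> \<eta> f X - mollify \<phi> \<eta> f Y"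
    unfolding eq using mollify_integrable[of X] mollify_integrable[of Y] by (simp add: mollify_def)
  then show ?thesis using jensen_square[OF _ _ mollifier_nonneg[OF \<phi>] mollifier_nn_integral[OF \<phi>] i] by simp
qed

text \<open>In the application \<open>f\<close> carries a cut-off that changes along the
  approximation. \<open>F\<close> is a fixed function that agrees with \<open>f\<close> at all
  relevant probes, so a continuity modulus of \<open>F\<close> alone controls the error. Jensen and
  Tonelli reduce the claim to one \<open>Z\<close> at a time.\<close>

lemma mollify_L2:
  assumes [measurable]: "Q \<in> sets borel" "V \<in> borel_measurable borel" "F \<in> borel_measurable borel"
    and near: "\<And>X Z. X \<in> Q \<Longrightarrow> norm Z < \<delta> \<Longrightarrow> f (probe \<eta> Z X) = F (probe \<eta> Z X)"
    and on: "\<And>X. X \<in> Q \<Longrightarrow> F X = V X"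
    and r: "\<And>Z. norm Z < \<delta> \<Longrightarrow> (\<integral>\<^sup>+X. ennreal ((F (probe \<eta> Z X) - F X)\<^sup>2) \<partial>lborel) \<le> ennreal r"
  shows "(\<integral>\<^sup>+X. ennreal ((mollify \<phi> \<eta> f X - V X)\<^sup>2) * indicator Q X \<partial>lborel) \<le> ennreal r"
proof -
  have [measurable]: "(\<lambda>p. F (probe \<eta> (snd p) (fst p))) \<in> borel_measurable borel"
    unfolding probe_def shear_def
    by (rule measurable_compose[OF borel_measurable_continuous_onI assms(3)]) (intro continuous_intros)
  have "(\<integral>\<^sup>+X. ennreal ((mollify \<phi> \<eta> f X - V X)\<^sup>2) * indicator Q X \<partial>lborel)
    \<le> (\<integral>\<^sup>+X. \<integral>\<^sup>+Z. ennreal (\<phi> Z) * ennreal ((F (probe \<eta> Z X) - F X)\<^sup>2) \<partial>lborel \<partial>lborel)"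
  proof (rule nn_integral_mono)
    fix X :: "'a \<times> real"
    show "ennreal ((mollify \<phi> \<eta> f X - V X)\<^sup>2) * indicator Q X \<le> (\<integral>\<^sup>+Z. ennreal (\<phi> Z) * ennreal ((F (probe \<eta> Z X) - F X)\<^sup>2) \<partial>lborel)"
    proof (cases "X \<in> Q")
      case True
      have "ennreal ((mollify \<phi> \<eta> f X - V X)\<^sup>2) \<le> (\<integral>\<^sup>+Z. ennreal (\<phi> Z) * ennreal ((f (probe \<eta> Z X) - V X)\<^sup>2) \<partial>lborel)"
        by (rule mollify_jensen)
      also have "\<dots> = (\<integral>\<^sup>+Z. ennreal (\<phi> Z) * ennreal ((F (probe \<eta> Z X) - F X)\<^sup>2) \<partial>lborel)"
      proof (rule nn_integral_cong)
        fix Z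
        show "ennreal (\<phi> Z) * ennreal ((f (probe \<eta> Z X) - V X)\<^sup>2) = ennreal (\<phi> Z) * ennreal ((F (probe \<eta> Z X) - F X)\<^sup>2)"
          using mollifier_support[OF \<phi>, of Z] near[OF True, of Z] on[OF True] by (cases "\<phi> Z = 0") auto
      qed
      finally show ?thesis using True by simp
    qed simp
  qed
  also have "\<dots> = (\<integral>\<^sup>+Z. \<integral>\<^sup>+X. ennreal (\<phi> Z) * ennreal ((F (probe \<eta> Z X) - F X)\<^sup>2) \<partial>lborel \<partial>lborel)"
    by (rule nn_integral_lborel_swap) measurable
  also have "\<dots> \<le> (\<integral>\<^sup>+Z. ennreal (\<phi> Z) * ennreal r \<partial>lborel)"
  proof (rule nn_integral_mono)
    fix Z
    have "(\<integral>\<^sup>+X. ennreal (\<phi> Z) * ennreal ((F (probe \<eta> Z X) - F X)\<^sup>2) \<partial>lborel) = ennreal (\<phi> Z) * (\<integral>\<^sup>+X. ennreal ((F (probe \<eta> Z X) - F X)\<^sup>2) \<partial>lborel)"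
      by (rule nn_integral_cmult) measurable
    also have "\<dots> \<le> ennreal (\<phi> Z) * ennreal r"
      using r[of Z] mollifier_support[OF \<phi>, of Z] by (cases "\<phi> Z = 0") (auto intro: mult_left_mono)
    finally show "(\<integral>\<^sup>+X. ennreal (\<phi> Z) * ennreal ((F (probe \<eta> Z X) - F X)\<^sup>2) \<partial>lborel) \<le> ennreal (\<phi> Z) * ennreal r" .
  qed
  also have "\<dots> = ennreal r" by (simp add: nn_integral_multc mollifier_nn_integral[OF \<phi>])
  finally show ?thesis .
qed

text \<open>For each \<open>Z\<close> both points undergo the same horizontal translation and the
  same affine map of the height. At \<open>\<epsilon> = 0\<close> they share their base, so the
  cut-off by \<open>K\<close> keeps or kills both; the new heights stay in the inner strip; and
  contracting the height difference can only increase the kernel. Each height contributes a Jacobian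
  factor \<open>1 / (1 - 2 * \<eta>)\<close>, whence the square. Jensen then averages over
  \<open>Z\<close>.\<close>

lemma mollify_energy:
  assumes \<omega>: "open \<omega>" and V: "V \<in> borel_measurable borel" and \<sigma>: "0 \<le> \<sigma>" and \<delta>: "\<delta> \<le> \<eta> / 2"
    and K: "K \<subseteq> \<omega>" and fV: "f = (\<lambda>X. V X * indicator (K \<times> {\<eta>/2..1 - \<eta>/2}) X)"
  shows "energy \<omega> 0 \<sigma> (mollify \<phi> \<eta> f) \<le> ennreal (1 / (1 - 2 * \<eta>)\<^sup>2) * energy \<omega> 0 \<sigma> V"
proof -
  let ?a = "1 - 2 * \<eta>"
  let ?D = "dens \<omega> 0 \<sigma> V"
  have a: "?a > 0" "?a \<le> 1" using \<eta> by auto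
  \<comment> \<open>The variable \<open>\<xi>\<close> is left unchanged, so the kernels differ only
    through the heights and no horizontal Jacobian appears.\<close>
  define T where "T Z P = (probe \<eta> Z (fst P), shear 0 ?a (\<eta> - snd Z) (snd P))" for Z :: "'a \<times> real" and P :: "('a \<times> real) \<times> ('a \<times> real)"
  note Dm[measurable] = measurable_dens[OF \<omega> V, of 0 \<sigma>]
  have DTm[measurable]: "(\<lambda>p. ?D (T (snd p) (fst p))) \<in> borel_measurable borel"
    unfolding T_def probe_def shear_def
    by (rule measurable_compose[OF borel_measurable_continuous_onI Dm]) (intro continuous_intros)
  have DTm1[measurable]: "(\<lambda>P. ?D (T Z P)) \<in> borel_measurable borel" "(\<lambda>Z. ?D (T Z P)) \<in> borel_measurable borel" for Z P
    unfolding T_def probe_def shear_def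
    by (rule measurable_compose[OF borel_measurable_continuous_onI Dm], intro continuous_intros)+
  have kern_T: "kern \<sigma> P \<le> kern \<sigma> (T Z P)" for Z P
  proof -
    let ?n = "(norm (fst (snd P)))\<^sup>2" and ?d = "snd (fst P) - snd (snd P)"
    let ?p = "real (DIM('a) + 1) / 2 + \<sigma>"
    have k: "kern \<sigma> (T Z P) = 1 / (?n + (?a * ?d)\<^sup>2) powr ?p"
      by (simp add: kern_def T_def probe_def shear_def algebra_simps)
    have le: "?n + (?a * ?d)\<^sup>2 \<le> ?n + ?d\<^sup>2"
      using a by (simp add: power_mult_distrib mult_left_le_one_le power_le_one)
    show ?thesis
    proof (cases "?n + (?a * ?d)\<^sup>2 = 0")
      \<comment> \<open>The value 0 of the kernel at singular points does not break the
        monotonicity: as \<open>?a > 0\<close>, the contracted base vanishes only together with the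
        original one.\<close>
      case True
      then have "?n + ?d\<^sup>2 = 0" using a by (simp add: add_nonneg_eq_0_iff)
      then show ?thesis unfolding k True by (simp add: kern_def)
    next
      case False
      then have pos: "?n + (?a * ?d)\<^sup>2 > 0" by (metis add_nonneg_nonneg zero_le_power2 less_le)
      have "(?n + (?a * ?d)\<^sup>2) powr ?p \<le> (?n + ?d\<^sup>2) powr ?p"
        using le \<sigma> by (intro powr_mono2) auto
      then show ?thesis unfolding k unfolding kern_def using pos le by (intro divide_left_mono mult_pos_pos) auto
    qed
  qed
  have pw: "dens \<omega> 0 \<sigma> (mollify \<phi> \<eta> f) P \<le> (\<integral>\<^sup>+Z. ennreal (\<phi> Z) * ?D (T Z P) \<partial>lborel)" for P
  proof (cases "fst P \<in> \<omega> \<times> {0<..<1} \<and> shift 0 P \<in> \<omega> \<times> {0<..<1}")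
    case True
    have heights: "snd (fst P) \<in> {0<..<1}" "snd (snd P) \<in> {0<..<1}"
      using True by (cases "fst P"; simp add: shift_def)+
    have est: "ennreal (\<phi> Z) * ennreal ((f (probe \<eta> Z (fst P)) - f (probe \<eta> Z (shift 0 P)))\<^sup>2) * ennreal (kern \<sigma> P)
       \<le> ennreal (\<phi> Z) * ?D (T Z P)" for Z
    proof (cases "\<phi> Z = 0")
      case False
      then have "norm Z < \<eta> / 2" using mollifier_support[OF \<phi>, of Z] \<delta> by simp
      moreover have "\<bar>snd Z\<bar> \<le> norm Z" by (metis norm_snd_le prod.collapse real_norm_def)
      ultimately have r: "\<bar>snd Z\<bar> < \<eta> / 2" by simp
      \<comment> \<open>The dilation maps the unit interval into
        \<open>{\<eta>..1 - \<eta>}\<close>, and \<open>snd Z\<close> moves the result by less than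
        \<open>\<eta> / 2\<close>.\<close>
      have h: "?a * t + (\<eta> - snd Z) \<in> {\<eta>/2..1 - \<eta>/2}" if "t \<in> {0<..<1}" for t
      proof -
        have "0 \<le> ?a * t" "?a * t \<le> ?a * 1" using that a by (auto intro: mult_left_mono)
        then show ?thesis using r by auto
      qed
      have sT: "shift 0 (T Z P) = probe \<eta> Z (shift 0 P)" by (simp add: shift_def T_def probe_def shear_def)
      have fT: "fst (T Z P) = probe \<eta> Z (fst P)" by (simp add: T_def)
      show ?thesis
      proof (cases "fst (fst P) - fst Z \<in> K")
        case True
        have 1: "probe \<eta> Z (fst P) \<in> K \<times> {\<eta>/2..1 - \<eta>/2}" "probe \<eta> Z (shift 0 P) \<in> K \<times> {\<eta>/2..1 - \<eta>/2}"
          using True h[OF heights(1)] h[OF heights(2)] by (auto simp: probe_def shear_def shift_def)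
        have sub: "K \<times> {\<eta>/2..1 - \<eta>/2} \<subseteq> \<omega> \<times> {0<..<1}" using K \<eta> by auto
        have 2: "fst (T Z P) \<in> \<omega> \<times> {0<..<1}" "shift 0 (T Z P) \<in> \<omega> \<times> {0<..<1}"
          unfolding sT fT by (rule subsetD[OF sub 1(1)], rule subsetD[OF sub 1(2)])
        have "?D (T Z P) = ennreal ((V (probe \<eta> Z (fst P)) - V (probe \<eta> Z (shift 0 P)))\<^sup>2 * kern \<sigma> (T Z P))"
          using 2 by (simp add: dens_def sT fT)
        also have "\<dots> \<ge> ennreal ((V (probe \<eta> Z (fst P)) - V (probe \<eta> Z (shift 0 P)))\<^sup>2 * kern \<sigma> P)"
          by (intro ennreal_leI mult_left_mono kern_T) auto
        finally have le: "ennreal ((V (probe \<eta> Z (fst P)) - V (probe \<eta> Z (shift 0 P)))\<^sup>2) * ennreal (kern \<sigma> P) \<le> ?D (T Z P)"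
          by (simp only: ennreal_mult[OF zero_le_power2 kern_nonneg])
        have feq: "f X = V X" if "X \<in> K \<times> {\<eta>/2..1 - \<eta>/2}" for X
          using that by (simp only: fV indicator_simps mult_1_right)
        show ?thesis unfolding feq[OF 1(1)] feq[OF 1(2)] mult.assoc by (rule mult_left_mono[OF le]) simp
      next
        case False
        then have "f (probe \<eta> Z (fst P)) = 0" "f (probe \<eta> Z (shift 0 P)) = 0"
          by (auto simp: fV probe_def shear_def shift_def indicator_def)
        then show ?thesis by simp
      qed
    qed simp
    have [measurable]: "(\<lambda>Z. f (probe \<eta> Z X)) \<in> borel_measurable borel" for X by measurable
    have "dens \<omega> 0 \<sigma> (mollify \<phi> \<eta> f) P = ennreal ((mollify \<phi> \<eta> f (fst P) - mollify \<phi> \<eta> f (shift 0 P))\<^sup>2) * ennreal (kern \<sigma> P)"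
      using True by (simp add: dens_def ennreal_mult)
    also have "\<dots> \<le> (\<integral>\<^sup>+Z. ennreal (\<phi> Z) * ennreal ((f (probe \<eta> Z (fst P)) - f (probe \<eta> Z (shift 0 P)))\<^sup>2) \<partial>lborel) * ennreal (kern \<sigma> P)"
      by (intro mult_right_mono mollify_jensen_diff) simp
    also have "\<dots> = (\<integral>\<^sup>+Z. ennreal (\<phi> Z) * ennreal ((f (probe \<eta> Z (fst P)) - f (probe \<eta> Z (shift 0 P)))\<^sup>2) * ennreal (kern \<sigma> P) \<partial>lborel)"
      by (rule nn_integral_multc[symmetric]) measurable
    also have "\<dots> \<le> (\<integral>\<^sup>+Z. ennreal (\<phi> Z) * ?D (T Z P) \<partial>lborel)"
      by (intro nn_integral_mono est)
    finally show ?thesis .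
  qed (auto simp: dens_def)
  have T_int: "(\<integral>\<^sup>+P. ?D (T Z P) \<partial>lborel) = ennreal (1 / ?a\<^sup>2) * energy \<omega> 0 \<sigma> V" for Z
  proof -
    have Ds[measurable]: "(\<lambda>Y. ?D (X, Y)) \<in> borel_measurable borel" for X
      by (rule measurable_compose[OF borel_measurable_continuous_onI Dm]) (intro continuous_intros)
    have "(\<integral>\<^sup>+P. ?D (T Z P) \<partial>lborel) = (\<integral>\<^sup>+X. \<integral>\<^sup>+Y. ?D (probe \<eta> Z X, shear 0 ?a (\<eta> - snd Z) Y) \<partial>lborel \<partial>lborel)"
      by (subst nn_integral_lborel_pair(1)) (simp_all add: T_def[symmetric], simp add: T_def)
    also have "\<dots> = (\<integral>\<^sup>+X. ennreal (1 / ?a) * (\<integral>\<^sup>+Y. ?D (probe \<eta> Z X, Y) \<partial>lborel) \<partial>lborel)"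
      by (intro nn_integral_cong nn_integral_shear_arg a Ds)
    also have "\<dots> = ennreal (1 / ?a) * (\<integral>\<^sup>+X. \<integral>\<^sup>+Y. ?D (probe \<eta> Z X, Y) \<partial>lborel \<partial>lborel)"
      by (rule nn_integral_cmult)
         (use measurable_compose[OF probe_measurable borel_measurable_nn_integral_lborel(1)[OF Dm]] in simp)
    also have "(\<integral>\<^sup>+X. \<integral>\<^sup>+Y. ?D (probe \<eta> Z X, Y) \<partial>lborel \<partial>lborel) = ennreal (1 / ?a) * (\<integral>\<^sup>+X. \<integral>\<^sup>+Y. ?D (X, Y) \<partial>lborel \<partial>lborel)"
      unfolding probe_def by (rule nn_integral_shear_arg[OF borel_measurable_nn_integral_lborel(1)[OF Dm] a(1)])
    also have "(\<integral>\<^sup>+X. \<integral>\<^sup>+Y. ?D (X, Y) \<partial>lborel \<partial>lborel) = energy \<omega> 0 \<sigma> V"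
      unfolding energy_def by (rule nn_integral_lborel_pair(1)[OF Dm, symmetric])
    also have "ennreal (1 / ?a) * (ennreal (1 / ?a) * energy \<omega> 0 \<sigma> V) = ennreal (1 / ?a\<^sup>2) * energy \<omega> 0 \<sigma> V"
      using a by (simp add: mult.assoc[symmetric] ennreal_mult[symmetric] power2_eq_square)
    finally show ?thesis .
  qed
  have "energy \<omega> 0 \<sigma> (mollify \<phi> \<eta> f) \<le> (\<integral>\<^sup>+P. \<integral>\<^sup>+Z. ennreal (\<phi> Z) * ?D (T Z P) \<partial>lborel \<partial>lborel)"
    unfolding energy_def by (intro nn_integral_mono pw)
  also have "\<dots> = (\<integral>\<^sup>+Z. \<integral>\<^sup>+P. ennreal (\<phi> Z) * ?D (T Z P) \<partial>lborel \<partial>lborel)"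
    by (rule nn_integral_lborel_swap) measurable
  also have "\<dots> = (\<integral>\<^sup>+Z. ennreal (\<phi> Z) * (ennreal (1 / ?a\<^sup>2) * energy \<omega> 0 \<sigma> V) \<partial>lborel)"
    by (intro nn_integral_cong) (simp add: nn_integral_cmult T_int)
  also have "\<dots> = ennreal (1 / ?a\<^sup>2) * energy \<omega> 0 \<sigma> V" by (simp add: nn_integral_multc mollifier_nn_integral[OF \<phi>])
  finally show ?thesis .
qed

end

section \<open>Gamma-convergence\<close>

text \<open>Mollification acts on integrable functions; on a set of finite measure
  \<open>\<bar>V\<bar> \<le> V\<^sup>2 + 1\<close> reduces this to the L2 bound.\<close>

lemma integrable_L2_compact:
  fixes V :: "'b::euclidean_space \<Rightarrow> real"
  assumes [measurable]: "V \<in> borel_measurable borel" and K: "compact K"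
    and fin: "(\<integral>\<^sup>+X. ennreal ((V X)\<^sup>2) * indicator K X \<partial>lborel) < \<infinity>"
  shows "integrable lborel (\<lambda>X. V X * indicator K X)"
proof (rule integrableI_bounded)
  have [measurable]: "K \<in> sets borel" using K by (rule borel_compact)
  then show "(\<lambda>X. V X * indicator K X) \<in> borel_measurable lborel" by measurable
  have "(\<integral>\<^sup>+X. ennreal (norm (V X * indicator K X)) \<partial>lborel) \<le>
     (\<integral>\<^sup>+X. ennreal ((V X)\<^sup>2) * indicator K X + indicator K X \<partial>lborel)"
  proof (rule nn_integral_mono)
    fix X
    have "\<bar>V X\<bar> \<le> (V X)\<^sup>2 + 1" using zero_le_power2[of "\<bar>V X\<bar> - 1"]
      by (simp add: power2_diff)
    then have "ennreal \<bar>V X\<bar> \<le> ennreal ((V X)\<^sup>2 + 1)" by (rule ennreal_leI)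
    then show "ennreal (norm (V X * indicator K X)) \<le> ennreal ((V X)\<^sup>2) * indicator K X + indicator K X"
      by (simp add: indicator_def)
  qed
  also have "\<dots> = (\<integral>\<^sup>+X. ennreal ((V X)\<^sup>2) * indicator K X \<partial>lborel) + emeasure lborel K"
    by (simp add: nn_integral_add)
  also have "\<dots> < \<infinity>" using fin emeasure_compact_finite[OF K] by simp
  finally show "(\<integral>\<^sup>+X. ennreal (norm (V X * indicator K X)) \<partial>lborel) < \<infinity>" .
qed

lemma dist_probe_le:
  assumes "snd X \<in> {0..1}" "0 \<le> \<eta>"
  shows "dist X (probe \<eta> Z X) \<le> norm Z + \<eta>"
proof -
  have "dist X (probe \<eta> Z X) = norm (Z + (0, \<eta> * (2 * snd X - 1)))"
    by (cases X; cases Z) (simp add: probe_eq shear_def dist_norm algebra_simps)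
  also have "\<dots> \<le> norm Z + norm (0 :: 'a, \<eta> * (2 * snd X - 1))" by (rule norm_triangle_ineq)
  also have "norm (0 :: 'a, \<eta> * (2 * snd X - 1)) = \<eta> * \<bar>2 * snd X - 1\<bar>"
    using assms by (simp add: norm_Pair abs_mult)
  also have "\<dots> \<le> \<eta> * 1" using assms by (intro mult_left_mono) auto
  finally show ?thesis by simp
qed

text \<open>A single parameter \<open>\<eta> j\<close> governs the dilation, the strip and the
  mollifier radius. The averages over dilated heights therefore never reach the edge of the strip,
  and the cut-off in height creates no energy.\<close>

lemma lipschitz_approximation:
  fixes \<omega> :: "'a::euclidean_space set" and V :: "'a \<times> real \<Rightarrow> real"
  assumes \<omega>: "open \<omega>" and V[measurable]: "V \<in> borel_measurable borel" and \<sigma>: "0 \<le> \<sigma>"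
    and loc: "\<And>K. compact K \<Longrightarrow> K \<subseteq> \<omega> \<times> {0<..<1} \<Longrightarrow> (\<integral>\<^sup>+X. ennreal ((V X)\<^sup>2) * indicator K X \<partial>lborel) < \<infinity>"
  obtains g :: "nat \<Rightarrow> 'a \<times> real \<Rightarrow> real" where
    "\<And>j. \<exists>L. L-lipschitz_on UNIV (g j)" "\<And>j. \<exists>M. \<forall>X. \<bar>g j X\<bar> \<le> M"
    "\<And>j. energy \<omega> 0 \<sigma> (g j) \<le> ennreal (1 / (1 - 2 * (1 / real (j + 4)))\<^sup>2) * energy \<omega> 0 \<sigma> V"
    "\<And>K. compact K \<Longrightarrow> K \<subseteq> \<omega> \<times> {0<..<1} \<Longrightarrow>
       (\<lambda>j. \<integral>\<^sup>+X. ennreal ((g j X - V X)\<^sup>2) * indicator K X \<partial>lborel) \<longlonglongrightarrow> 0"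
proof -
  obtain C where C: "\<forall>n::nat. compact (C n)" "\<forall>n. C n \<subseteq> \<omega>"
    "\<forall>K. compact K \<longrightarrow> K \<subseteq> \<omega> \<longrightarrow> (\<exists>N. \<forall>n\<ge>N. K \<subseteq> C n)"
    using compact_exhaustion[OF \<omega>] by (elim exE conjE)
  \<comment> \<open>The offset 4 keeps \<open>\<eta> j\<close> at most 1/4, so the dilation factor
    \<open>1 - 2 \<eta> j\<close> is positive from the start.\<close>
  define \<eta> where "\<eta> j = 1 / real (j + 4)" for j
  have \<eta>: "0 < \<eta> j" "\<eta> j < 1/2" for j by (auto simp: \<eta>_def field_simps)
  define D where "D j = C j \<times> {\<eta> j / 2..1 - \<eta> j / 2}" for j
  have D: "compact (D j)" "D j \<subseteq> \<omega> \<times> {0<..<1}" for j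
    unfolding D_def using C \<eta>[of j] by (auto intro!: compact_Times)
  define f where "f j = (\<lambda>X. V X * indicator (D j) X)" for j
  have f: "integrable lborel (f j)" for j
    unfolding f_def by (rule integrable_L2_compact[OF V D(1) loc[OF D]])
  have "\<exists>\<phi> :: 'a \<times> real \<Rightarrow> real. mollifier (\<eta> j / 2) \<phi>" for j by (rule mollifier_exists) (use \<eta> in simp)
  then obtain \<phi> :: "nat \<Rightarrow> 'a \<times> real \<Rightarrow> real" where \<phi>: "\<And>j. mollifier (\<eta> j / 2) (\<phi> j)" by metis
  show ?thesis
  proof (rule that[of "\<lambda>j. mollify (\<phi> j) (\<eta> j) (f j)"])
    fix j
    show "\<exists>L. L-lipschitz_on UNIV (mollify (\<phi> j) (\<eta> j) (f j))" by (rule mollify_lipschitz[OF \<phi> f \<eta>])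
    show "\<exists>M. \<forall>X. \<bar>mollify (\<phi> j) (\<eta> j) (f j) X\<bar> \<le> M" by (rule mollify_bounded[OF \<phi> f \<eta>])
    show "energy \<omega> 0 \<sigma> (mollify (\<phi> j) (\<eta> j) (f j)) \<le> ennreal (1 / (1 - 2 * (1 / real (j + 4)))\<^sup>2) * energy \<omega> 0 \<sigma> V"
      unfolding \<eta>_def[symmetric]
      by (rule mollify_energy[OF \<phi> f \<eta> \<omega> V \<sigma> order_refl C(2)[rule_format]]) (simp add: f_def D_def)
  next
    fix K :: "('a \<times> real) set" assume K: "compact K" "K \<subseteq> \<omega> \<times> {0<..<1}"
    show "(\<lambda>j. \<integral>\<^sup>+X. ennreal ((mollify (\<phi> j) (\<eta> j) (f j) X - V X)\<^sup>2) * indicator K X \<partial>lborel) \<longlonglongrightarrow> 0"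
    proof (rule tendsto_0_ennrealI)
      fix r :: real assume r: "r > 0"
      have S: "open (\<omega> \<times> {0<..<1::real})" using \<omega> by (intro open_Times) auto
      obtain \<rho> K' where \<rho>: "\<rho> > 0" "compact K'" "K' \<subseteq> \<omega> \<times> {0<..<1}" "\<And>x y. x \<in> K \<Longrightarrow> dist x y \<le> \<rho> \<Longrightarrow> y \<in> K'"
        using compact_enlarge[OF K(1) S K(2)] by metis
      have "compact (fst ` K')" "fst ` K' \<subseteq> \<omega>"
        using \<rho>(2,3) by (auto intro!: compact_continuous_image continuous_intros)
      then obtain N where N: "\<And>n. n \<ge> N \<Longrightarrow> fst ` K' \<subseteq> C n" using C(3) by meson
      have "compact (snd ` K')" "snd ` K' \<subseteq> {0<..<1}" "open {0<..<1::real}"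
        using \<rho>(2,3) by (auto intro!: compact_continuous_image continuous_intros)
      then obtain \<rho>' K'' where \<rho>': "\<rho>' > 0" "K'' \<subseteq> {0<..<1}" "\<And>x y. x \<in> snd ` K' \<Longrightarrow> dist x y \<le> \<rho>' \<Longrightarrow> y \<in> K''"
        using compact_enlarge[of "snd ` K'" "{0<..<1::real}"] by metis
      \<comment> \<open>The compact set of heights has positive distance from 0 and 1. This places
        \<open>K'\<close> inside \<open>D j\<close> once \<open>\<eta> j < \<rho>'\<close> and
        \<open>j \<ge> N\<close>.\<close>
      have K'snd: "snd X \<in> {\<rho>'..1 - \<rho>'}" if "X \<in> K'" for X
        using \<rho>'(3)[of "snd X" "snd X - \<rho>'"] \<rho>'(3)[of "snd X" "snd X + \<rho>'"] \<rho>'(1,2) that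
        by (auto simp: dist_real_def subset_iff)
      have [measurable]: "K \<in> sets borel" "K' \<in> sets borel" using K \<rho> by (auto intro: borel_compact)
      define F where "F = (\<lambda>X. V X * indicator K' X)"
      have F[measurable]: "F \<in> borel_measurable borel" unfolding F_def by measurable
      have "(\<integral>\<^sup>+X. ennreal ((F X)\<^sup>2) \<partial>lborel) = (\<integral>\<^sup>+X. ennreal ((V X)\<^sup>2) * indicator K' X \<partial>lborel)"
        by (intro nn_integral_cong) (auto simp: F_def indicator_def)
      then have "(\<integral>\<^sup>+X. ennreal ((F X)\<^sup>2) \<partial>lborel) < \<infinity>" using loc[OF \<rho>(2,3)] by simp
      from shear_L2_eps[OF F this r] obtain \<delta> where \<delta>: "\<delta> > 0"
        and F\<delta>: "\<And>z a b. norm z < \<delta> \<Longrightarrow> \<bar>a - 1\<bar> < \<delta> \<Longrightarrow> \<bar>b\<bar> < \<delta> \<Longrightarrow>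
         (\<integral>\<^sup>+X. ennreal ((F (shear z a b X) - F X)\<^sup>2) \<partial>lborel) \<le> ennreal r"
        by auto
      have "\<eta> \<longlonglongrightarrow> 0"
        unfolding \<eta>_def using LIMSEQ_ignore_initial_segment[OF lim_1_over_n, of 4] by simp
      \<comment> \<open>The dilation factor differs from 1 by \<open>2 \<eta> j\<close> and the
        vertical translation is below \<open>3/2 \<eta> j\<close>, which \<open>\<delta> / 3\<close>
        accommodates. Probes move points by less than \<open>3/2 \<eta> j\<close>, for which
        \<open>\<rho> / 2\<close> suffices.\<close>
      then have "eventually (\<lambda>j. \<eta> j < min (\<delta> / 3) (min (\<rho> / 2) \<rho>')) sequentially"
        using \<delta> \<rho> \<rho>' by (intro order_tendstoD(2)) auto
      then show "eventually (\<lambda>j. (\<integral>\<^sup>+X. ennreal ((mollify (\<phi> j) (\<eta> j) (f j) X - V X)\<^sup>2) * indicator K X \<partial>lborel) \<le> ennreal r) sequentially"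
        using eventually_ge_at_top[of N]
      proof eventually_elim
        case (elim j)
        have K'D: "K' \<subseteq> D j"
        proof
          fix X assume X: "X \<in> K'"
          then have "fst X \<in> C j" using N[OF elim(2)] by auto
          moreover have "snd X \<in> {\<eta> j / 2..1 - \<eta> j / 2}" using K'snd[OF X] elim(1) \<eta>[of j] by auto
          ultimately show "X \<in> D j" unfolding D_def by (cases X) auto
        qed
        have inK': "probe (\<eta> j) Z X \<in> K'" if X: "X \<in> K" and Z: "norm Z < \<eta> j / 2" for X Z
        proof (rule \<rho>(4)[OF X])
          have "snd X \<in> {0..1}" using X K(2) by (cases X) auto
          from dist_probe_le[OF this, of "\<eta> j" Z] show "dist X (probe (\<eta> j) Z X) \<le> \<rho>"
            using \<eta>[of j] Z elim(1) by auto
        qed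
        show ?case
        proof (rule mollify_L2[OF \<phi> f \<eta>])
          fix X and Z :: "'a \<times> real" assume "X \<in> K" "norm Z < \<eta> j / 2"
          from inK'[OF this] K'D show "f j (probe (\<eta> j) Z X) = F (probe (\<eta> j) Z X)"
            by (auto simp: f_def F_def)
        next
          fix X assume "X \<in> K"
          then have "X \<in> K'" using \<rho>(1) by (intro \<rho>(4)[of X X]) auto
          then show "F X = V X" by (simp add: F_def)
        next
          fix Z :: "'a \<times> real" assume Z: "norm Z < \<eta> j / 2"
          have "norm (fst Z) \<le> norm Z" "\<bar>snd Z\<bar> \<le> norm Z" by (metis norm_fst_le norm_snd_le prod.collapse real_norm_def)+
          then show "(\<integral>\<^sup>+X. ennreal ((F (probe (\<eta> j) Z X) - F X)\<^sup>2) \<partial>lborel) \<le> ennreal r"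
            unfolding probe_def using Z elim(1) \<eta>[of j] by (intro F\<delta>) auto
        qed (use V F in auto)
      qed
    qed
  qed
qed

text \<open>The witness is the largest admissible index not exceeding \<open>1 / \<epsilon>\<close>.
  That bound makes the set of candidates finite, and since each fixed \<open>j\<close> eventually
  belongs to it, the maximum tends to infinity.\<close>

lemma diagonal_choice:
  assumes P: "\<And>j::nat. eventually (P j) (at_right (0::real))"
  obtains N :: "real \<Rightarrow> nat" where "filterlim N at_top (at_right 0)" "eventually (\<lambda>\<epsilon>. P (N \<epsilon>) \<epsilon>) (at_right 0)"
proof -
  define A where "A \<epsilon> = {j. real j \<le> 1 / \<epsilon> \<and> P j \<epsilon>}" for \<epsilon>
  have fin: "finite (A \<epsilon>)" for \<epsilon>
    by (rule finite_subset[of _ "{..nat \<lfloor>1 / \<epsilon>\<rfloor>}"]) (auto simp: A_def le_nat_floor)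
  have ev: "eventually (\<lambda>\<epsilon>. j \<in> A \<epsilon>) (at_right 0)" for j
  proof -
    have "eventually (\<lambda>\<epsilon>::real. 0 < \<epsilon> \<and> \<epsilon> < 1 / real (Suc j)) (at_right 0)"
      by (intro eventually_at_rightI[of 0 "1 / real (Suc j)"]) auto
    then show ?thesis using P[of j]
    proof eventually_elim
      case (elim \<epsilon>)
      then have "real (Suc j) * \<epsilon> < 1" by (simp add: field_simps)
      then have "real j \<le> 1 / \<epsilon>" using elim by (simp add: field_simps)
      then show ?case using elim by (simp add: A_def)
    qed
  qed
  show ?thesis
  proof (rule that[of "\<lambda>\<epsilon>. Max (A \<epsilon>)"])
    show "filterlim (\<lambda>\<epsilon>. Max (A \<epsilon>)) at_top (at_right 0)"
      unfolding filterlim_at_top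
    proof
      fix m
      show "eventually (\<lambda>\<epsilon>. m \<le> Max (A \<epsilon>)) (at_right 0)"
        using ev[of m] by eventually_elim (rule Max_ge[OF fin])
    qed
    show "eventually (\<lambda>\<epsilon>. P (Max (A \<epsilon>)) \<epsilon>) (at_right 0)"
      using ev[of 0]
    proof eventually_elim
      case (elim \<epsilon>)
      then have "Max (A \<epsilon>) \<in> A \<epsilon>" using fin by (intro Max_in) auto
      then show ?case by (simp add: A_def)
    qed
  qed
qed

text \<open>For each fixed approximation the energies converge, and \<open>diagonal_choice\<close>
  lets the index grow slowly enough to keep the error below \<open>1 / Suc (N \<epsilon>)\<close>.
  Every \<open>g \<epsilon>\<close> is bounded and Lipschitz, even where the diagonal estimate does
  not hold yet; this later gives membership in \<open>Hs\<close>.\<close>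

lemma recovery_energy:
  fixes \<omega> :: "'a::euclidean_space set" and V :: "'a \<times> real \<Rightarrow> real"
  assumes \<omega>: "open \<omega>" "bounded \<omega>" and V: "V \<in> borel_measurable borel"
    and loc: "\<And>K. compact K \<Longrightarrow> K \<subseteq> \<omega> \<times> {0<..<1} \<Longrightarrow> (\<integral>\<^sup>+X. ennreal ((V X)\<^sup>2) * indicator K X \<partial>lborel) < \<infinity>"
    and s: "(s \<longlongrightarrow> s0) (at_right 0)" "\<And>\<epsilon>. \<epsilon> > 0 \<Longrightarrow> s \<epsilon> \<in> {0<..<1/2}" and s0: "0 \<le> s0" "s0 \<le> 1/2"
  obtains g :: "real \<Rightarrow> 'a \<times> real \<Rightarrow> real" where
    "\<And>\<epsilon>. \<exists>L. L-lipschitz_on UNIV (g \<epsilon>)" "\<And>\<epsilon>. \<exists>M. \<forall>X. \<bar>g \<epsilon> X\<bar> \<le> M"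
    "Limsup (at_right 0) (\<lambda>\<epsilon>. energy \<omega> \<epsilon> (s \<epsilon>) (g \<epsilon>)) \<le> energy \<omega> 0 s0 V"
    "\<And>K. compact K \<Longrightarrow> K \<subseteq> \<omega> \<times> {0<..<1} \<Longrightarrow>
       ((\<lambda>\<epsilon>. \<integral>\<^sup>+X. ennreal ((g \<epsilon> X - V X)\<^sup>2) * indicator K X \<partial>lborel) \<longlongrightarrow> 0) (at_right 0)"
proof (rule lipschitz_approximation[OF \<omega>(1) V s0(1) loc], assumption, assumption)
  fix g :: "nat \<Rightarrow> 'a \<times> real \<Rightarrow> real"
  assume lip: "\<And>j. \<exists>L. L-lipschitz_on UNIV (g j)" and bnd: "\<And>j. \<exists>M. \<forall>X. \<bar>g j X\<bar> \<le> M"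
    and en: "\<And>j. energy \<omega> 0 s0 (g j) \<le> ennreal (1 / (1 - 2 * (1 / real (j + 4)))\<^sup>2) * energy \<omega> 0 s0 V"
    and conv: "\<And>K. compact K \<Longrightarrow> K \<subseteq> \<omega> \<times> {0<..<1} \<Longrightarrow>
       (\<lambda>j. \<integral>\<^sup>+X. ennreal ((g j X - V X)\<^sup>2) * indicator K X \<partial>lborel) \<longlonglongrightarrow> 0"
  let ?E = "energy \<omega> 0 s0 V"
  have ev: "eventually (\<lambda>\<epsilon>. energy \<omega> \<epsilon> (s \<epsilon>) (g j) \<le> energy \<omega> 0 s0 (g j) + ennreal (1 / real (Suc j))) (at_right 0)" for j
  proof -
    obtain L M where LM: "L-lipschitz_on UNIV (g j)" "\<And>X. \<bar>g j X\<bar> \<le> M" using lip bnd by meson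
    \<comment> \<open>Finiteness turns the added \<open>1 / Suc j\<close> into a strict gap, as
      needed to pass from the limit to an eventual bound.\<close>
    have "energy \<omega> 0 s0 (g j) < \<infinity>"
      by (rule energy_lipschitz_finite[OF \<omega> LM]) (use s0 in auto)
    then have "energy \<omega> 0 s0 (g j) < energy \<omega> 0 s0 (g j) + ennreal (1 / real (Suc j))"
      using ennreal_add_left_cancel_less[of "energy \<omega> 0 s0 (g j)" 0 "ennreal (1 / real (Suc j))"] by simp
    from order_tendstoD(2)[OF energy_lipschitz_tendsto[OF \<omega> LM s] this]
    show ?thesis by (auto elim: eventually_mono)
  qed
  show thesis
  proof (rule diagonal_choice[OF ev])
    fix N :: "real \<Rightarrow> nat"
    assume N: "filterlim N at_top (at_right 0)"
      and EN: "eventually (\<lambda>\<epsilon>. energy \<omega> \<epsilon> (s \<epsilon>) (g (N \<epsilon>)) \<le> energy \<omega> 0 s0 (g (N \<epsilon>)) + ennreal (1 / real (Suc (N \<epsilon>)))) (at_right 0)"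
    show thesis
    proof (rule that[of "\<lambda>\<epsilon>. g (N \<epsilon>)"])
      fix K :: "('a \<times> real) set" assume "compact K" "K \<subseteq> \<omega> \<times> {0<..<1}"
      from filterlim_compose[OF conv[OF this] N]
      show "((\<lambda>\<epsilon>. \<integral>\<^sup>+X. ennreal ((g (N \<epsilon>) X - V X)\<^sup>2) * indicator K X \<partial>lborel) \<longlongrightarrow> 0) (at_right 0)" .
    next
      show "Limsup (at_right 0) (\<lambda>\<epsilon>. energy \<omega> \<epsilon> (s \<epsilon>) (g (N \<epsilon>))) \<le> ?E"
      proof (cases "?E = top")
        case False
        let ?b = "\<lambda>j::nat. ennreal (1 / (1 - 2 * (1 / real (j + 4)))\<^sup>2) * ?E + ennreal (1 / real (Suc j))"
        have "(\<lambda>j. 1 / (1 - 2 * (1 / real (j + 4)))\<^sup>2) \<longlonglongrightarrow> 1 / (1 - 2 * 0)\<^sup>2"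
          by (intro tendsto_intros LIMSEQ_ignore_initial_segment[OF lim_1_over_n]) auto
        moreover have "(\<lambda>j. 1 / real (Suc j)) \<longlonglongrightarrow> 0"
          using LIMSEQ_ignore_initial_segment[OF lim_1_over_n, of 1] by simp
        ultimately have "?b \<longlonglongrightarrow> ennreal (1 / (1 - 2 * 0)\<^sup>2) * ?E + ennreal 0"
          using False by (intro tendsto_add tendsto_mult_ennreal tendsto_ennrealI tendsto_const) auto
        then have "?b \<longlonglongrightarrow> ?E" by simp
        from filterlim_compose[OF this N]
        have b: "((\<lambda>\<epsilon>. ?b (N \<epsilon>)) \<longlongrightarrow> ?E) (at_right 0)" .
        have "eventually (\<lambda>\<epsilon>. energy \<omega> \<epsilon> (s \<epsilon>) (g (N \<epsilon>)) \<le> ?b (N \<epsilon>)) (at_right 0)"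
          using EN by eventually_elim (meson add_right_mono en order_trans)
        then have "Limsup (at_right 0) (\<lambda>\<epsilon>. energy \<omega> \<epsilon> (s \<epsilon>) (g (N \<epsilon>))) \<le> Limsup (at_right 0) (\<lambda>\<epsilon>. ?b (N \<epsilon>))"
          by (rule Limsup_mono)
        also have "\<dots> = ?E" by (rule lim_imp_Limsup[OF _ b]) simp
        finally show ?thesis .
      qed simp
    qed (rule lip bnd)+
  qed
qed

section \<open>Return to the original variables\<close>

text \<open>The representatives differ on a null subset of the thin domain. \<open>AE_shear\<close>
  pulls it back along the rescaling of the height, so the convergence can be tested with Borel
  functions.\<close>

lemma thin_conv_iff:
  fixes \<omega> :: "'a::euclidean_space set"
  assumes u: "\<And>\<epsilon>. \<epsilon> > 0 \<Longrightarrow> AE X in lborel. X \<in> thin_domain \<omega> \<epsilon> \<longrightarrow> u \<epsilon> X = U \<epsilon> X"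
    and v: "AE X in lborel. X \<in> \<omega> \<times> {0<..<1} \<longrightarrow> v X = V X"
  shows "thin_conv \<omega> u v \<longleftrightarrow> (\<forall>K. compact K \<and> K \<subseteq> \<omega> \<times> {0<..<1} \<longrightarrow>
    ((\<lambda>\<epsilon>. \<integral>\<^sup>+X. ennreal ((U \<epsilon> (fst X, \<epsilon> * snd X) - V X)\<^sup>2) * indicator K X \<partial>lborel) \<longlongrightarrow> 0) (at_right 0))"
  unfolding thin_conv_def L2_loc_tendsto_def
proof (intro all_cong tendsto_cong)
  fix K :: "('a \<times> real) set" assume K: "compact K \<and> K \<subseteq> \<omega> \<times> {0<..<1}"
  then have Kl: "K \<in> sets lebesgue" by (auto dest: borel_compact)
  have "eventually (\<lambda>\<epsilon>::real. 0 < \<epsilon>) (at_right 0)" by (simp add: eventually_at_right_less)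
  then show "eventually (\<lambda>\<epsilon>. (\<integral>\<^sup>+X. ennreal (\<bar>(case X of (x', t) \<Rightarrow> u \<epsilon> (x', \<epsilon> * t)) - v X\<bar>\<^sup>2) \<partial>lebesgue_on K) =
      (\<integral>\<^sup>+X. ennreal ((U \<epsilon> (fst X, \<epsilon> * snd X) - V X)\<^sup>2) * indicator K X \<partial>lborel)) (at_right 0)"
  proof eventually_elim
    case (elim \<epsilon>)
    have "AE X in lborel. shear 0 \<epsilon> 0 X \<in> thin_domain \<omega> \<epsilon> \<longrightarrow> u \<epsilon> (shear 0 \<epsilon> 0 X) = U \<epsilon> (shear 0 \<epsilon> 0 X)"
      by (rule AE_shear[OF u[OF elim] elim])
    then show ?case unfolding nn_integral_lebesgue_on[OF Kl] using v
    proof (intro nn_integral_cong_AE, eventually_elim)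
      case (elim X)
      show ?case
      proof (cases "X \<in> K")
        case True
        then have X: "X \<in> \<omega> \<times> {0<..<1}" using K by blast
        then have "shear 0 \<epsilon> 0 X \<in> thin_domain \<omega> \<epsilon>"
          using \<open>\<epsilon> > 0\<close> by (cases X) (auto simp: shear_def thin_domain_def)
        then show ?thesis using elim X by (cases X) (simp add: shear_def)
      qed simp
    qed
  qed
qed

theorem theorem6p3:
  fixes \<omega> :: "'a::euclidean_space set"
    and s :: "real \<Rightarrow> real"
    and s\<^sub>0 :: real
  assumes "bounded_lipschitz_set \<omega>"
    and "\<And>\<epsilon>. \<epsilon> > 0 \<Longrightarrow> s \<epsilon> \<in> {0<..<1/2}"
    and "s\<^sub>0 \<in> {0..<1/2}"
    and "(s \<longlongrightarrow> s\<^sub>0) (at_right 0)"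
  shows "gamma_converges
           (\<lambda>\<epsilon>. Hs (s \<epsilon>) (thin_domain \<omega> \<epsilon>)) (thin_energy \<omega> s)
           (thin_conv \<omega>)
           (L2_loc (\<omega> \<times> {0<..<1})) (limit_energy \<omega> s\<^sub>0)"
  unfolding gamma_converges_def
proof (intro ballI conjI allI impI)
  have \<omega>: "open \<omega>" "bounded \<omega>" using assms(1) by (auto simp: bounded_lipschitz_set_def)
  have S: "open (\<omega> \<times> {0<..<1::real})" using \<omega> by (intro open_Times) auto
  then have Sl: "\<omega> \<times> {0<..<1::real} \<in> sets lebesgue" by auto
  have "open (thin_domain \<omega> \<epsilon>)" for \<epsilon> unfolding thin_domain_def using \<omega> by (intro open_Times) auto
  then have Tl: "thin_domain \<omega> \<epsilon> \<in> sets lebesgue" for \<epsilon> by auto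
  have pos: "eventually (\<lambda>\<epsilon>::real. 0 < \<epsilon>) (at_right 0)" by (simp add: eventually_at_right_less)
  fix v :: "'a \<times> real \<Rightarrow> real" assume v: "v \<in> L2_loc (\<omega> \<times> {0<..<1})"
  then have "v \<in> borel_measurable (lebesgue_on (\<omega> \<times> {0<..<1}))" by (simp add: L2_loc_def)
  from borel_representative[OF Sl this] obtain V
    where V: "V \<in> borel_measurable borel" and ae: "AE X in lborel. X \<in> \<omega> \<times> {0<..<1} \<longrightarrow> v X = V X" .
  have lim: "limit_energy \<omega> s\<^sub>0 v = energy \<omega> 0 s\<^sub>0 V" by (rule limit_energy_eq_energy[OF \<omega>(1) V ae])
  have loc: "(\<integral>\<^sup>+X. ennreal ((V X)\<^sup>2) * indicator K X \<partial>lborel) < \<infinity>"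
    if K: "compact K" "K \<subseteq> \<omega> \<times> {0<..<1}" for K
  proof -
    have Kl: "K \<in> sets lebesgue" using K by (auto dest: borel_compact)
    have "(\<integral>\<^sup>+X. ennreal (\<bar>v X\<bar>\<^sup>2) \<partial>lebesgue_on K) < \<infinity>" using v K by (auto simp: L2_loc_def L2_def)
    also have "(\<integral>\<^sup>+X. ennreal (\<bar>v X\<bar>\<^sup>2) \<partial>lebesgue_on K) = (\<integral>\<^sup>+X. ennreal ((V X)\<^sup>2) * indicator K X \<partial>lborel)"
      unfolding nn_integral_lebesgue_on[OF Kl]
      by (rule nn_integral_cong_AE, use ae in eventually_elim) (use K in \<open>auto simp: indicator_def\<close>)
    finally show ?thesis .
  qed
  {
    fix u assume u: "(\<forall>\<epsilon>>0. u \<epsilon> \<in> Hs (s \<epsilon>) (thin_domain \<omega> \<epsilon>)) \<and> thin_conv \<omega> u v"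
    \<comment> \<open>For \<open>\<epsilon> \<le> 0\<close> nothing is known about
      \<open>u \<epsilon>\<close>; the constant 0 keeps \<open>U\<close> a family of Borel functions
      over all real indices.\<close>
    have "\<exists>U. U \<in> borel_measurable borel \<and> (\<epsilon> > 0 \<longrightarrow> (AE X in lborel. X \<in> thin_domain \<omega> \<epsilon> \<longrightarrow> u \<epsilon> X = U X))" for \<epsilon>
    proof (cases "\<epsilon> > 0")
      case True
      then have "u \<epsilon> \<in> borel_measurable (lebesgue_on (thin_domain \<omega> \<epsilon>))" using u by (auto simp: Hs_def L2_def)
      from borel_representative[OF Tl this] show ?thesis by metis
    qed (auto intro: exI[of _ "\<lambda>_. 0"])
    then obtain U where U: "\<And>\<epsilon>. U \<epsilon> \<in> borel_measurable borel"
      and aeU: "\<And>\<epsilon>. \<epsilon> > 0 \<Longrightarrow> AE X in lborel. X \<in> thin_domain \<omega> \<epsilon> \<longrightarrow> u \<epsilon> X = U \<epsilon> X" by metis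
    define W where "W \<epsilon> = (\<lambda>X. U \<epsilon> (fst X, \<epsilon> * snd X))" for \<epsilon>
    have W: "W \<epsilon> \<in> borel_measurable borel" for \<epsilon>
      unfolding W_def by (rule measurable_compose[OF borel_measurable_continuous_onI U]) (intro continuous_intros)
    have conv: "((\<lambda>\<epsilon>. \<integral>\<^sup>+X. ennreal ((W \<epsilon> X - V X)\<^sup>2) * indicator K X \<partial>lborel) \<longlongrightarrow> 0) (at_right 0)"
      if "compact K" "K \<subseteq> \<omega> \<times> {0<..<1}" for K
      using thin_conv_iff[OF aeU ae] u that by (simp add: W_def)
    have "limit_energy \<omega> s\<^sub>0 v \<le> Liminf (at_right 0) (\<lambda>\<epsilon>. energy \<omega> \<epsilon> (s \<epsilon>) (W \<epsilon>))"
      unfolding lim by (rule liminf_energy[OF \<omega>(1) W V loc conv assms(4)])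
    also have "\<dots> \<le> Liminf (at_right 0) (\<lambda>\<epsilon>. thin_energy \<omega> s \<epsilon> (u \<epsilon>))"
      by (rule Liminf_mono, use pos in eventually_elim)
         (simp add: thin_energy_eq_energy[OF \<omega>(1) U _ aeU] W_def)
    finally show "limit_energy \<omega> s\<^sub>0 v \<le> Liminf (at_right 0) (\<lambda>\<epsilon>. thin_energy \<omega> s \<epsilon> (u \<epsilon>))" .
  next
    show "\<exists>u. (\<forall>\<epsilon>>0. u \<epsilon> \<in> Hs (s \<epsilon>) (thin_domain \<omega> \<epsilon>)) \<and> thin_conv \<omega> u v \<and>
       Limsup (at_right 0) (\<lambda>\<epsilon>. thin_energy \<omega> s \<epsilon> (u \<epsilon>)) \<le> limit_energy \<omega> s\<^sub>0 v"
    proof (rule recovery_energy[OF \<omega> V loc assms(4,2)])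
      show "0 \<le> s\<^sub>0" "s\<^sub>0 \<le> 1/2" using assms(3) by auto
      fix g :: "real \<Rightarrow> 'a \<times> real \<Rightarrow> real"
      assume lip: "\<And>\<epsilon>. \<exists>L. L-lipschitz_on UNIV (g \<epsilon>)" and bnd: "\<And>\<epsilon>. \<exists>M. \<forall>X. \<bar>g \<epsilon> X\<bar> \<le> M"
        and sup: "Limsup (at_right 0) (\<lambda>\<epsilon>. energy \<omega> \<epsilon> (s \<epsilon>) (g \<epsilon>)) \<le> energy \<omega> 0 s\<^sub>0 V"
        and conv: "\<And>K. compact K \<Longrightarrow> K \<subseteq> \<omega> \<times> {0<..<1} \<Longrightarrow>
         ((\<lambda>\<epsilon>. \<integral>\<^sup>+X. ennreal ((g \<epsilon> X - V X)\<^sup>2) * indicator K X \<partial>lborel) \<longlongrightarrow> 0) (at_right 0)"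
      \<comment> \<open>The inverse of the rescaling: seen in the fixed cylinder,
        \<open>u \<epsilon>\<close> is exactly \<open>g \<epsilon>\<close>.\<close>
      define u where "u \<epsilon> = (\<lambda>X. g \<epsilon> (fst X, snd X / \<epsilon>))" for \<epsilon>
      have gm: "g \<epsilon> \<in> borel_measurable borel" for \<epsilon>
        using lip[of \<epsilon>] by (auto intro: borel_measurable_continuous_onI lipschitz_on_continuous_on)
      have um: "u \<epsilon> \<in> borel_measurable borel" if "\<epsilon> > 0" for \<epsilon>
        unfolding u_def by (rule measurable_compose[OF borel_measurable_continuous_onI gm]) (use that in \<open>intro continuous_intros; simp\<close>)
      have en: "thin_energy \<omega> s \<epsilon> (u \<epsilon>) = energy \<omega> \<epsilon> (s \<epsilon>) (g \<epsilon>)" if "\<epsilon> > 0" for \<epsilon>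
        using thin_energy_eq_energy[OF \<omega>(1) um[OF that] that, of "u \<epsilon>" s] that by (simp add: u_def)
      show ?thesis
      proof (intro exI[of _ u] conjI allI impI)
        fix \<epsilon> :: real assume \<epsilon>: "\<epsilon> > 0"
        obtain L M where LM: "L-lipschitz_on UNIV (g \<epsilon>)" "\<And>X. \<bar>g \<epsilon> X\<bar> \<le> M" using lip bnd by meson
        have "energy \<omega> \<epsilon> (s \<epsilon>) (g \<epsilon>) < \<infinity>"
          by (rule energy_lipschitz_finite[OF \<omega> LM]) (use assms(2)[OF \<epsilon>] \<epsilon> in auto)
        \<comment> \<open>The prefactor in \<open>thin_energy\<close> is positive, so finite energy
          forces a finite seminorm.\<close>
        then have "seminorm_sq (s \<epsilon>) (thin_domain \<omega> \<epsilon>) (u \<epsilon>) < \<infinity>"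
          using \<epsilon> unfolding en[OF \<epsilon>, symmetric] thin_energy_def by (auto simp: ennreal_mult_less_top ennreal_eq_0_iff)
        moreover have "u \<epsilon> \<in> L2 (thin_domain \<omega> \<epsilon>)"
        proof -
          have "(\<integral>\<^sup>+X. ennreal (\<bar>u \<epsilon> X\<bar>\<^sup>2) \<partial>lebesgue_on (thin_domain \<omega> \<epsilon>)) \<le> (\<integral>\<^sup>+X. ennreal (M\<^sup>2) * indicator (thin_domain \<omega> \<epsilon>) X \<partial>lborel)"
            unfolding nn_integral_lebesgue_on[OF Tl]
            by (intro nn_integral_mono mult_right_mono ennreal_leI power_mono) (auto simp: u_def LM(2))
          also have "\<dots> = ennreal (M\<^sup>2) * emeasure lborel (thin_domain \<omega> \<epsilon>)"
            by (intro nn_integral_cmult_indicator) (use \<open>\<And>\<epsilon>. open (thin_domain \<omega> \<epsilon>)\<close> in auto)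
          also have "\<dots> < \<infinity>"
          proof -
            have "bounded (thin_domain \<omega> \<epsilon>)" unfolding thin_domain_def using \<omega> by (intro bounded_Times) auto
            then have "emeasure lborel (thin_domain \<omega> \<epsilon>) < \<infinity>" by (rule emeasure_bounded_finite)
            then show ?thesis by (simp add: ennreal_mult_less_top)
          qed
          finally have "(\<integral>\<^sup>+X. ennreal (\<bar>u \<epsilon> X\<bar>\<^sup>2) \<partial>lebesgue_on (thin_domain \<omega> \<epsilon>)) < \<infinity>" .
          moreover have "u \<epsilon> \<in> borel_measurable (lebesgue_on (thin_domain \<omega> \<epsilon>))"
            using um[OF \<epsilon>] by (intro measurable_restrict_space1 measurable_completion) simp
          ultimately show ?thesis by (simp add: L2_def)
        qed
        ultimately show "u \<epsilon> \<in> Hs (s \<epsilon>) (thin_domain \<omega> \<epsilon>)" by (simp add: Hs_def)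
      next
        have "((\<lambda>\<epsilon>. \<integral>\<^sup>+X. ennreal ((u \<epsilon> (fst X, \<epsilon> * snd X) - V X)\<^sup>2) * indicator K X \<partial>lborel) \<longlongrightarrow> 0) (at_right 0)"
          if K: "compact K" "K \<subseteq> \<omega> \<times> {0<..<1}" for K
          by (rule Lim_transform_eventually[OF conv[OF K]], use pos in eventually_elim) (simp add: u_def)
        then show "thin_conv \<omega> u v" using thin_conv_iff[of \<omega> u u v V] ae by simp
      next
        have "Limsup (at_right 0) (\<lambda>\<epsilon>. thin_energy \<omega> s \<epsilon> (u \<epsilon>)) \<le> Limsup (at_right 0) (\<lambda>\<epsilon>. energy \<omega> \<epsilon> (s \<epsilon>) (g \<epsilon>))"
          by (rule Limsup_mono, use pos in eventually_elim) (simp add: en)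
        also note sup
        finally show "Limsup (at_right 0) (\<lambda>\<epsilon>. thin_energy \<omega> s \<epsilon> (u \<epsilon>)) \<le> limit_energy \<omega> s\<^sub>0 v" unfolding lim .
      qed
    qed
  }
qed

end
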